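(* Let $D\subset\mathbb R^d$ be a bounded domain. Suppose that $\mathbf X\in\boldsymbol\Theta\cup\boldsymbol\Sigma$ and, in case $\mathbf X\in\boldsymbol\Theta$, additionally that $\mathbf X$ is $\beta$-mixing with strictly decreasing rate function $\Xi(t)$ (for $\mathbf X\in\boldsymbol\Sigma$, $\mathbf X$ is by definition $\beta$-mixing with $\Xi(t)=c_\kappa e^{-\kappa t}$). Then, for any $u_T\ge1$ such that $\Xi^{-1}(T^{-u_T})\in\mathsf o(T)$ and any bandwidth $h=h_T$ with $T^{-2}\le h_T\in\mathsf o(1)$ (as $T\to\infty$), there exists a constant $c^*>0$ such that for large enough $T$ $$\mathbb P\Big(\|\hat\rho_{h,T}-\mathbb E\hat\rho_{h,T}\|_{L^\infty(D)}\ge c^*\Big(\frac{u_T+\log T}{Th^d}\,\Xi^{-1}(T^{-u_T})+T^{-\frac12}\psi_d(h^d)\sqrt{u_T\vee\log(h^{-1})}\Big)\Big)\le e^{-u_T}.$$ In particular, when $\mathbf X\in\boldsymbol\Sigma$, for any $\gamma>0$ and $u_T\in[1,\gamma\log T]$ there exists a constant $c_\gamma>0$ such that for large enough $T$ $$\mathbb P\Big(\|\hat\rho_{h,T}-\mathbb E\hat\rho_{h,T}\|_{L^\infty(D)}\ge c_\gamma\Upsilon_{h,T}(u_T)\Big)\le e^{-u_T},$$ where $$\Upsilon_{h,T}(u)=\frac{u(\log T)^2}{Th^d}+T^{-\frac12}\psi_d(h^d)\sqrt{u\vee\log(h^{-1})},\qquad u\ge1.$$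
   Context: $\mathbf X=(X_t)_{t\ge 0}$ with laws $(\mathbb P^x)_{x\in\mathbb R^d}$ is a non-explosive Borel right Markov process with state space $(\mathbb R^d,\mathcal B(\mathbb R^d))$ and semigroup $P_t(x,B)=\mathbb P^x(X_t\in B)$. $\mathbb P=\mathbb P^\mu$, $\mathbb E=\mathbb E^\mu$, where $\mu$ is the invariant distribution below; $\|\nu\|_{\mathrm{TV}}=\sup_{|f|\le1}|\nu(f)|$. A Borel set $B$ is $\mu$-full if $\mu(B)=1$. Conditions. (Basic assumption) For any $t>0$ there is a measurable transition density $p_t$ with $P_t(x,B)=\int_Bp_t(x,y)\,dy$, and there is a unique invariant probability measure $\mu$, absolutely continuous with density $\rho$. (Short-time bound) If $d=1$: $\sup_{x,y}p_t(x,y)\le\alpha(t)$ for $t\in(0,1]$ with a non-negative measurable $\alpha$ satisfying $\int_{0+}^1\alpha(t)\,dt<\infty$; if $d\ge2$: $\sup_{x,y}p_t(x,y)\le c_2t^{-d/2}$ for $t\in(0,1]$ and some $c_2>0$. (Local uniform convergence) There is a $\mu$-full set $\Lambda$ such that for every compact $\mathcal S\subset\mathbb R^d$ there is a non-negative measurable $r_{\mathcal S}$ on $(0,\infty)$ with $\sup_{x\in\mathcal S\cap\Lambda,y\in\mathcal S}|p_t(x,y)-\rho(y)|\le r_{\mathcal S}(t)$ for all $t>1$ and $c_{\mathcal S}=\int_1^\infty r_{\mathcal S}(t)\,dt<\infty$. (Monotonicity) $\mathcal S_1\subset\mathcal S_2$ implies $c_{\mathcal S_1}\le c_{\mathcal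 S_2}$. $\mathbf X$ is $\beta$-mixing with rate function $\Xi$ (decreasing to $0$) if $\int\|P_t(x,\cdot)-\mu\|_{\mathrm{TV}}\,\mu(dx)\le\Xi(t)$; exponentially $\beta$-mixing if this holds with $\Xi(t)=c_\kappa e^{-\kappa t}$ for some $c_\kappa,\kappa>0$. Classes. $\boldsymbol\Sigma$: non-explosive, exponentially $\beta$-mixing Borel right Markov processes satisfying the basic assumption and the short-time bound (so $\rho$ has a bounded version), and, if $d=1$, additionally local uniform convergence with monotonicity. $\boldsymbol\Theta$: $d$-dimensional non-explosive Borel right processes satisfying the basic assumption, the short-time bound, and local uniform convergence with monotonicity. Estimator. $\hat\rho_{h,T}(x)=\frac1T\int_0^TK_h(x-X_s)\,ds$, $K_h(\cdot)=h^{-d}K(\cdot/h)$, where $K:\mathbb R^d\to\mathbb R$ is a smooth, Lipschitz continuous kernel function with compact support $[-1/2,1/2]^d$. $\|\cdot\|_{L^\infty(D)}$ is the sup-norm restricted to $D$. $\psi_1(x)=1$, $\psi_2(x)=\sqrt{1+\log(1/x)}$, $\psi_d(x)=x^{\frac1d-\frac12}$ for $d\ge3$. *)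

theory Defs
  imports "HOL-Probability.Probability" "HOL-Library.Landau_Symbols"
begin

section \<open>Borel right processes on Euclidean space\<close>

text \<open>
  A process is given by a measurable space \<open>M\<close> (only its carrier and its sigma-algebra are used),
  the paths \<open>X\<close> and the laws \<open>P\<close>; \<open>P x\<close> is the law started in \<open>x\<close>. The time parameter has type
  \<^typ>\<open>real\<close> and only times \<open>t \<ge> 0\<close> are ever looked at. The law with initial distribution \<open>\<nu>\<close>
  is \<open>\<nu> \<bind> P\<close>.
\<close>

definition transition :: "(real \<Rightarrow> 'w \<Rightarrow> 'a::euclidean_space) \<Rightarrow> ('a \<Rightarrow> 'w measure) \<Rightarrow> real \<Rightarrow> 'a \<Rightarrow> 'a measure" where
  "transition X P t x = distr (P x) borel (X t)"

definition natural_filtration :: "'w measure \<Rightarrow> (real \<Rightarrow> 'w \<Rightarrow> 'a::euclidean_space) \<Rightarrow> real \<Rightarrow> 'w measure" where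
  "natural_filtration M X t =
     sigma (space M) (\<Union>s\<in>{0..t}. (\<lambda>B. X s -` B \<inter> space M) ` sets borel)"

definition universally_measurable :: "('a::euclidean_space \<Rightarrow> ennreal) \<Rightarrow> bool" where
  "universally_measurable f \<longleftrightarrow>
     (\<forall>\<nu>. finite_measure \<nu> \<and> sets \<nu> = sets borel \<longrightarrow> f \<in> borel_measurable (completion \<nu>))"

text \<open>
  For universally measurable \<open>f\<close> the integral below is the one with respect to the completed
  transition probability, see \<open>nn_integral_completion\<close>.
\<close>

definition excessive ::
  "(real \<Rightarrow> 'w \<Rightarrow> 'a::euclidean_space) \<Rightarrow> ('a \<Rightarrow> 'w measure) \<Rightarrow> real \<Rightarrow> ('a \<Rightarrow> ennreal) \<Rightarrow> bool" where
  "excessive X P \<alpha> f \<longleftrightarrow>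
     universally_measurable f \<and>
     (\<forall>x. (\<forall>t>0. ennreal (exp (- \<alpha> * t)) * (\<integral>\<^sup>+y. f y \<partial>transition X P t x) \<le> f x) \<and>
          ((\<lambda>t. ennreal (exp (- \<alpha> * t)) * (\<integral>\<^sup>+y. f y \<partial>transition X P t x)) \<longlongrightarrow> f x) (at_right 0))"

text \<open>
  Right process in the sense of Sharpe, with Borel kernels: a normal Markov process with right
  continuous paths whose \<open>\<alpha>\<close>-excessive functions are almost surely right continuous along the paths,
  for every initial law. The process is non-explosive because the \<open>P x\<close> are probability measures and
  \<open>X\<close> never leaves the state space. The Markov property is required for the natural filtration only;
  it follows from the one for any larger filtration. Shift operators, a further ingredient of the
  usual canonical setting, are not needed.
\<close>

definition borel_right_process ::
  "'w measure \<Rightarrow> (real \<Rightarrow> 'w \<Rightarrow> 'a::euclidean_space) \<Rightarrow> ('a \<Rightarrow> 'w measure) \<Rightarrow> bool" where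
  "borel_right_process M X P \<longleftrightarrow>
     P \<in> borel \<rightarrow>\<^sub>M prob_algebra M \<and>
     (\<forall>t\<ge>0. X t \<in> M \<rightarrow>\<^sub>M borel) \<and>
     (\<forall>\<omega>\<in>space M. \<forall>t\<ge>0. continuous (at_right t) (\<lambda>s. X s \<omega>)) \<and>
     (\<forall>x. AE \<omega> in P x. X 0 \<omega> = x) \<and>
     (\<forall>x. \<forall>s\<ge>0. \<forall>t\<ge>0. \<forall>B\<in>sets borel. AE \<omega> in P x.
        real_cond_exp (P x) (natural_filtration M X t) (\<lambda>\<omega>'. indicator B (X (t + s) \<omega>')) \<omega> =
        measure (transition X P s (X t \<omega>)) B) \<and>
     (\<forall>\<nu> \<alpha> f. prob_space \<nu> \<and> sets \<nu> = sets borel \<and> \<alpha> > 0 \<and> excessive X P \<alpha> f \<longrightarrow>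
        (AE \<omega> in \<nu> \<bind> P. \<forall>t\<ge>0. continuous (at_right t) (\<lambda>s. f (X s \<omega>))))"


section \<open>Conditions on the process\<close>

definition invariant_distribution ::
  "(real \<Rightarrow> 'w \<Rightarrow> 'a::euclidean_space) \<Rightarrow> ('a \<Rightarrow> 'w measure) \<Rightarrow> 'a measure \<Rightarrow> bool" where
  "invariant_distribution X P \<mu> \<longleftrightarrow>
     prob_space \<mu> \<and> sets \<mu> = sets borel \<and> (\<forall>t\<ge>0. \<mu> \<bind> transition X P t = \<mu>)"

definition basic_assumption ::
  "(real \<Rightarrow> 'w \<Rightarrow> 'a::euclidean_space) \<Rightarrow> ('a \<Rightarrow> 'w measure) \<Rightarrow> 'a measure \<Rightarrow>
   (real \<Rightarrow> 'a \<Rightarrow> 'a \<Rightarrow> real) \<Rightarrow> ('a \<Rightarrow> real) \<Rightarrow> bool" where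
  "basic_assumption X P \<mu> p \<rho> \<longleftrightarrow>
     (\<forall>t>0. (\<lambda>z. p t (fst z) (snd z)) \<in> borel_measurable (borel \<Otimes>\<^sub>M borel) \<and>
            (\<forall>x y. 0 \<le> p t x y) \<and>
            (\<forall>x. transition X P t x = density lborel (\<lambda>y. ennreal (p t x y)))) \<and>
     invariant_distribution X P \<mu> \<and>
     (\<forall>\<nu>. invariant_distribution X P \<nu> \<longrightarrow> \<nu> = \<mu>) \<and>
     \<rho> \<in> borel_measurable borel \<and> (\<forall>y. 0 \<le> \<rho> y) \<and> \<mu> = density lborel (\<lambda>y. ennreal (\<rho> y))"

definition short_time_bound :: "(real \<Rightarrow> 'a::euclidean_space \<Rightarrow> 'a \<Rightarrow> real) \<Rightarrow> bool" where
  "short_time_bound p \<longleftrightarrow>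
     (DIM('a) = 1 \<longrightarrow>
        (\<exists>\<alpha>. (\<forall>t\<in>{0<..1}. 0 \<le> \<alpha> t \<and> (\<forall>x y. p t x y \<le> \<alpha> t)) \<and>
             set_integrable lborel {0<..1} \<alpha>)) \<and>
     (DIM('a) \<ge> 2 \<longrightarrow>
        (\<exists>c>0. \<forall>t\<in>{0<..1}. \<forall>x y. p t x y \<le> c * t powr (- real DIM('a) / 2)))"

definition local_uniform_convergence ::
  "'a::euclidean_space measure \<Rightarrow> (real \<Rightarrow> 'a \<Rightarrow> 'a \<Rightarrow> real) \<Rightarrow> ('a \<Rightarrow> real) \<Rightarrow> bool" where
  "local_uniform_convergence \<mu> p \<rho> \<longleftrightarrow>
     (\<exists>\<Lambda>\<in>sets borel. \<exists>r :: 'a set \<Rightarrow> real \<Rightarrow> real.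
        emeasure \<mu> \<Lambda> = 1 \<and>
        (\<forall>S. compact S \<longrightarrow>
           set_borel_measurable borel {0<..} (r S) \<and> (\<forall>t>0. 0 \<le> r S t) \<and>
           (\<forall>t>1. \<forall>x\<in>S \<inter> \<Lambda>. \<forall>y\<in>S. \<bar>p t x y - \<rho> y\<bar> \<le> r S t) \<and>
           set_integrable lborel {1<..} (r S)) \<and>
        (\<forall>S S'. compact S \<and> compact S' \<and> S \<subseteq> S' \<longrightarrow>
           (LINT t:{1<..}|lborel. r S t) \<le> (LINT t:{1<..}|lborel. r S' t)))"

text \<open>The total variation norm of \<open>\<nu> - \<nu>'\<close> as a supremum over \<open>\<bar>f\<bar> \<le> 1\<close> (so with values in \<open>[0, 2]\<close>).\<close>

definition tv_norm_diff :: "'a::euclidean_space measure \<Rightarrow> 'a measure \<Rightarrow> real" where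
  "tv_norm_diff \<nu> \<nu>' =
     (SUP f\<in>{f \<in> borel_measurable borel. \<forall>x. \<bar>f x\<bar> \<le> (1::real)}. \<bar>(\<integral>y. f y \<partial>\<nu>) - (\<integral>y. f y \<partial>\<nu>')\<bar>)"

text \<open>Rate functions are functions on \<open>(0, \<infinity>)\<close>; the value of \<open>\<Xi>\<close> elsewhere is irrelevant.\<close>

definition beta_mixing ::
  "(real \<Rightarrow> 'w \<Rightarrow> 'a::euclidean_space) \<Rightarrow> ('a \<Rightarrow> 'w measure) \<Rightarrow> 'a measure \<Rightarrow> (real \<Rightarrow> real) \<Rightarrow> bool" where
  "beta_mixing X P \<mu> \<Xi> \<longleftrightarrow>
     antimono_on {0<..} \<Xi> \<and> (\<Xi> \<longlongrightarrow> 0) at_top \<and>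
     (\<forall>t>0. (\<integral>\<^sup>+x. ennreal (tv_norm_diff (transition X P t x) \<mu>) \<partial>\<mu>) \<le> ennreal (\<Xi> t))"

definition exponential_rate :: "(real \<Rightarrow> real) \<Rightarrow> bool" where
  "exponential_rate \<Xi> \<longleftrightarrow> (\<exists>c>0. \<exists>\<kappa>>0. \<Xi> = (\<lambda>t. c * exp (- \<kappa> * t)))"

definition exponentially_beta_mixing ::
  "(real \<Rightarrow> 'w \<Rightarrow> 'a::euclidean_space) \<Rightarrow> ('a \<Rightarrow> 'w measure) \<Rightarrow> 'a measure \<Rightarrow> bool" where
  "exponentially_beta_mixing X P \<mu> \<longleftrightarrow> (\<exists>\<Xi>. exponential_rate \<Xi> \<and> beta_mixing X P \<mu> \<Xi>)"

text \<open>
  The densities are only determined almost everywhere; all pointwise bounds refer to one common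
  choice of versions \<open>p\<close> and \<open>\<rho>\<close>.
\<close>

definition class_Sigma ::
  "'w measure \<Rightarrow> (real \<Rightarrow> 'w \<Rightarrow> 'a::euclidean_space) \<Rightarrow> ('a \<Rightarrow> 'w measure) \<Rightarrow> 'a measure \<Rightarrow> bool" where
  "class_Sigma M X P \<mu> \<longleftrightarrow>
     borel_right_process M X P \<and> exponentially_beta_mixing X P \<mu> \<and>
     (\<exists>p \<rho>. basic_assumption X P \<mu> p \<rho> \<and> short_time_bound p \<and>
            (DIM('a) = 1 \<longrightarrow> local_uniform_convergence \<mu> p \<rho>))"

definition class_Theta ::
  "'w measure \<Rightarrow> (real \<Rightarrow> 'w \<Rightarrow> 'a::euclidean_space) \<Rightarrow> ('a \<Rightarrow> 'w measure) \<Rightarrow> 'a measure \<Rightarrow> bool" where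
  "class_Theta M X P \<mu> \<longleftrightarrow>
     borel_right_process M X P \<and>
     (\<exists>p \<rho>. basic_assumption X P \<mu> p \<rho> \<and> short_time_bound p \<and>
            local_uniform_convergence \<mu> p \<rho>)"

text \<open>
  Generalised inverse of a decreasing function on \<open>(0, \<infinity>)\<close>. If \<open>\<Xi>\<close> is strictly decreasing and
  \<open>s = \<Xi> t\<close>, then its value at \<open>s\<close> is \<open>t\<close>; it is also meaningful at values skipped by jumps of \<open>\<Xi>\<close>.
\<close>

definition rate_inv :: "(real \<Rightarrow> real) \<Rightarrow> real \<Rightarrow> real" where
  "rate_inv \<Xi> s = Inf {t. 0 < t \<and> \<Xi> t \<le> s}"

lemma rate_inv_eq:
  assumes "strict_antimono_on {0<..} \<Xi>" "0 < t"
  shows "rate_inv \<Xi> (\<Xi> t) = t"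
proof -
  have "{t'. 0 < t' \<and> \<Xi> t' \<le> \<Xi> t} = {t..}"
  proof (intro set_eqI iffI)
    fix t' assume "t' \<in> {t'. 0 < t' \<and> \<Xi> t' \<le> \<Xi> t}"
    then show "t' \<in> {t..}"
      using monotone_onD[OF assms(1), of t' t] assms(2) by (cases "t' < t") auto
  next
    fix t' assume "t' \<in> {t..}"
    then show "t' \<in> {t'. 0 < t' \<and> \<Xi> t' \<le> \<Xi> t}"
      using monotone_onD[OF assms(1), of t t'] assms(2) by (cases "t' = t") auto
  qed
  then show ?thesis
    unfolding rate_inv_def by simp
qed


section \<open>Kernel density estimator\<close>

fun C_k :: "nat \<Rightarrow> ('a::euclidean_space \<Rightarrow> real) \<Rightarrow> bool" where
  "C_k 0 f \<longleftrightarrow> continuous_on UNIV f"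
| "C_k (Suc k) f \<longleftrightarrow>
     (\<forall>x. f differentiable (at x)) \<and> (\<forall>b\<in>Basis. C_k k (\<lambda>x. frechet_derivative f (at x) b))"

text \<open>No normalisation of the integral of the kernel is imposed.\<close>

definition smooth_kernel :: "(real ^ 'd \<Rightarrow> real) \<Rightarrow> bool" where
  "smooth_kernel K \<longleftrightarrow>
     (\<forall>k. C_k k K) \<and> (\<exists>L. L-lipschitz_on UNIV K) \<and>
     closure {x. K x \<noteq> 0} \<subseteq> cbox (\<chi> i. - 1/2) (\<chi> i. 1/2)"

definition scaled_kernel :: "(real ^ 'd \<Rightarrow> real) \<Rightarrow> real \<Rightarrow> real ^ 'd \<Rightarrow> real" where
  "scaled_kernel K h x = K ((1 / h) *\<^sub>R x) / h ^ CARD('d)"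

definition kde :: "(real ^ 'd \<Rightarrow> real) \<Rightarrow> (real \<Rightarrow> 'w \<Rightarrow> real ^ 'd) \<Rightarrow> real \<Rightarrow> real \<Rightarrow> real ^ 'd \<Rightarrow> 'w \<Rightarrow> real" where
  "kde K X h T x \<omega> = (1 / T) * (LINT s:{0..T}|lborel. scaled_kernel K h (x - X s \<omega>))"

definition sup_norm_on :: "'a set \<Rightarrow> ('a \<Rightarrow> real) \<Rightarrow> real" where
  "sup_norm_on D f = (SUP x\<in>D. \<bar>f x\<bar>)"

definition deviation ::
  "(real ^ 'd \<Rightarrow> real) \<Rightarrow> (real \<Rightarrow> 'w \<Rightarrow> real ^ 'd) \<Rightarrow> 'w measure \<Rightarrow> (real ^ 'd) set \<Rightarrow> real \<Rightarrow> real \<Rightarrow> 'w \<Rightarrow> real" where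
  "deviation K X Q D h T \<omega> =
     sup_norm_on D (\<lambda>x. kde K X h T x \<omega> - (\<integral>\<omega>'. kde K X h T x \<omega>' \<partial>Q))"

definition psi :: "nat \<Rightarrow> real \<Rightarrow> real" where
  "psi d x = (if d = 1 then 1 else if d = 2 then sqrt (1 + ln (1 / x))
              else x powr (1 / real d - 1 / 2))"

definition Upsilon :: "nat \<Rightarrow> real \<Rightarrow> real \<Rightarrow> real \<Rightarrow> real" where
  "Upsilon d h T u =
     u * (ln T)\<^sup>2 / (T * h ^ d) + T powr (- 1/2) * psi d (h ^ d) * sqrt (max u (ln (1 / h)))"

end

theory Submission
  imports Defs
begin

text \<open>
  For \<open>x\<close> in \<open>D\<close> let \<open>f\<^sub>x z = K ((x - z) / h) / h ^ d\<close>, and let \<open>\<mu> f\<^sub>x\<close> be its stationary mean. By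
  stationarity the deviation of the estimator at \<open>x\<close> is \<open>1 / T\<close> times the integral of
  \<open>f\<^sub>x (X\<^sub>s) - \<mu> f\<^sub>x\<close> over \<open>[0, T]\<close>. The proof combines a Bernstein inequality that holds for
  finitely many functions at the same time with chaining in the space variable.

  Blocks. Cut \<open>[0, T]\<close> into \<open>2 * n\<close> blocks of equal length \<open>a\<close>, where \<open>a\<close> lies between
  \<open>2 * \<tau>\<close> and \<open>4 * \<tau>\<close> and \<open>\<tau> = \<Xi>\<^sup>-\<^sup>1 (T powr (- u))\<close>. Two consecutive blocks of the same parity are
  separated by a gap of length \<open>a\<close>. By the Markov property and \<open>\<beta>\<close>-mixing, replacing everything after
  such a gap by an independent copy changes the expectation of a \<open>[0, 1]\<close>-valued function of past and
  future by at most \<open>\<Xi> a\<close> (\<open>decoupling_fold\<close>, \<open>block_decoupling\<close>). There may be far more functions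
  \<open>f\<^sub>x\<close> than the mixing error can pay for, hence it must be paid once per block and not once per
  block and function. This is achieved by the functional \<open>min 1 (\<Sum>i\<in>I. A i * exp (S i))\<close>, in which
  \<open>S i\<close> is the sum of the block integrals of the \<open>i\<close>-th function: it has values in \<open>[0, 1]\<close>, it
  dominates the indicator of the event that one of the sums is large, and integrating out the last
  block only multiplies \<open>A i\<close> by a moment generating function (\<open>exp_moments_of_separated_blocks\<close>).
  The total mixing error \<open>2 * n * \<Xi> a\<close> is at most
  \<open>T powr (1 - u) / (2 * \<tau>)\<close>, hence at most \<open>exp (- u) / 2\<close> for large \<open>T\<close>.

  Variance. A function bounded by \<open>B\<close> with support in a set of volume of order \<open>h ^ d\<close> has a block
  integral of variance at most \<open>C * a * B\<^sup>2 * h ^ (2 * d) * psi d (h ^ d) ^ 2\<close> (\<open>block_variance\<close>).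
  For this the covariance at lag \<open>s\<close> is integrated over \<open>s\<close>. Up to time 1 it is controlled by the
  bound on the transition density, except that for \<open>d \<ge> 2\<close> the trivial bound is better up to the
  diffusive time \<open>h\<^sup>2\<close>; afterwards it is controlled by the local uniform convergence or, for
  \<open>d \<ge> 2\<close>, by the exponential mixing.

  Chaining. A union bound over a grid that is fine enough for the Lipschitz constant of \<open>f\<^sub>x\<close> would
  put \<open>ln T\<close> below the square root, while the theorem has \<open>ln (1 / h)\<close> there. So \<open>x\<close> is
  approximated along dyadic grids of mesh \<open>h / 2 ^ j\<close>. The increment of \<open>f\<^sub>x\<close> from level \<open>j\<close> to
  level \<open>j + 1\<close>, multiplied by \<open>2 ^ j\<close>, obeys, up to constants, the same bounds on size and volume of the
  support as \<open>f\<^sub>x\<close> itself, and the cardinality of level \<open>j\<close> enters through its logarithm, which is of the order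
  \<open>ln (1 / h) + j\<close>. The factors \<open>1 / 2 ^ j\<close> make the sum over the levels converge
  (\<open>uniform_deviation_bound\<close>).
\<close>

section \<open>Moment generating functions and Riemann sums\<close>

lemma exp_le_quadratic:
  fixes x :: real
  assumes "x \<le> 1"
  shows "exp x \<le> 1 + x + x\<^sup>2"
proof (cases "0 \<le> x")
  case True
  then show ?thesis using exp_bound assms by auto
next
  case False
  have "(1 - x) * exp x \<le> exp (- x) * exp x"
    using exp_ge_add_one_self[of "- x"] by (intro mult_right_mono) auto
  also have "\<dots> = 1" by (simp flip: exp_add)
  also have "1 \<le> (1 - x) * (1 + x + x\<^sup>2)"
  proof -
    have "(1 - x) * (1 + x + x\<^sup>2) = 1 + (- x) * x\<^sup>2"
      by (simp add: algebra_simps power2_eq_square)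
    moreover have "0 \<le> (- x) * x\<^sup>2" using False by (intro mult_nonneg_nonneg) auto
    ultimately show ?thesis by linarith
  qed
  finally show ?thesis using False by (subst (asm) mult_le_cancel_left_pos) auto
qed

text \<open>
  As \<open>l * Y\<close> is at most 1, the exponential is below its quadratic Taylor polynomial with constant 1
  instead of \<open>1/2\<close>, and the linear term has mean 0.
\<close>

lemma (in prob_space) mgf_le_exp_variance:
  fixes Y :: "'a \<Rightarrow> real"
  assumes Y[measurable]: "random_variable borel Y"
    and bounded: "\<And>\<omega>. \<omega> \<in> space M \<Longrightarrow> \<bar>Y \<omega>\<bar> \<le> b"
    and centred: "expectation Y = 0"
    and var: "expectation (\<lambda>\<omega>. (Y \<omega>)\<^sup>2) \<le> v"
    and l: "\<bar>l\<bar> * b \<le> 1"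
  shows "expectation (\<lambda>\<omega>. exp (l * Y \<omega>)) \<le> exp (l\<^sup>2 * v)"
proof -
  have le: "l * Y \<omega> \<le> 1" if "\<omega> \<in> space M" for \<omega>
  proof -
    have "l * Y \<omega> \<le> \<bar>l\<bar> * \<bar>Y \<omega>\<bar>" by (metis abs_ge_self abs_mult)
    also have "\<dots> \<le> \<bar>l\<bar> * b" using bounded[OF that] by (intro mult_left_mono) auto
    finally show ?thesis using l by simp
  qed
  have i1: "integrable M Y"
    using bounded by (intro integrable_const_bound[where B=b]) auto
  have i2: "integrable M (\<lambda>\<omega>. (Y \<omega>)\<^sup>2)"
  proof (intro integrable_const_bound[where B="b\<^sup>2"] AE_I2)
    show "norm ((Y \<omega>)\<^sup>2) \<le> b\<^sup>2" if "\<omega> \<in> space M" for \<omega>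
      using bounded[OF that] by (simp add: abs_le_square_iff[symmetric])
  qed auto
  have i3: "integrable M (\<lambda>\<omega>. exp (l * Y \<omega>))"
    using le by (intro integrable_const_bound[where B="exp 1"]) auto
  have "expectation (\<lambda>\<omega>. exp (l * Y \<omega>)) \<le> expectation (\<lambda>\<omega>. 1 + l * Y \<omega> + l\<^sup>2 * (Y \<omega>)\<^sup>2)"
  proof (intro integral_mono i3)
    show "integrable M (\<lambda>\<omega>. 1 + l * Y \<omega> + l\<^sup>2 * (Y \<omega>)\<^sup>2)"
      using i1 i2 by simp
    show "exp (l * Y \<omega>) \<le> 1 + l * Y \<omega> + l\<^sup>2 * (Y \<omega>)\<^sup>2" if "\<omega> \<in> space M" for \<omega>
      using exp_le_quadratic[OF le[OF that]] by (simp add: power_mult_distrib)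
  qed
  also have "\<dots> = 1 + l\<^sup>2 * expectation (\<lambda>\<omega>. (Y \<omega>)\<^sup>2)"
    using i1 i2 centred by (simp add: prob_space)
  also have "\<dots> \<le> 1 + l\<^sup>2 * v"
    using var by (simp add: mult_left_mono)
  also have "\<dots> \<le> exp (l\<^sup>2 * v)" by simp
  finally show ?thesis .
qed

text \<open>
  Evaluating a right continuous path at the next point of a grid recovers the path as the mesh tends
  to 0. This replaces continuity in all arguments below about measurability and Riemann sums.
\<close>

lemma tendsto_right_continuous_seq:
  fixes g :: "real \<Rightarrow> 'b::topological_space"
  assumes "continuous (at_right s) g" "\<And>n. s \<le> t n" "t \<longlonglongrightarrow> s"
  shows "(\<lambda>n. g (t n)) \<longlonglongrightarrow> g s"
proof -
  have "(g \<longlongrightarrow> g s) (at_right s)" using assms(1) by (simp add: continuous_within)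
  then have "(g \<longlongrightarrow> g s) (at s within {s..})"
    by (simp add: at_within_Ici_at_right)
  then have "continuous (at s within {s..}) g" by (simp add: continuous_within)
  then show ?thesis
    by (rule continuous_within_tendsto_compose'[OF _ _ assms(3)]) (use assms(2) in auto)
qed

lemma ceiling_grid_bounds:
  fixes s r d :: real
  assumes "d > 0"
  shows "s \<le> r + d * \<lceil>(s - r) / d\<rceil>" "r + d * \<lceil>(s - r) / d\<rceil> < s + d"
proof -
  have "(s - r) / d \<le> \<lceil>(s - r) / d\<rceil>" "\<lceil>(s - r) / d\<rceil> < (s - r) / d + 1"
    by linarith+
  then have "d * ((s - r) / d) \<le> d * \<lceil>(s - r) / d\<rceil>" "d * \<lceil>(s - r) / d\<rceil> < d * ((s - r) / d + 1)"
    using assms by (intro mult_left_mono mult_strict_left_mono; simp)+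
  then show "s \<le> r + d * \<lceil>(s - r) / d\<rceil>" "r + d * \<lceil>(s - r) / d\<rceil> < s + d"
    using assms by (simp_all add: distrib_left)
qed

lemma ceiling_grid_tendsto:
  fixes s r a :: real
  assumes "a > 0"
  shows "(\<lambda>m. r + a / Suc m * \<lceil>(s - r) / (a / Suc m)\<rceil>) \<longlonglongrightarrow> s"
proof (rule tendsto_sandwich)
  have b: "s \<le> r + a / Suc m * \<lceil>(s - r) / (a / Suc m)\<rceil>"
      "r + a / Suc m * \<lceil>(s - r) / (a / Suc m)\<rceil> < s + a / Suc m" for m
    using ceiling_grid_bounds[of "a / Suc m"] assms by auto
  show "\<forall>\<^sub>F m in sequentially. s \<le> r + a / Suc m * \<lceil>(s - r) / (a / Suc m)\<rceil>"
    using b(1) by (intro always_eventually) blast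
  show "\<forall>\<^sub>F m in sequentially. r + a / Suc m * \<lceil>(s - r) / (a / Suc m)\<rceil> \<le> s + a / Suc m"
    using b(2) by (intro always_eventually allI less_imp_le)
  have "(\<lambda>m. s + a * (1 / Suc m)) \<longlonglongrightarrow> s + a * 0"
    by (intro tendsto_intros LIMSEQ_Suc[OF lim_1_over_n])
  then show "(\<lambda>m. s + a / Suc m) \<longlonglongrightarrow> s" by simp
qed auto

lemma right_continuous_measurable:
  fixes g :: "real \<Rightarrow> 'b::metric_space"
  assumes "\<And>s. continuous (at_right s) g"
  shows "g \<in> borel_measurable borel"
proof (rule borel_measurable_LIMSEQ_metric)
  show "(\<lambda>s. g (0 + 1 / Suc m * \<lceil>(s - 0) / (1 / Suc m)\<rceil>)) \<in> borel_measurable borel" for m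
  proof (rule measurable_compose[where g="\<lambda>k::int. g (0 + 1 / Suc m * k)" and N="count_space UNIV"])
    show "(\<lambda>s::real. \<lceil>(s - 0) / (1 / Suc m)\<rceil>) \<in> borel \<rightarrow>\<^sub>M count_space UNIV"
      by measurable
  qed simp
  show "(\<lambda>m. g (0 + 1 / Suc m * \<lceil>(s - 0) / (1 / Suc m)\<rceil>)) \<longlonglongrightarrow> g s" for s
    using ceiling_grid_tendsto[of 1 0 s] ceiling_grid_bounds(1)[of "1 / Suc m" s 0 for m]
    by (intro tendsto_right_continuous_seq[OF assms]) auto
qed

text \<open>
  The Riemann sum with right endpoints is the integral of a step function, so that dominated
  convergence applies to it.
\<close>

lemma riemann_step_integral:
  fixes g :: "real \<Rightarrow> real"
  assumes d: "d > 0" and bounded: "\<And>s. \<bar>g s\<bar> \<le> B"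
  shows "set_integrable lborel {r<..r + real n * d} (\<lambda>s. g (r + d * \<lceil>(s - r) / d\<rceil>)) \<and>
    (LINT s:{r<..r + real n * d}|lborel. g (r + d * \<lceil>(s - r) / d\<rceil>)) = d * (\<Sum>k=1..n. g (r + real k * d))"
proof (induction n)
  case 0
  then show ?case by (simp add: set_lebesgue_integral_def set_integrable_def)
next
  case (Suc n)
  let ?G = "\<lambda>s. g (r + d * \<lceil>(s - r) / d\<rceil>)"
  let ?J = "{r + n * d<..r + Suc n * d}"
  have U: "{r<..r + Suc n * d} = {r<..r + n * d} \<union> ?J"
    using d by (intro ivl_disj_un_two(6)[symmetric]) (auto simp: mult_right_mono)
  have c: "\<lceil>(s - r) / d\<rceil> = int (Suc n)" if "s \<in> ?J" for s
    using that d by (intro ceiling_unique) (auto simp: field_simps)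
  have ci: "set_integrable lborel ?J (\<lambda>s. g (r + Suc n * d))"
    using d unfolding set_integrable_def
    by (intro integrable_scaleR_left integrable_real_indicator) (auto simp: mult_right_mono)
  have eq: "indicat_real ?J s *\<^sub>R ?G s = indicat_real ?J s *\<^sub>R g (r + Suc n * d)" for s
    using c[of s] by (cases "s \<in> ?J") (auto simp: mult.commute)
  have i: "set_integrable lborel ?J ?G"
    using ci unfolding set_integrable_def eq .
  have v: "(LINT s:?J|lborel. ?G s) = d * g (r + Suc n * d)"
    using d unfolding set_lebesgue_integral_def eq
    by (simp add: algebra_simps)
  show ?case
  proof
    show "set_integrable lborel {r<..r + real (Suc n) * d} ?G"
      unfolding U using Suc i by (intro set_integrable_Un) auto
    have "(LINT s:{r<..r + real (Suc n) * d}|lborel. ?G s)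
        = (LINT s:{r<..r + n * d}|lborel. ?G s) + (LINT s:?J|lborel. ?G s)"
      unfolding U using Suc i by (intro set_integral_Un) auto
    also have "\<dots> = d * (\<Sum>k=1..n. g (r + real k * d)) + d * g (r + Suc n * d)"
      using Suc v by simp
    also have "\<dots> = d * (\<Sum>k=1..Suc n. g (r + real k * d))"
      by (simp add: distrib_left del: of_nat_Suc)
    finally show "(LINT s:{r<..r + real (Suc n) * d}|lborel. ?G s) = d * (\<Sum>k=1..Suc n. g (r + real k * d))" .
  qed
qed

lemma riemann_sums_converge:
  fixes g :: "real \<Rightarrow> real"
  assumes a: "a > 0" and rc: "\<And>s. continuous (at_right s) g" and bounded: "\<And>s. \<bar>g s\<bar> \<le> B"
  shows "(\<lambda>m. a / Suc m * (\<Sum>k=1..Suc m. g (r + k * (a / Suc m)))) \<longlonglongrightarrow> (LINT s:{r..r + a}|lborel. g s)"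
proof -
  let ?G = "\<lambda>m s. g (r + a / Suc m * \<lceil>(s - r) / (a / Suc m)\<rceil>)"
  have B: "0 \<le> B" using bounded[of 0] by linarith
  have meas[measurable]: "?G m \<in> borel_measurable borel" for m
  proof (rule measurable_compose[where g="\<lambda>k::int. g (r + a / Suc m * k)" and N="count_space UNIV"])
    show "(\<lambda>s::real. \<lceil>(s - r) / (a / Suc m)\<rceil>) \<in> borel \<rightarrow>\<^sub>M count_space UNIV"
      by measurable
  qed simp
  have [measurable]: "g \<in> borel_measurable borel" by (rule right_continuous_measurable[OF rc])
  have "(\<lambda>m. LINT s:{r<..r + a}|lborel. ?G m s) \<longlonglongrightarrow> (LINT s:{r<..r + a}|lborel. g s)"
    unfolding set_lebesgue_integral_def
  proof (rule integral_dominated_convergence[where w="\<lambda>s. indicator {r<..r+a} s * B"])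
    show "integrable lborel (\<lambda>s. indicator {r<..r + a} s * B)"
      using a by (intro integrable_mult_left integrable_real_indicator) auto
    show "AE s in lborel. (\<lambda>m. indicat_real {r<..r + a} s *\<^sub>R ?G m s) \<longlonglongrightarrow> indicat_real {r<..r + a} s *\<^sub>R g s"
    proof (intro AE_I2 tendsto_scaleR tendsto_const)
      fix s
      have "s \<le> r + a / Suc m * \<lceil>(s - r) / (a / Suc m)\<rceil>" for m
        using a by (intro ceiling_grid_bounds) simp
      then show "(\<lambda>m. ?G m s) \<longlonglongrightarrow> g s"
        by (intro tendsto_right_continuous_seq[OF rc] ceiling_grid_tendsto a)
    qed
    show "AE s in lborel. norm (indicat_real {r<..r + a} s *\<^sub>R ?G m s) \<le> indicator {r<..r + a} s * B" for m
      using bounded by (auto simp: indicator_def intro!: AE_I2)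
  qed auto
  moreover have "(LINT s:{r<..r + a}|lborel. ?G m s) = a / Suc m * (\<Sum>k=1..Suc m. g (r + k * (a / Suc m)))" for m
    using riemann_step_integral[of "a / Suc m" g B r "Suc m"] a bounded
    by (simp add: nonzero_mult_div_cancel_left del: sum.cl_ivl_Suc of_nat_Suc)
  moreover have "(LINT s:{r<..r + a}|lborel. g s) = (LINT s:{r..r + a}|lborel. g s)"
    unfolding set_lebesgue_integral_def
  proof (intro integral_cong_AE)
    show "AE s in lborel. indicat_real {r<..r + a} s *\<^sub>R g s = indicat_real {r..r + a} s *\<^sub>R g s"
      using AE_lborel_singleton[of r] by eventually_elim (auto simp: indicator_def)
  qed auto
  ultimately show ?thesis by simp
qed

section \<open>The process under its stationary law\<close>

locale stationary_process =
  fixes M :: "'w measure"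
    and X :: "real \<Rightarrow> 'w \<Rightarrow> 'a::euclidean_space"
    and P :: "'a \<Rightarrow> 'w measure"
    and \<mu> :: "'a measure"
  assumes process: "borel_right_process M X P"
    and invariant: "invariant_distribution X P \<mu>"
begin

abbreviation Q :: "'w measure" where "Q \<equiv> \<mu> \<bind> P"
abbreviation F :: "real \<Rightarrow> 'w measure" where "F \<equiv> natural_filtration M X"

lemma kernel_P[measurable]: "P \<in> borel \<rightarrow>\<^sub>M prob_algebra M"
  using process by (simp add: borel_right_process_def)

lemma prob_space_P: "prob_space (P x)" and sets_P[simp, measurable_cong]: "sets (P x) = sets M"
  using measurable_space[OF kernel_P, of x] by (auto simp: space_prob_algebra)

lemma space_P[simp]: "space (P x) = space M"
  by (rule sets_eq_imp_space_eq) simp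

lemma X_measurable: "t \<ge> 0 \<Longrightarrow> X t \<in> M \<rightarrow>\<^sub>M borel"
  using process by (simp add: borel_right_process_def)

lemma X_right_continuous: "\<omega> \<in> space M \<Longrightarrow> t \<ge> 0 \<Longrightarrow> continuous (at_right t) (\<lambda>s. X s \<omega>)"
  using process by (simp add: borel_right_process_def)

lemma prob_space_\<mu>: "prob_space \<mu>" and sets_\<mu>[simp, measurable_cong]: "sets \<mu> = sets borel"
  using invariant by (auto simp: invariant_distribution_def)

lemma space_\<mu>[simp]: "space \<mu> = UNIV"
  using sets_eq_imp_space_eq[OF sets_\<mu>] by simp

lemma kernel_P_\<mu>: "P \<in> \<mu> \<rightarrow>\<^sub>M subprob_algebra M"
  using measurable_prob_algebraD[OF kernel_P] by (simp add: measurable_cong_sets[OF sets_\<mu> refl])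

lemma sets_Q[simp, measurable_cong]: "sets Q = sets M"
  by (rule sets_bind) auto

lemma space_Q[simp]: "space Q = space M"
  by (rule sets_eq_imp_space_eq) simp

lemma prob_space_Q: "prob_space Q"
  by (rule prob_space.prob_space_bind[OF prob_space_\<mu> _ kernel_P_\<mu>]) (simp add: prob_space_P)

sublocale Q: prob_space Q by (rule prob_space_Q)
sublocale \<mu>: prob_space \<mu> by (rule prob_space_\<mu>)

lemma measure_Q_space[simp]: "measure Q (space M) = 1"
  using Q.prob_space by simp

lemma nn_integral_Q:
  "f \<in> borel_measurable M \<Longrightarrow> (\<integral>\<^sup>+\<omega>. f \<omega> \<partial>Q) = (\<integral>\<^sup>+x. \<integral>\<^sup>+\<omega>. f \<omega> \<partial>P x \<partial>\<mu>)"
  by (rule nn_integral_bind[OF _ kernel_P_\<mu>])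

lemma sets_transition[simp, measurable_cong]: "sets (transition X P t x) = sets borel"
  by (simp add: transition_def)

lemma space_transition[simp]: "space (transition X P t x) = UNIV"
  by (simp add: transition_def)

lemma kernel_transition:
  assumes "t \<ge> 0"
  shows "transition X P t \<in> borel \<rightarrow>\<^sub>M prob_algebra borel"
  unfolding transition_def[abs_def]
  using measurable_compose[OF kernel_P measurable_distr_prob_space[OF X_measurable[OF assms]]] .

lemma prob_space_transition: "t \<ge> 0 \<Longrightarrow> prob_space (transition X P t x)"
  using measurable_space[OF kernel_transition, of t x] by (auto simp: space_prob_algebra)

lemma distr_X:
  assumes "t \<ge> 0"
  shows "distr Q borel (X t) = \<mu>"
proof -
  have "distr Q borel (X t) = \<mu> \<bind> (\<lambda>x. distr (P x) borel (X t))"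
    by (rule distr_bind[OF kernel_P_\<mu> _ X_measurable[OF assms]]) simp
  also have "\<dots> = \<mu>"
    using invariant assms by (simp add: invariant_distribution_def transition_def[abs_def])
  finally show ?thesis .
qed

lemma space_F[simp]: "space (F t) = space M"
  by (simp add: natural_filtration_def space_measure_of_conv)

lemma sets_F: "sets (F t) = sigma_sets (space M) (\<Union>s\<in>{0..t}. (\<lambda>B. X s -` B \<inter> space M) ` sets borel)"
  unfolding natural_filtration_def by (intro sets_measure_of) auto

lemma sets_F_subset: "sets (F t) \<subseteq> sets M"
  unfolding sets_F by (rule sets.sigma_sets_subset) (auto intro!: measurable_sets[OF X_measurable])

lemma sets_F_mono: "s \<le> t \<Longrightarrow> sets (F s) \<subseteq> sets (F t)"
  unfolding sets_F by (rule sigma_sets_mono', rule UN_mono) auto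

lemma X_measurable_F:
  assumes "0 \<le> s" "s \<le> t"
  shows "X s \<in> F t \<rightarrow>\<^sub>M borel"
proof (rule measurableI)
  show "X s -` B \<inter> space (F t) \<in> sets (F t)" if "B \<in> sets borel" for B
    unfolding sets_F using assms that by (auto intro!: sigma_sets.Basic)
qed simp

lemma measurable_F_mono: "f \<in> F s \<rightarrow>\<^sub>M N \<Longrightarrow> s \<le> t \<Longrightarrow> f \<in> F t \<rightarrow>\<^sub>M N"
  using sets_F_mono[of s t] by (auto simp: measurable_def)

lemma measurable_F_M: "f \<in> F s \<rightarrow>\<^sub>M N \<Longrightarrow> f \<in> M \<rightarrow>\<^sub>M N"
  using sets_F_subset[of s] by (auto simp: measurable_def)

lemma markov_property:
  assumes "t \<ge> 0" "s \<ge> 0" "B \<in> sets borel"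
  shows "AE \<omega> in P x. real_cond_exp (P x) (F t) (\<lambda>\<omega>'. indicator B (X (t + s) \<omega>')) \<omega> =
      measure (transition X P s (X t \<omega>)) B"
proof -
  have "\<forall>x. \<forall>s\<ge>0. \<forall>t\<ge>0. \<forall>B\<in>sets borel. AE \<omega> in P x.
        real_cond_exp (P x) (F t) (\<lambda>\<omega>'. indicator B (X (t + s) \<omega>')) \<omega> =
        measure (transition X P s (X t \<omega>)) B"
    using process unfolding borel_right_process_def by (elim conjE)
  from this[rule_format, OF assms(2,1,3)] show ?thesis .
qed

lemma markov_P:
  assumes t: "t \<ge> 0" and s: "s \<ge> 0" and A: "A \<in> sets (F t)" and B[measurable]: "B \<in> sets borel"
  shows "(\<integral>\<^sup>+\<omega>. indicator A \<omega> * indicator B (X (t + s) \<omega>) \<partial>P x)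
       = (\<integral>\<^sup>+\<omega>. indicator A \<omega> * emeasure (transition X P s (X t \<omega>)) B \<partial>P x)"
proof -
  interpret Px: prob_space "P x" by (rule prob_space_P)
  interpret finite_measure_subalgebra "P x" "F t"
    by unfold_locales (use sets_F_subset in \<open>auto simp: subalgebra_def\<close>)
  have A'[measurable]: "A \<in> sets M" using A sets_F_subset by auto
  note [measurable] = X_measurable[OF t] X_measurable[of "t + s"] kernel_transition[OF s]
  have ts: "t + s \<ge> 0" using t s by simp
  let ?p = "\<lambda>\<omega>. measure (transition X P s (X t \<omega>)) B"
  have p: "0 \<le> ?p \<omega>" "?p \<omega> \<le> 1" for \<omega>
    using prob_space.prob_le_1[OF prob_space_transition[OF s]] by auto
  have pm[measurable]: "?p \<in> borel_measurable M"
    by (rule measurable_compose[OF X_measurable[OF t]]) measurable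
  have "(\<integral>\<omega>\<in>A. indicator B (X (t + s) \<omega>) \<partial>P x)
      = (\<integral>\<omega>\<in>A. real_cond_exp (P x) (F t) (\<lambda>\<omega>'. indicator B (X (t + s) \<omega>')) \<omega> \<partial>P x)"
    using ts by (intro real_cond_exp_intA A Px.integrable_const_bound[where B=1]) auto
  also have "\<dots> = (\<integral>\<omega>\<in>A. ?p \<omega> \<partial>P x)"
  proof (rule set_lebesgue_integral_cong_AE)
    have "AE \<omega> in P x. real_cond_exp (P x) (F t) (\<lambda>\<omega>'. indicator B (X (t + s) \<omega>')) \<omega> = ?p \<omega>"
      by (rule markov_property[OF t s B])
    then show "AE \<omega>\<in>A in P x. real_cond_exp (P x) (F t) (\<lambda>\<omega>'. indicator B (X (t + s) \<omega>')) \<omega> = ?p \<omega>"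
      by eventually_elim simp
  qed auto
  finally have eq: "(\<integral>\<omega>. indicator A \<omega> * indicator B (X (t + s) \<omega>) \<partial>P x) = (\<integral>\<omega>. indicator A \<omega> * ?p \<omega> \<partial>P x)"
    by (simp add: set_lebesgue_integral_def)
  have "(\<integral>\<^sup>+\<omega>. indicator A \<omega> * indicator B (X (t + s) \<omega>) \<partial>P x)
      = (\<integral>\<^sup>+\<omega>. ennreal (indicator A \<omega> * indicator B (X (t + s) \<omega>)) \<partial>P x)"
    by (intro nn_integral_cong) (auto simp: indicator_def)
  also have "\<dots> = ennreal (\<integral>\<omega>. indicator A \<omega> * indicator B (X (t + s) \<omega>) \<partial>P x)"
    using ts by (intro nn_integral_eq_integral Px.integrable_const_bound[where B=1])
      (auto simp: indicator_def)
  also have "\<dots> = ennreal (\<integral>\<omega>. indicator A \<omega> * ?p \<omega> \<partial>P x)" using eq by simp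
  also have "\<dots> = (\<integral>\<^sup>+\<omega>. ennreal (indicator A \<omega> * ?p \<omega>) \<partial>P x)"
    using p by (intro nn_integral_eq_integral[symmetric] Px.integrable_const_bound[where B=1])
      (auto simp: indicator_def)
  also have "\<dots> = (\<integral>\<^sup>+\<omega>. indicator A \<omega> * emeasure (transition X P s (X t \<omega>)) B \<partial>P x)"
  proof (intro nn_integral_cong)
    fix \<omega>
    interpret T: prob_space "transition X P s (X t \<omega>)" by (rule prob_space_transition[OF s])
    show "ennreal (indicator A \<omega> * ?p \<omega>) = indicator A \<omega> * emeasure (transition X P s (X t \<omega>)) B"
      by (auto simp: indicator_def T.emeasure_eq_measure)
  qed
  finally show ?thesis .
qed

lemma markov_Q:
  assumes t: "t \<ge> 0" and s: "s \<ge> 0" and A: "A \<in> sets (F t)" and B[measurable]: "B \<in> sets borel"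
  shows "(\<integral>\<^sup>+\<omega>. indicator A \<omega> * indicator B (X (t + s) \<omega>) \<partial>Q)
       = (\<integral>\<^sup>+\<omega>. indicator A \<omega> * emeasure (transition X P s (X t \<omega>)) B \<partial>Q)"
proof -
  have A'[measurable]: "A \<in> sets M" using A sets_F_subset by auto
  have [measurable]: "X t \<in> M \<rightarrow>\<^sub>M borel" "X (t + s) \<in> M \<rightarrow>\<^sub>M borel"
    using X_measurable t s by auto
  have [measurable]: "(\<lambda>x. emeasure (transition X P s x) B) \<in> borel_measurable borel"
    using measurable_emeasure_subprob_algebra[OF B] measurable_prob_algebraD[OF kernel_transition[OF s]]
    by (rule measurable_compose[rotated])
  show ?thesis
    by (subst (1 2) nn_integral_Q) (auto simp: markov_P[OF assms] intro!: nn_integral_cong)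
qed

text \<open>
  The Markov property in the form that is used throughout: \<open>H\<close> may depend on the whole past through
  \<open>\<omega>\<close>. Both sides are integrals of \<open>H\<close> against probability measures on past times state space,
  and these agree on rectangles by \<open>markov_Q\<close>.
\<close>

lemma markov_step:
  assumes t: "t \<ge> 0" and s: "s \<ge> 0" and H[measurable]: "H \<in> borel_measurable (F t \<Otimes>\<^sub>M borel)"
  shows "(\<integral>\<^sup>+\<omega>. H (\<omega>, X (t + s) \<omega>) \<partial>Q) = (\<integral>\<^sup>+\<omega>. \<integral>\<^sup>+y. H (\<omega>, y) \<partial>transition X P s (X t \<omega>) \<partial>Q)"
proof -
  have [measurable]: "X t \<in> M \<rightarrow>\<^sub>M borel" "X (t + s) \<in> M \<rightarrow>\<^sub>M borel"
    using X_measurable t s by auto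
  have id[measurable]: "(\<lambda>\<omega>. \<omega>) \<in> M \<rightarrow>\<^sub>M F t"
    using sets_F_subset by (auto simp: measurable_def)
  have pair[measurable]: "(\<lambda>\<omega>. (\<omega>, X (t + s) \<omega>)) \<in> Q \<rightarrow>\<^sub>M F t \<Otimes>\<^sub>M borel"
    by measurable
  have tr[measurable]: "transition X P s \<in> borel \<rightarrow>\<^sub>M subprob_algebra borel"
    by (rule measurable_prob_algebraD[OF kernel_transition[OF s]])
  define k where "k \<omega> = distr (transition X P s (X t \<omega>)) (F t \<Otimes>\<^sub>M borel) (\<lambda>y. (\<omega>, y))" for \<omega>
  have k[measurable]: "k \<in> Q \<rightarrow>\<^sub>M subprob_algebra (F t \<Otimes>\<^sub>M borel)"
    unfolding k_def
  proof (rule measurable_distr2[where M=borel])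
    have "(\<lambda>\<omega>. \<omega>) \<in> Q \<rightarrow>\<^sub>M F t" by measurable
    from measurable_compose[OF measurable_fst this]
    show "case_prod Pair \<in> Q \<Otimes>\<^sub>M borel \<rightarrow>\<^sub>M F t \<Otimes>\<^sub>M borel"
      unfolding case_prod_beta' by (intro measurable_Pair measurable_snd)
  qed (rule measurable_compose[OF _ tr], measurable)
  have pr: "(\<lambda>y. (\<omega>, y)) \<in> transition X P s z \<rightarrow>\<^sub>M F t \<Otimes>\<^sub>M borel" if "\<omega> \<in> space M" for \<omega> z
    using that by (intro measurable_Pair measurable_const) (auto simp: measurable_cong_sets[OF sets_transition refl])
  have "distr Q (F t \<Otimes>\<^sub>M borel) (\<lambda>\<omega>. (\<omega>, X (t + s) \<omega>)) = Q \<bind> k"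
  proof (rule measure_eqI_generator_eq[OF Int_stable_pair_measure_generator, where
        A="\<lambda>_. space (F t) \<times> space borel"])
    show "{a \<times> b |a b. a \<in> sets (F t) \<and> b \<in> sets borel} \<subseteq> Pow (space (F t) \<times> space borel)"
      using sets.sets_into_space by fastforce
    show "sets (distr Q (F t \<Otimes>\<^sub>M borel) (\<lambda>\<omega>. (\<omega>, X (t + s) \<omega>))) =
        sigma_sets (space (F t) \<times> space borel) {a \<times> b |a b. a \<in> sets (F t) \<and> b \<in> sets borel}"
      by (simp add: sets_pair_measure)
    show "sets (Q \<bind> k) =
        sigma_sets (space (F t) \<times> space borel) {a \<times> b |a b. a \<in> sets (F t) \<and> b \<in> sets borel}"
      using Q.not_empty unfolding sets_pair_measure[symmetric]
      by (intro sets_bind) (auto simp: k_def)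
    show "emeasure (distr Q (F t \<Otimes>\<^sub>M borel) (\<lambda>\<omega>. (\<omega>, X (t + s) \<omega>))) E = emeasure (Q \<bind> k) E"
      if E_in: "E \<in> {a \<times> b |a b. a \<in> sets (F t) \<and> b \<in> sets borel}" for E
    proof -
      obtain A B where E: "E = A \<times> B" and A: "A \<in> sets (F t)" and B[measurable]: "B \<in> sets borel"
        using E_in by auto
      have [measurable]: "E \<in> sets (F t \<Otimes>\<^sub>M borel)" using A by (simp add: E)
      have "emeasure (distr Q (F t \<Otimes>\<^sub>M borel) (\<lambda>\<omega>. (\<omega>, X (t + s) \<omega>))) E
          = (\<integral>\<^sup>+z. indicator E z \<partial>distr Q (F t \<Otimes>\<^sub>M borel) (\<lambda>\<omega>. (\<omega>, X (t + s) \<omega>)))"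
        by simp
      also have "\<dots> = (\<integral>\<^sup>+\<omega>. indicator E (\<omega>, X (t + s) \<omega>) \<partial>Q)"
        by (rule nn_integral_distr[OF pair]) simp
      also have "\<dots> = (\<integral>\<^sup>+\<omega>. indicator A \<omega> * indicator B (X (t + s) \<omega>) \<partial>Q)"
        by (simp add: E indicator_times)
      also have "\<dots> = (\<integral>\<^sup>+\<omega>. indicator A \<omega> * emeasure (transition X P s (X t \<omega>)) B \<partial>Q)"
        by (rule markov_Q[OF t s A B])
      also have "\<dots> = (\<integral>\<^sup>+\<omega>. emeasure (k \<omega>) E \<partial>Q)"
      proof (intro nn_integral_cong)
        fix \<omega> assume "\<omega> \<in> space Q"
        then have w: "\<omega> \<in> space M" by simp
        show "indicator A \<omega> * emeasure (transition X P s (X t \<omega>)) B = emeasure (k \<omega>) E"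
          unfolding k_def using w
          using A by (subst emeasure_distr[OF pr[OF w]]) (auto simp: E indicator_def)
      qed
      also have "\<dots> = emeasure (Q \<bind> k) E"
        using Q.not_empty by (intro emeasure_bind[symmetric, OF _ k]) auto
      finally show ?thesis .
    qed
    show "emeasure (distr Q (F t \<Otimes>\<^sub>M borel) (\<lambda>\<omega>. (\<omega>, X (t + s) \<omega>))) (space (F t) \<times> space borel) \<noteq> \<infinity>"
      using finite_measure.emeasure_finite[OF prob_space.finite_measure[OF Q.prob_space_distr[OF pair]]]
      by simp
    have "space M \<in> sets (F t)" using sets.top[of "F t"] by simp
    then have "space (F t) \<times> space borel \<in> {a \<times> b |a b. a \<in> sets (F t) \<and> b \<in> sets borel}"
      by (intro CollectI exI[of _ "space (F t)"] exI[of _ "space borel"]) auto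
    then show "range (\<lambda>_. space (F t) \<times> space borel) \<subseteq> {a \<times> b |a b. a \<in> sets (F t) \<and> b \<in> sets borel}"
      by blast
  qed auto
  note eq = this
  have "(\<integral>\<^sup>+\<omega>. H (\<omega>, X (t + s) \<omega>) \<partial>Q) = (\<integral>\<^sup>+z. H z \<partial>distr Q (F t \<Otimes>\<^sub>M borel) (\<lambda>\<omega>. (\<omega>, X (t + s) \<omega>)))"
    by (simp add: nn_integral_distr)
  also have "\<dots> = (\<integral>\<^sup>+\<omega>. \<integral>\<^sup>+z. H z \<partial>k \<omega> \<partial>Q)"
    unfolding eq by (rule nn_integral_bind[OF H k])
  also have "\<dots> = (\<integral>\<^sup>+\<omega>. \<integral>\<^sup>+y. H (\<omega>, y) \<partial>transition X P s (X t \<omega>) \<partial>Q)"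
    unfolding k_def using pr by (intro nn_integral_cong nn_integral_distr) auto
  finally show ?thesis .
qed

lemma X_clamped_right_continuous:
  assumes "\<omega> \<in> space M"
  shows "continuous (at_right s) (\<lambda>s. X (max 0 s) \<omega>)"
proof (cases "s < 0")
  case True
  have "\<forall>\<^sub>F u in at_right s. X (max 0 u) \<omega> = X 0 \<omega>"
    unfolding eventually_at_right[OF True] using True by (intro exI[of _ 0]) auto
  then show ?thesis
    using True unfolding continuous_within by (auto intro: tendsto_eventually)
next
  case False
  then have "continuous (at_right s) (\<lambda>s. X s \<omega>)" using X_right_continuous[OF assms, of s] by simp
  moreover have "\<forall>\<^sub>F u in at_right s. X u \<omega> = X (max 0 u) \<omega>"
    using eventually_at_right_less[of s] by eventually_elim (use False in auto)
  ultimately show ?thesis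
    using False unfolding continuous_within by (auto elim: Lim_transform_eventually)
qed

text \<open>
  Time is clamped at 0 because nothing is known about \<open>X\<close> at negative times.
\<close>

lemma X_jointly_measurable[measurable]: "(\<lambda>(s, \<omega>). X (max 0 s) \<omega>) \<in> borel \<Otimes>\<^sub>M M \<rightarrow>\<^sub>M borel"
proof (rule borel_measurable_LIMSEQ_metric)
  let ?t = "\<lambda>m s. 0 + 1 / Suc m * \<lceil>(s - 0) / (1 / Suc m)\<rceil>"
  show "(\<lambda>(s, \<omega>). X (max 0 (?t m s)) \<omega>) \<in> borel_measurable (borel \<Otimes>\<^sub>M M)" for m
    unfolding case_prod_beta'
  proof (rule measurable_compose_countable'[where g="\<lambda>z. \<lceil>(fst z - 0) / (1 / Suc m)\<rceil>" and I=UNIV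
        and f="\<lambda>k z. X (max 0 (0 + 1 / Suc m * real_of_int k)) (snd z)"])
    show "(\<lambda>z. X (max 0 (0 + 1 / Suc m * real_of_int k)) (snd z)) \<in> borel \<Otimes>\<^sub>M M \<rightarrow>\<^sub>M borel" for k
      by (rule measurable_compose[OF measurable_snd X_measurable]) simp
    show "(\<lambda>z. \<lceil>(fst z - 0) / (1 / Suc m)\<rceil>) \<in> borel \<Otimes>\<^sub>M M \<rightarrow>\<^sub>M count_space UNIV"
      by measurable
  qed simp
  show "(\<lambda>m. case z of (s, \<omega>) \<Rightarrow> X (max 0 (?t m s)) \<omega>) \<longlonglongrightarrow> (case z of (s, \<omega>) \<Rightarrow> X (max 0 s) \<omega>)"
    if z: "z \<in> space (borel \<Otimes>\<^sub>M M)" for z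
  proof -
    obtain s \<omega> where z': "z = (s, \<omega>)" "\<omega> \<in> space M" using z by (auto simp: space_pair_measure)
    have "(\<lambda>m. X (max 0 (?t m s)) \<omega>) \<longlonglongrightarrow> X (max 0 s) \<omega>"
      by (intro tendsto_right_continuous_seq[OF X_clamped_right_continuous[OF z'(2)]]
          ceiling_grid_tendsto ceiling_grid_bounds) auto
    then show ?thesis by (simp add: z')
  qed
qed

section \<open>Decoupling the future across a gap\<close>

text \<open>
  Functionals of the future are computed on a time grid of mesh \<open>\<delta>\<close>: a state of an arbitrary type is
  updated with each new position of the process. The second function below is the expectation of \<open>v\<close> at
  the final state, given the present state and position; it is the backward recursion that belongs to the
  Markov chain of states and positions.
\<close>

primrec fold_path :: "real \<Rightarrow> ('n \<Rightarrow> 'a \<Rightarrow> 'n) \<Rightarrow> nat \<Rightarrow> 'n \<Rightarrow> real \<Rightarrow> 'w \<Rightarrow> 'n" where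
  "fold_path \<delta> up 0 w s \<omega> = w"
| "fold_path \<delta> up (Suc k) w s \<omega> = fold_path \<delta> up k (up w (X (s + \<delta>) \<omega>)) (s + \<delta>) \<omega>"

primrec expected_fold ::
  "real \<Rightarrow> ('n \<Rightarrow> 'a \<Rightarrow> 'n) \<Rightarrow> ('n \<Rightarrow> ennreal) \<Rightarrow> nat \<Rightarrow> 'n \<times> 'a \<Rightarrow> ennreal" where
  "expected_fold \<delta> up v 0 = (\<lambda>z. v (fst z))"
| "expected_fold \<delta> up v (Suc k) =
     (\<lambda>z. \<integral>\<^sup>+y. expected_fold \<delta> up v k (up (fst z) y, y) \<partial>transition X P \<delta> (snd z))"

context
  fixes \<delta> :: real and up :: "'n \<Rightarrow> 'a \<Rightarrow> 'n" and v :: "'n \<Rightarrow> ennreal" and N :: "'n measure"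
  assumes \<delta>: "\<delta> \<ge> 0"
    and up[measurable]: "case_prod up \<in> N \<Otimes>\<^sub>M borel \<rightarrow>\<^sub>M N"
    and v[measurable]: "v \<in> borel_measurable N"
begin

lemma expected_fold_measurable[measurable]: "expected_fold \<delta> up v k \<in> borel_measurable (N \<Otimes>\<^sub>M borel)"
proof (induction k)
  case 0
  show ?case by simp
next
  case (Suc k)
  note [measurable] = Suc
  have [measurable]: "transition X P \<delta> \<in> borel \<rightarrow>\<^sub>M subprob_algebra borel"
    by (rule measurable_prob_algebraD[OF kernel_transition[OF \<delta>]])
  show ?case
    unfolding expected_fold.simps
    by (rule nn_integral_measurable_subprob_algebra2[where N=borel]) measurable
qed

lemma expected_fold_le_1:
  assumes "\<And>w. v w \<le> 1"
  shows "expected_fold \<delta> up v k z \<le> 1"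
proof (induction k arbitrary: z)
  case (Suc k)
  interpret T: prob_space "transition X P \<delta> (snd z)" by (rule prob_space_transition[OF \<delta>])
  have "expected_fold \<delta> up v (Suc k) z \<le> (\<integral>\<^sup>+y. 1 \<partial>transition X P \<delta> (snd z))"
    unfolding expected_fold.simps by (intro nn_integral_mono Suc)
  also have "\<dots> = 1" using T.emeasure_space_1 by simp
  finally show ?case .
qed (simp add: assms)

lemma nn_integral_expected_fold:
  assumes "s \<ge> 0" "W \<in> F s \<rightarrow>\<^sub>M N"
  shows "(\<integral>\<^sup>+\<omega>. expected_fold \<delta> up v k (W \<omega>, X s \<omega>) \<partial>Q) = (\<integral>\<^sup>+\<omega>. v (fold_path \<delta> up k (W \<omega>) s \<omega>) \<partial>Q)"
  using assms
proof (induction k arbitrary: s W)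
  case 0
  then show ?case by simp
next
  case (Suc k)
  note [measurable] = Suc.prems(2)
  have s: "s + \<delta> \<ge> 0" using \<delta> Suc.prems by simp
  have "(\<integral>\<^sup>+\<omega>. expected_fold \<delta> up v (Suc k) (W \<omega>, X s \<omega>) \<partial>Q)
      = (\<integral>\<^sup>+\<omega>. \<integral>\<^sup>+y. expected_fold \<delta> up v k (up (W (fst (\<omega>, y))) (snd (\<omega>, y)), snd (\<omega>, y)) \<partial>transition X P \<delta> (X s \<omega>) \<partial>Q)"
    by simp
  also have "\<dots> = (\<integral>\<^sup>+\<omega>. expected_fold \<delta> up v k (up (W \<omega>) (X (s + \<delta>) \<omega>), X (s + \<delta>) \<omega>) \<partial>Q)"
    by (subst markov_step[OF Suc.prems(1) \<delta>, symmetric]) measurable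
  also have "\<dots> = (\<integral>\<^sup>+\<omega>. v (fold_path \<delta> up k (up (W \<omega>) (X (s + \<delta>) \<omega>)) (s + \<delta>) \<omega>) \<partial>Q)"
  proof (rule Suc.IH[OF s])
    have [measurable]: "W \<in> F (s + \<delta>) \<rightarrow>\<^sub>M N" "X (s + \<delta>) \<in> F (s + \<delta>) \<rightarrow>\<^sub>M borel"
      using \<delta> s by (auto intro: measurable_F_mono[OF Suc.prems(2)] X_measurable_F)
    show "(\<lambda>\<omega>. up (W \<omega>) (X (s + \<delta>) \<omega>)) \<in> F (s + \<delta>) \<rightarrow>\<^sub>M N" by measurable
  qed
  finally show ?case by simp
qed

text \<open>
  By the Markov property, the left hand side depends on the future only through the position
  \<open>X (t + a)\<close>, whose conditional law given the past is the transition probability after time \<open>a\<close>.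
  The hypothesis \<open>mixing\<close> replaces this law by \<open>\<mu>\<close>, and \<open>\<mu>\<close> is again the law of \<open>X (t + a)\<close> in
  an independent copy.
\<close>

lemma decoupling_fold:
  assumes v1: "\<And>w. v w \<le> 1" and t: "t \<ge> 0" and a: "a \<ge> 0" and W[measurable]: "W \<in> F t \<rightarrow>\<^sub>M N"
    and mixing: "\<And>H. H \<in> borel_measurable (F t \<Otimes>\<^sub>M borel) \<Longrightarrow> (\<And>z. H z \<le> 1) \<Longrightarrow>
      (\<integral>\<^sup>+\<omega>. \<integral>\<^sup>+y. H (\<omega>, y) \<partial>transition X P a (X t \<omega>) \<partial>Q) \<le> (\<integral>\<^sup>+\<omega>. \<integral>\<^sup>+y. H (\<omega>, y) \<partial>\<mu> \<partial>Q) + e"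
  shows "(\<integral>\<^sup>+\<omega>. v (fold_path \<delta> up k (W \<omega>) (t + a) \<omega>) \<partial>Q) \<le>
    (\<integral>\<^sup>+\<omega>. \<integral>\<^sup>+\<omega>'. v (fold_path \<delta> up k (W \<omega>) (t + a) \<omega>') \<partial>Q \<partial>Q) + e"
proof -
  have ta: "t + a \<ge> 0" using t a by simp
  have W': "W \<in> F (t + a) \<rightarrow>\<^sub>M N" using a by (intro measurable_F_mono[OF W]) simp
  have "(\<integral>\<^sup>+\<omega>. v (fold_path \<delta> up k (W \<omega>) (t + a) \<omega>) \<partial>Q) = (\<integral>\<^sup>+\<omega>. expected_fold \<delta> up v k (W \<omega>, X (t + a) \<omega>) \<partial>Q)"
    by (rule nn_integral_expected_fold[symmetric, OF ta W'])
  also have "\<dots> = (\<integral>\<^sup>+\<omega>. expected_fold \<delta> up v k (W (fst (\<omega>, X (t + a) \<omega>)), snd (\<omega>, X (t + a) \<omega>)) \<partial>Q)" by simp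
  also have "\<dots> = (\<integral>\<^sup>+\<omega>. \<integral>\<^sup>+y. expected_fold \<delta> up v k (W (fst (\<omega>, y)), snd (\<omega>, y)) \<partial>transition X P a (X t \<omega>) \<partial>Q)"
    by (rule markov_step[OF t a]) measurable
  also have "\<dots> \<le> (\<integral>\<^sup>+\<omega>. \<integral>\<^sup>+y. expected_fold \<delta> up v k (W (fst (\<omega>, y)), snd (\<omega>, y)) \<partial>\<mu> \<partial>Q) + e"
    by (rule mixing) (measurable, rule expected_fold_le_1[OF v1])
  also have "(\<integral>\<^sup>+\<omega>. \<integral>\<^sup>+y. expected_fold \<delta> up v k (W (fst (\<omega>, y)), snd (\<omega>, y)) \<partial>\<mu> \<partial>Q)
      = (\<integral>\<^sup>+\<omega>. \<integral>\<^sup>+\<omega>'. v (fold_path \<delta> up k (W \<omega>) (t + a) \<omega>') \<partial>Q \<partial>Q)"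
  proof (intro nn_integral_cong)
    fix \<omega> assume "\<omega> \<in> space Q"
    then have w: "W \<omega> \<in> space N" using measurable_space[OF W, of \<omega>] by simp
    have "(\<integral>\<^sup>+y. expected_fold \<delta> up v k (W \<omega>, y) \<partial>\<mu>) = (\<integral>\<^sup>+y. expected_fold \<delta> up v k (W \<omega>, y) \<partial>distr Q borel (X (t + a)))"
      by (simp add: distr_X[OF ta])
    also have "\<dots> = (\<integral>\<^sup>+\<omega>'. expected_fold \<delta> up v k (W \<omega>, X (t + a) \<omega>') \<partial>Q)"
      using w X_measurable[OF ta] by (intro nn_integral_distr) (auto simp: measurable_cong_sets[OF sets_Q refl])
    also have "\<dots> = (\<integral>\<^sup>+\<omega>'. v (fold_path \<delta> up k (W \<omega>) (t + a) \<omega>') \<partial>Q)"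
      using w by (intro nn_integral_expected_fold ta) simp
    finally show "(\<integral>\<^sup>+y. expected_fold \<delta> up v k (W (fst (\<omega>, y)), snd (\<omega>, y)) \<partial>\<mu>)
      = (\<integral>\<^sup>+\<omega>'. v (fold_path \<delta> up k (W \<omega>) (t + a) \<omega>') \<partial>Q)" by simp
  qed
  finally show ?thesis .
qed

end

section \<open>Time integrals over blocks\<close>

definition block :: "('a \<Rightarrow> real) \<Rightarrow> real \<Rightarrow> real \<Rightarrow> 'w \<Rightarrow> real" where
  "block f r a \<omega> = (LINT s:{r..r + a}|lborel. f (X s \<omega>))"

lemma path_functional_right_continuous:
  fixes f :: "'a \<Rightarrow> real"
  assumes "\<omega> \<in> space M" "continuous_on UNIV f"
  shows "continuous (at_right s) (\<lambda>s. f (X (max 0 s) \<omega>))"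
  using assms(2) X_clamped_right_continuous[OF assms(1), of s]
  unfolding continuous_on_eq_continuous_at[OF open_UNIV] continuous_within[of s]
  by (elim isCont_tendsto_compose[rotated]) auto

lemma block_clamped:
  assumes "r \<ge> 0"
  shows "block f r a \<omega> = (LINT s:{r..r + a}|lborel. f (X (max 0 s) \<omega>))"
  unfolding block_def using assms by (intro set_lebesgue_integral_cong) auto

lemma block_riemann:
  fixes f :: "'a \<Rightarrow> real"
  assumes "\<omega> \<in> space M" "r \<ge> 0" "a > 0" "continuous_on UNIV f" "\<And>x. \<bar>f x\<bar> \<le> B"
  shows "(\<lambda>m. a / Suc m * (\<Sum>k<Suc m. f (X (r + Suc k * (a / Suc m)) \<omega>))) \<longlonglongrightarrow> block f r a \<omega>"
proof -
  have "(\<lambda>m. a / Suc m * (\<Sum>k=1..Suc m. f (X (max 0 (r + k * (a / Suc m))) \<omega>))) \<longlonglongrightarrow> block f r a \<omega>"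
    unfolding block_clamped[OF assms(2)]
    by (rule riemann_sums_converge[OF assms(3) path_functional_right_continuous[OF assms(1,4)] assms(5)])
  moreover have "max 0 (r + real k * (a / Suc m)) = r + real k * (a / Suc m)" for k m
    using assms by (intro max_absorb2) simp
  ultimately show ?thesis
    by (simp only: One_nat_def sum.atLeast1_atMost_eq)
qed

lemma block_measurable_F:
  fixes f :: "'a \<Rightarrow> real"
  assumes "r \<ge> 0" "a > 0" "r + a \<le> t" "continuous_on UNIV f" "\<And>x. \<bar>f x\<bar> \<le> B"
  shows "block f r a \<in> borel_measurable (F t)"
proof (rule borel_measurable_LIMSEQ_real)
  show "(\<lambda>m. a / Suc m * (\<Sum>k<Suc m. f (X (r + Suc k * (a / Suc m)) \<omega>))) \<longlonglongrightarrow> block f r a \<omega>"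
    if "\<omega> \<in> space (F t)" for \<omega>
    using that by (intro block_riemann[OF _ assms(1,2,4,5)]) simp
  show "(\<lambda>\<omega>. a / Suc m * (\<Sum>k<Suc m. f (X (r + Suc k * (a / Suc m)) \<omega>))) \<in> borel_measurable (F t)" for m
  proof (intro borel_measurable_times borel_measurable_const borel_measurable_sum)
    fix k assume k: "k \<in> {..<Suc m}"
    have "Suc k * (a / Suc m) \<le> Suc m * (a / Suc m)"
      using k assms(2) by (intro mult_right_mono) auto
    also have "\<dots> = a" by simp
    finally have "r + Suc k * (a / Suc m) \<le> t" using assms(3) by simp
    moreover have "0 \<le> r + Suc k * (a / Suc m)" using assms(1,2) by simp
    ultimately have "X (r + Suc k * (a / Suc m)) \<in> F t \<rightarrow>\<^sub>M borel"
      by (intro X_measurable_F)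
    then show "(\<lambda>\<omega>. f (X (r + Suc k * (a / Suc m)) \<omega>)) \<in> borel_measurable (F t)"
      using borel_measurable_continuous_onI[OF assms(4)] by (rule measurable_compose)
  qed
qed

lemma block_measurable:
  fixes f :: "'a \<Rightarrow> real"
  assumes "r \<ge> 0" "a > 0" "continuous_on UNIV f" "\<And>x. \<bar>f x\<bar> \<le> B"
  shows "block f r a \<in> borel_measurable M"
  using block_measurable_F[OF assms(1,2) order_refl assms(3,4)] by (rule measurable_F_M)

lemma block_set_integrable:
  fixes f :: "'a \<Rightarrow> real"
  assumes "\<omega> \<in> space M" "r \<ge> 0" "continuous_on UNIV f" "\<And>x. \<bar>f x\<bar> \<le> B"
  shows "set_integrable lborel {r..t} (\<lambda>s. f (X s \<omega>))"
proof -
  have [measurable]: "(\<lambda>s. f (X (max 0 s) \<omega>)) \<in> borel_measurable borel"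
    by (intro right_continuous_measurable path_functional_right_continuous assms)
  have "set_integrable lborel {r..t} (\<lambda>s. f (X (max 0 s) \<omega>))"
    unfolding set_integrable_def
  proof (rule Bochner_Integration.integrable_bound)
    show "integrable lborel (\<lambda>s. indicator {r..t} s * B)"
      by (cases "r \<le> t") (auto intro!: integrable_mult_left integrable_real_indicator)
    have "0 \<le> B" using assms(4)[of undefined] by linarith
    then show "AE s in lborel. norm (indicat_real {r..t} s *\<^sub>R f (X (max 0 s) \<omega>)) \<le> norm (indicator {r..t} s * B)"
      using assms(4) by (auto simp: indicator_def)
  qed measurable
  then show ?thesis
    unfolding set_integrable_def
    by (rule Bochner_Integration.integrable_cong[OF refl, THEN iffD1, rotated]) (use assms(2) in \<open>auto simp: indicator_def\<close>)
qed

lemma block_bound: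
  fixes f :: "'a \<Rightarrow> real"
  assumes "\<omega> \<in> space M" "r \<ge> 0" "a \<ge> 0" "continuous_on UNIV f" "\<And>x. \<bar>f x\<bar> \<le> B"
  shows "\<bar>block f r a \<omega>\<bar> \<le> a * B"
proof -
  have "\<bar>block f r a \<omega>\<bar> \<le> (\<integral>s. indicator {r..r+a} s * B \<partial>lborel)"
    unfolding block_def set_lebesgue_integral_def real_norm_def[symmetric]
  proof (rule Bochner_Integration.integral_norm_bound_integral)
    show "integrable lborel (\<lambda>s. indicat_real {r..r + a} s *\<^sub>R f (X s \<omega>))"
      using block_set_integrable[OF assms(1,2,4,5)] by (simp add: set_integrable_def)
    show "integrable lborel (\<lambda>s. indicator {r..r + a} s * B)"
      using assms(3) by (intro integrable_mult_left integrable_real_indicator) auto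
  qed (use assms(5) in \<open>auto simp: indicator_def\<close>)
  also have "\<dots> = a * B" using assms(3) by simp
  finally show ?thesis .
qed

text \<open>
  With this update the state at the end carries, for every \<open>i\<close>, the exponential of a Riemann sum of
  the \<open>i\<close>-th function; a finite family of block integrals is thereby one state of the chain.
\<close>

lemma fold_path_exp_sum:
  fixes f :: "'i \<Rightarrow> 'a \<Rightarrow> real" and I and \<delta> :: real
  defines "up \<equiv> \<lambda>w y. \<lambda>i\<in>I. w i * exp (\<delta> * f i y)"
  assumes "w \<in> extensional I" "\<delta> \<ge> 0"
  shows "fold_path \<delta> up k w s \<omega> = (\<lambda>i\<in>I. w i * exp (\<delta> * (\<Sum>j<k. f i (X (s + Suc j * \<delta>) \<omega>))))"
  using assms(2)
proof (induction k arbitrary: w s)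
  case 0
  then show ?case by (auto simp: extensional_def fun_eq_iff restrict_def)
next
  case (Suc k)
  have "up w (X (s + \<delta>) \<omega>) \<in> extensional I" by (simp add: up_def)
  from Suc.IH[OF this, of "s + \<delta>"] show ?case
    unfolding fold_path.simps
    by (intro ext) (auto simp: up_def restrict_def sum.lessThan_Suc_shift algebra_simps
        exp_add simp del: sum.lessThan_Suc)
qed

text \<open>
  The Riemann sum version is \<open>decoupling_fold\<close>, followed by
  \<open>E (min 1 Z) \<le> min 1 (E Z)\<close> for the independent copy. The minimum and the block integrals are
  bounded, so dominated convergence takes the mesh to 0.
\<close>

lemma block_decoupling:
  fixes f :: "'i \<Rightarrow> 'a \<Rightarrow> real" and W :: "'i \<Rightarrow> 'w \<Rightarrow> real"
  assumes I: "finite I" and t: "t \<ge> 0" and a: "a > 0" and e: "e \<ge> 0"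
    and W[measurable]: "\<And>i. i \<in> I \<Longrightarrow> W i \<in> borel_measurable (F t)"
    and W0: "\<And>i \<omega>. i \<in> I \<Longrightarrow> \<omega> \<in> space M \<Longrightarrow> 0 \<le> W i \<omega>"
    and f: "\<And>i. i \<in> I \<Longrightarrow> continuous_on UNIV (f i)" "\<And>i x. i \<in> I \<Longrightarrow> \<bar>f i x\<bar> \<le> B i"
    and mixing: "\<And>H. H \<in> borel_measurable (F t \<Otimes>\<^sub>M borel) \<Longrightarrow> (\<And>z. H z \<le> 1) \<Longrightarrow>
      (\<integral>\<^sup>+\<omega>. \<integral>\<^sup>+y. H (\<omega>, y) \<partial>transition X P a (X t \<omega>) \<partial>Q)
        \<le> (\<integral>\<^sup>+\<omega>. \<integral>\<^sup>+y. H (\<omega>, y) \<partial>\<mu> \<partial>Q) + ennreal e"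
  shows "Q.expectation (\<lambda>\<omega>. min 1 (\<Sum>i\<in>I. W i \<omega> * exp (block (f i) (t + a) a \<omega>)))
    \<le> Q.expectation (\<lambda>\<omega>. min 1 (\<Sum>i\<in>I. W i \<omega> * Q.expectation (\<lambda>\<omega>'. exp (block (f i) (t + a) a \<omega>')))) + e"
proof -
  have W'[measurable]: "W i \<in> borel_measurable M" if "i \<in> I" for i
    using W[OF that] by (rule measurable_F_M)
  define R where "R m i \<omega> = a / Suc m * (\<Sum>k<Suc m. f i (X (t + a + Suc k * (a / Suc m)) \<omega>))" for m :: nat and i \<omega>
  have R[measurable]: "R m i \<in> borel_measurable M" if "i \<in> I" for m i
    unfolding R_def
  proof (intro borel_measurable_times borel_measurable_const borel_measurable_sum)
    fix k
    have "X (t + a + Suc k * (a / Suc m)) \<in> M \<rightarrow>\<^sub>M borel"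
      using t a by (intro X_measurable) simp
    then show "(\<lambda>\<omega>. f i (X (t + a + Suc k * (a / Suc m)) \<omega>)) \<in> borel_measurable M"
      using borel_measurable_continuous_onI[OF f(1)[OF that]] by (rule measurable_compose)
  qed
  have Rb: "R m i \<omega> \<le> a * B i" if "i \<in> I" for m i \<omega>
  proof -
    have "(\<Sum>k<Suc m. f i (X (t + a + Suc k * (a / Suc m)) \<omega>)) \<le> (\<Sum>k<Suc m. B i)"
      using f(2)[OF that] by (intro sum_mono) (auto dest: abs_le_D1)
    then have "R m i \<omega> \<le> a / Suc m * (\<Sum>k<Suc m. B i)"
      unfolding R_def using a by (intro mult_left_mono) auto
    also have "\<dots> = a * B i" by simp
    finally show ?thesis .
  qed
  have lim: "(\<lambda>m. R m i \<omega>) \<longlonglongrightarrow> block (f i) (t + a) a \<omega>" if "i \<in> I" "\<omega> \<in> space M" for i \<omega>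
    unfolding R_def using t a that by (intro block_riemann[where B="B i"] f) auto
  have bm[measurable]: "block (f i) (t + a) a \<in> borel_measurable M" if "i \<in> I" for i
    using t a that by (intro block_measurable[where B="B i"] f) auto
  define m' where "m' m i = Q.expectation (\<lambda>\<omega>. exp (R m i \<omega>))" for m i
  have Rint: "integrable Q (\<lambda>\<omega>. exp (R m i \<omega>))" if "i \<in> I" for m i
    using Rb[OF that] R[OF that] by (intro Q.integrable_const_bound[where B="exp (a * B i)"]) auto
  have m'0: "0 \<le> m' m i" for m i unfolding m'_def by (intro integral_nonneg_AE) auto
  have discrete: "Q.expectation (\<lambda>\<omega>. min 1 (\<Sum>i\<in>I. W i \<omega> * exp (R m i \<omega>)))
    \<le> Q.expectation (\<lambda>\<omega>. min 1 (\<Sum>i\<in>I. W i \<omega> * m' m i)) + e" for m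
  proof -
    define \<delta> where "\<delta> = a / Suc m"
    define N where "N = PiM I (\<lambda>_. borel :: real measure)"
    define up where "up = (\<lambda>w y. \<lambda>i\<in>I. w i * exp (\<delta> * f i y))"
    define v where "v w = ennreal (min 1 (\<Sum>i\<in>I. w i))" for w :: "'i \<Rightarrow> real"
    define V where "V \<omega> = (\<lambda>i\<in>I. W i \<omega>)" for \<omega>
    have \<delta>: "\<delta> \<ge> 0" using a by (simp add: \<delta>_def)
    have fm[measurable]: "f i \<in> borel_measurable borel" if "i \<in> I" for i
      using f(1)[OF that] by (rule borel_measurable_continuous_onI)
    have up: "case_prod up \<in> N \<Otimes>\<^sub>M borel \<rightarrow>\<^sub>M N"
      unfolding up_def N_def case_prod_beta' by measurable
    have v: "v \<in> borel_measurable N"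
      unfolding v_def N_def by measurable
    have V: "V \<in> F t \<rightarrow>\<^sub>M N"
      unfolding V_def N_def by measurable
    have v1: "v w \<le> 1" for w by (simp add: v_def)
    have fp: "fold_path \<delta> up (Suc m) (V \<omega>) (t + a) \<omega>' = (\<lambda>i\<in>I. W i \<omega> * exp (R m i \<omega>'))" for \<omega> \<omega>'
      unfolding up_def by (subst fold_path_exp_sum) (use \<delta> in \<open>auto simp: V_def R_def \<delta>_def fun_eq_iff simp del: sum.lessThan_Suc\<close>)
    have s0: "0 \<le> (\<Sum>i\<in>I. W i \<omega> * exp (R m i \<omega>'))" if "\<omega> \<in> space M" for \<omega> \<omega>'
      using W0 that by (intro sum_nonneg) auto
    have s1: "0 \<le> (\<Sum>i\<in>I. W i \<omega> * m' m i)" if "\<omega> \<in> space M" for \<omega>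
      using W0 m'0 that by (intro sum_nonneg) auto
    have "(\<integral>\<^sup>+\<omega>. ennreal (min 1 (\<Sum>i\<in>I. W i \<omega> * exp (R m i \<omega>))) \<partial>Q)
        \<le> (\<integral>\<^sup>+\<omega>. \<integral>\<^sup>+\<omega>'. ennreal (min 1 (\<Sum>i\<in>I. W i \<omega> * exp (R m i \<omega>'))) \<partial>Q \<partial>Q) + ennreal e"
      using decoupling_fold[OF \<delta> up v v1 t less_imp_le[OF a] V mixing, of "Suc m"]
      unfolding fp by (simp add: v_def)
    also have "(\<integral>\<^sup>+\<omega>. \<integral>\<^sup>+\<omega>'. ennreal (min 1 (\<Sum>i\<in>I. W i \<omega> * exp (R m i \<omega>'))) \<partial>Q \<partial>Q)
        \<le> (\<integral>\<^sup>+\<omega>. ennreal (min 1 (\<Sum>i\<in>I. W i \<omega> * m' m i)) \<partial>Q)"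
    proof (rule nn_integral_mono)
      fix \<omega> assume "\<omega> \<in> space Q"
      then have w: "\<omega> \<in> space M" by simp
      have int: "integrable Q (\<lambda>\<omega>'. \<Sum>i\<in>I. W i \<omega> * exp (R m i \<omega>'))"
        using Rint by auto
      have minint: "integrable Q (\<lambda>\<omega>'. min 1 (\<Sum>i\<in>I. W i \<omega> * exp (R m i \<omega>')))"
        using int by (intro integrable_min) auto
      have "(\<integral>\<^sup>+\<omega>'. ennreal (min 1 (\<Sum>i\<in>I. W i \<omega> * exp (R m i \<omega>'))) \<partial>Q)
          = ennreal (Q.expectation (\<lambda>\<omega>'. min 1 (\<Sum>i\<in>I. W i \<omega> * exp (R m i \<omega>'))))"
        using s0[OF w] minint by (intro nn_integral_eq_integral) auto
      also have "\<dots> \<le> ennreal (min 1 (\<Sum>i\<in>I. W i \<omega> * m' m i))"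
      proof (intro ennreal_leI min.boundedI)
        have "Q.expectation (\<lambda>\<omega>'. min 1 (\<Sum>i\<in>I. W i \<omega> * exp (R m i \<omega>'))) \<le> Q.expectation (\<lambda>\<omega>'. 1)"
          using minint by (intro integral_mono) auto
        then show "Q.expectation (\<lambda>\<omega>'. min 1 (\<Sum>i\<in>I. W i \<omega> * exp (R m i \<omega>'))) \<le> 1"
          using Q.prob_space by simp
        have "Q.expectation (\<lambda>\<omega>'. min 1 (\<Sum>i\<in>I. W i \<omega> * exp (R m i \<omega>')))
            \<le> Q.expectation (\<lambda>\<omega>'. \<Sum>i\<in>I. W i \<omega> * exp (R m i \<omega>'))"
          using minint int by (intro integral_mono) auto
        also have "\<dots> = (\<Sum>i\<in>I. W i \<omega> * m' m i)"
          using Rint by (simp add: m'_def)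
        finally show "Q.expectation (\<lambda>\<omega>'. min 1 (\<Sum>i\<in>I. W i \<omega> * exp (R m i \<omega>'))) \<le> (\<Sum>i\<in>I. W i \<omega> * m' m i)" .
      qed
      finally show "(\<integral>\<^sup>+\<omega>'. ennreal (min 1 (\<Sum>i\<in>I. W i \<omega> * exp (R m i \<omega>'))) \<partial>Q)
          \<le> ennreal (min 1 (\<Sum>i\<in>I. W i \<omega> * m' m i))" .
    qed
    finally have le: "(\<integral>\<^sup>+\<omega>. ennreal (min 1 (\<Sum>i\<in>I. W i \<omega> * exp (R m i \<omega>))) \<partial>Q)
        \<le> (\<integral>\<^sup>+\<omega>. ennreal (min 1 (\<Sum>i\<in>I. W i \<omega> * m' m i)) \<partial>Q) + ennreal e"
      by (meson add_right_mono order_trans)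
    have "(\<integral>\<^sup>+\<omega>. ennreal (min 1 (\<Sum>i\<in>I. W i \<omega> * exp (R m i \<omega>))) \<partial>Q)
        = ennreal (Q.expectation (\<lambda>\<omega>. min 1 (\<Sum>i\<in>I. W i \<omega> * exp (R m i \<omega>))))"
      using s0 by (intro nn_integral_eq_integral Q.integrable_const_bound[where B=1]) auto
    moreover have "(\<integral>\<^sup>+\<omega>. ennreal (min 1 (\<Sum>i\<in>I. W i \<omega> * m' m i)) \<partial>Q)
        = ennreal (Q.expectation (\<lambda>\<omega>. min 1 (\<Sum>i\<in>I. W i \<omega> * m' m i)))"
      using s1 by (intro nn_integral_eq_integral Q.integrable_const_bound[where B=1]) auto
    moreover have "0 \<le> Q.expectation (\<lambda>\<omega>. min 1 (\<Sum>i\<in>I. W i \<omega> * m' m i))"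
      using s1 by (intro integral_nonneg_AE) auto
    ultimately show ?thesis
      using le e by (simp flip: ennreal_plus)
  qed
  have m'lim: "(\<lambda>m. m' m i) \<longlonglongrightarrow> Q.expectation (\<lambda>\<omega>'. exp (block (f i) (t + a) a \<omega>'))" if "i \<in> I" for i
    unfolding m'_def
  proof (rule integral_dominated_convergence[where w="\<lambda>_. exp (a * B i)"])
    show "AE \<omega> in Q. (\<lambda>m. exp (R m i \<omega>)) \<longlonglongrightarrow> exp (block (f i) (t + a) a \<omega>)"
      using lim[OF that] by (intro AE_I2 tendsto_intros) auto
  qed (use Rb[OF that] bm[OF that] R[OF that] in auto)
  have "(\<lambda>m. Q.expectation (\<lambda>\<omega>. min 1 (\<Sum>i\<in>I. W i \<omega> * exp (R m i \<omega>))))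
    \<longlonglongrightarrow> Q.expectation (\<lambda>\<omega>. min 1 (\<Sum>i\<in>I. W i \<omega> * exp (block (f i) (t + a) a \<omega>)))"
  proof (rule integral_dominated_convergence[where w="\<lambda>_. 1"])
    show "AE \<omega> in Q. (\<lambda>m. min 1 (\<Sum>i\<in>I. W i \<omega> * exp (R m i \<omega>)))
      \<longlonglongrightarrow> min 1 (\<Sum>i\<in>I. W i \<omega> * exp (block (f i) (t + a) a \<omega>))"
      using lim by (intro AE_I2 tendsto_intros) auto
    show "AE \<omega> in Q. norm (min 1 (\<Sum>i\<in>I. W i \<omega> * exp (R m i \<omega>))) \<le> 1" for m
    proof (intro AE_I2)
      fix \<omega> assume "\<omega> \<in> space Q"
      then have "0 \<le> (\<Sum>i\<in>I. W i \<omega> * exp (R m i \<omega>))"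
        using W0 by (intro sum_nonneg) auto
      then show "norm (min 1 (\<Sum>i\<in>I. W i \<omega> * exp (R m i \<omega>))) \<le> 1" by simp
    qed
  qed auto
  moreover have "(\<lambda>m. Q.expectation (\<lambda>\<omega>. min 1 (\<Sum>i\<in>I. W i \<omega> * m' m i)) + e)
    \<longlonglongrightarrow> Q.expectation (\<lambda>\<omega>. min 1 (\<Sum>i\<in>I. W i \<omega> * Q.expectation (\<lambda>\<omega>'. exp (block (f i) (t + a) a \<omega>')))) + e"
  proof (intro tendsto_add tendsto_const integral_dominated_convergence[where w="\<lambda>_. 1"])
    show "AE \<omega> in Q. (\<lambda>m. min 1 (\<Sum>i\<in>I. W i \<omega> * m' m i))
      \<longlonglongrightarrow> min 1 (\<Sum>i\<in>I. W i \<omega> * Q.expectation (\<lambda>\<omega>'. exp (block (f i) (t + a) a \<omega>')))"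
      using m'lim by (intro AE_I2 tendsto_intros) auto
    show "AE \<omega> in Q. norm (min 1 (\<Sum>i\<in>I. W i \<omega> * m' m i)) \<le> 1" for m
    proof (intro AE_I2)
      fix \<omega> assume "\<omega> \<in> space Q"
      then have "0 \<le> (\<Sum>i\<in>I. W i \<omega> * m' m i)"
        using W0 m'0 by (intro sum_nonneg) auto
      then show "norm (min 1 (\<Sum>i\<in>I. W i \<omega> * m' m i)) \<le> 1" by simp
    qed
  qed auto
  ultimately show ?thesis
    using discrete by (intro LIMSEQ_le) auto
qed

end

section \<open>Mixing and exponential moments of separated blocks\<close>

locale stationary_density_process = stationary_process M X P \<mu>
  for M :: "'w measure"
    and X :: "real \<Rightarrow> 'w \<Rightarrow> 'a::euclidean_space"
    and P :: "'a \<Rightarrow> 'w measure"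
    and \<mu> :: "'a measure" +
  fixes p :: "real \<Rightarrow> 'a \<Rightarrow> 'a \<Rightarrow> real"
    and \<rho> :: "'a \<Rightarrow> real"
  assumes basic: "basic_assumption X P \<mu> p \<rho>"
begin

lemma p_measurable: "t > 0 \<Longrightarrow> (\<lambda>z. p t (fst z) (snd z)) \<in> borel_measurable (borel \<Otimes>\<^sub>M borel)"
  and p_nonneg: "t > 0 \<Longrightarrow> 0 \<le> p t x y"
  and transition_density: "t > 0 \<Longrightarrow> transition X P t x = density lborel (\<lambda>y. ennreal (p t x y))"
  and \<rho>_measurable[measurable]: "\<rho> \<in> borel_measurable borel"
  and \<rho>_nonneg: "0 \<le> \<rho> y"
  and \<mu>_density: "\<mu> = density lborel (\<lambda>y. ennreal (\<rho> y))"
  using basic by (auto simp: basic_assumption_def)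

lemma p_measurable2: "t > 0 \<Longrightarrow> (\<lambda>y. p t x y) \<in> borel_measurable borel"
  using measurable_compose[OF measurable_Pair1'[of x borel borel] p_measurable[of t]] by simp

lemma tv_distance_measurable:
  assumes t: "t > 0"
  shows "(\<lambda>x. \<integral>\<^sup>+y. ennreal \<bar>p t x y - \<rho> y\<bar> \<partial>lborel) \<in> borel_measurable borel"
proof (rule lborel.borel_measurable_nn_integral)
  note [measurable] = p_measurable[OF t]
  have "(\<lambda>z. ennreal \<bar>p t (fst z) (snd z) - \<rho> (snd z)\<bar>) \<in> borel_measurable (borel \<Otimes>\<^sub>M borel)"
    by measurable
  then show "(\<lambda>(x, y). ennreal \<bar>p t x y - \<rho> y\<bar>) \<in> borel_measurable (borel \<Otimes>\<^sub>M lborel)"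
    by (simp add: case_prod_beta')
qed

text \<open>
  The test function is the sign of the difference of the densities. The \<open>L\<^sup>1\<close> distance is used in
  place of the total variation norm because it is visibly measurable in \<open>x\<close>.
\<close>

lemma L1_distance_le_tv_norm:
  assumes t: "t > 0"
  shows "(\<integral>\<^sup>+y. ennreal \<bar>p t x y - \<rho> y\<bar> \<partial>lborel) \<le> ennreal (tv_norm_diff (transition X P t x) \<mu>)"
proof -
  note [measurable] = p_measurable2[OF t]
  interpret T: prob_space "transition X P t x" using t by (intro prob_space_transition) simp
  have "emeasure (transition X P t x) UNIV = 1" using T.emeasure_space_1 by simp
  then have "(\<integral>\<^sup>+y. ennreal (p t x y) \<partial>lborel) = 1"
    by (simp add: transition_density[OF t] emeasure_density)
  then have ip: "integrable lborel (\<lambda>y. p t x y)"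
    using p_nonneg[OF t] by (intro integrableI_nonneg) auto
  have "emeasure \<mu> UNIV = 1" using \<mu>.emeasure_space_1 by simp
  then have "(\<integral>\<^sup>+y. ennreal (\<rho> y) \<partial>lborel) = 1"
    by (subst (asm) \<mu>_density) (simp add: emeasure_density)
  then have ir: "integrable lborel \<rho>"
    using \<rho>_nonneg by (intro integrableI_nonneg) auto
  define f where "f y = sgn (p t x y - \<rho> y)" for y
  have f[measurable]: "f \<in> borel_measurable borel" unfolding f_def by measurable
  have f1: "\<bar>f y\<bar> \<le> 1" for y by (simp add: f_def abs_sgn_eq)
  have "(\<integral>y. f y \<partial>transition X P t x) = (\<integral>y. p t x y * f y \<partial>lborel)"
    unfolding transition_density[OF t] using p_nonneg[OF t] by (subst integral_density) auto
  moreover have "(\<integral>y. f y \<partial>\<mu>) = (\<integral>y. \<rho> y * f y \<partial>lborel)"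
    using \<rho>_nonneg by (subst \<mu>_density, subst integral_density) auto
  moreover have "integrable lborel (\<lambda>y. p t x y * f y)"
    by (rule Bochner_Integration.integrable_bound[OF ip]) (use f1 in \<open>auto simp: abs_mult intro!: mult_left_le\<close>)
  moreover have "integrable lborel (\<lambda>y. \<rho> y * f y)"
    by (rule Bochner_Integration.integrable_bound[OF ir]) (use f1 in \<open>auto simp: abs_mult intro!: mult_left_le\<close>)
  ultimately have "(\<integral>y. f y \<partial>transition X P t x) - (\<integral>y. f y \<partial>\<mu>) = (\<integral>y. p t x y * f y - \<rho> y * f y \<partial>lborel)"
    by simp
  also have "\<dots> = (\<integral>y. \<bar>p t x y - \<rho> y\<bar> \<partial>lborel)"
    by (simp add: f_def abs_sgn left_diff_distrib)
  finally have "(\<integral>y. f y \<partial>transition X P t x) - (\<integral>y. f y \<partial>\<mu>) = (\<integral>y. \<bar>p t x y - \<rho> y\<bar> \<partial>lborel)" .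
  then have "(\<integral>y. \<bar>p t x y - \<rho> y\<bar> \<partial>lborel) \<le> \<bar>(\<integral>y. f y \<partial>transition X P t x) - (\<integral>y. f y \<partial>\<mu>)\<bar>"
    by linarith
  also have "\<dots> \<le> tv_norm_diff (transition X P t x) \<mu>"
    unfolding tv_norm_diff_def
  proof (rule cSUP_upper)
    show "f \<in> {f \<in> borel_measurable borel. \<forall>x. \<bar>f x\<bar> \<le> 1}" using f f1 by auto
    show "bdd_above ((\<lambda>f. \<bar>(\<integral>y. f y \<partial>transition X P t x) - (\<integral>y. f y \<partial>\<mu>)\<bar>) `
        {f \<in> borel_measurable borel. \<forall>x. \<bar>f x\<bar> \<le> (1::real)})"
    proof (rule bdd_aboveI2)
      fix g :: "'a \<Rightarrow> real" assume "g \<in> {f \<in> borel_measurable borel. \<forall>x. \<bar>f x\<bar> \<le> 1}"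
      then have [measurable]: "g \<in> borel_measurable borel" and g1: "\<bar>g x\<bar> \<le> 1" for x by auto
      have "\<bar>\<integral>y. g y \<partial>\<nu>\<bar> \<le> 1" if "prob_space \<nu>" "sets \<nu> = sets borel" for \<nu> :: "'a measure"
      proof -
        interpret N: prob_space \<nu> by fact
        note [measurable_cong] = that(2)
        have "norm (\<integral>y. g y \<partial>\<nu>) \<le> (\<integral>y. 1 \<partial>\<nu>)"
          using g1 by (intro Bochner_Integration.integral_norm_bound_integral N.integrable_const_bound[where B=1]) auto
        then show ?thesis by (simp add: N.prob_space)
      qed
      from this[OF T.prob_space_axioms] this[OF prob_space_\<mu>]
      show "\<bar>(\<integral>y. g y \<partial>transition X P t x) - (\<integral>y. g y \<partial>\<mu>)\<bar> \<le> 2" by simp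
    qed
  qed
  finally have "(\<integral>y. \<bar>p t x y - \<rho> y\<bar> \<partial>lborel) \<le> tv_norm_diff (transition X P t x) \<mu>" .
  then show ?thesis
    using ip ir by (subst nn_integral_eq_integral) (auto intro: ennreal_leI)
qed

lemma nn_integral_tv_distance_le:
  assumes "beta_mixing X P \<mu> \<Xi>" "t > 0"
  shows "(\<integral>\<^sup>+x. \<integral>\<^sup>+y. ennreal \<bar>p t x y - \<rho> y\<bar> \<partial>lborel \<partial>\<mu>) \<le> ennreal (\<Xi> t)"
proof -
  have "(\<integral>\<^sup>+x. \<integral>\<^sup>+y. ennreal \<bar>p t x y - \<rho> y\<bar> \<partial>lborel \<partial>\<mu>)
      \<le> (\<integral>\<^sup>+x. ennreal (tv_norm_diff (transition X P t x) \<mu>) \<partial>\<mu>)"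
    by (intro nn_integral_mono L1_distance_le_tv_norm assms)
  also have "\<dots> \<le> ennreal (\<Xi> t)"
    using assms by (simp add: beta_mixing_def)
  finally show ?thesis .
qed

lemma mixing_step:
  assumes mix: "beta_mixing X P \<mu> \<Xi>" and t: "t \<ge> 0" and a: "a > 0"
    and H[measurable]: "H \<in> borel_measurable (F t \<Otimes>\<^sub>M borel)" and H1: "\<And>z. H z \<le> 1"
  shows "(\<integral>\<^sup>+\<omega>. \<integral>\<^sup>+y. H (\<omega>, y) \<partial>transition X P a (X t \<omega>) \<partial>Q)
    \<le> (\<integral>\<^sup>+\<omega>. \<integral>\<^sup>+y. H (\<omega>, y) \<partial>\<mu> \<partial>Q) + ennreal (\<Xi> a)"
proof -
  let ?L = "\<lambda>x. \<integral>\<^sup>+y. ennreal \<bar>p a x y - \<rho> y\<bar> \<partial>lborel"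
  note L[measurable] = tv_distance_measurable[OF a]
  have Xt[measurable]: "X t \<in> M \<rightarrow>\<^sub>M borel" by (rule X_measurable[OF t])
  have id[measurable]: "(\<lambda>\<omega>. \<omega>) \<in> M \<rightarrow>\<^sub>M F t"
    using sets_F_subset by (auto simp: measurable_def)
  have "(\<integral>\<^sup>+\<omega>. \<integral>\<^sup>+y. H (\<omega>, y) \<partial>transition X P a (X t \<omega>) \<partial>Q)
      \<le> (\<integral>\<^sup>+\<omega>. (\<integral>\<^sup>+y. H (\<omega>, y) \<partial>\<mu>) + ?L (X t \<omega>) \<partial>Q)"
  proof (rule nn_integral_mono)
    fix \<omega> assume "\<omega> \<in> space Q"
    then have w: "\<omega> \<in> space (F t)" by simp
    have [measurable]: "(\<lambda>y. H (\<omega>, y)) \<in> borel_measurable borel"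
      using measurable_compose[OF measurable_Pair1'[OF w] H] .
    have [measurable]: "(\<lambda>y. p a (X t \<omega>) y) \<in> borel_measurable borel" by (rule p_measurable2[OF a])
    have "(\<integral>\<^sup>+y. H (\<omega>, y) \<partial>transition X P a (X t \<omega>)) = (\<integral>\<^sup>+y. ennreal (p a (X t \<omega>) y) * H (\<omega>, y) \<partial>lborel)"
      by (simp add: transition_density[OF a] nn_integral_density)
    also have "\<dots> \<le> (\<integral>\<^sup>+y. ennreal (\<rho> y) * H (\<omega>, y) + ennreal \<bar>p a (X t \<omega>) y - \<rho> y\<bar> \<partial>lborel)"
    proof (rule nn_integral_mono)
      fix y
      have "ennreal (p a (X t \<omega>) y) \<le> ennreal (\<rho> y + \<bar>p a (X t \<omega>) y - \<rho> y\<bar>)"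
        by (intro ennreal_leI) linarith
      also have "\<dots> = ennreal (\<rho> y) + ennreal \<bar>p a (X t \<omega>) y - \<rho> y\<bar>"
        using \<rho>_nonneg by (intro ennreal_plus) auto
      finally have "ennreal (p a (X t \<omega>) y) * H (\<omega>, y)
          \<le> (ennreal (\<rho> y) + ennreal \<bar>p a (X t \<omega>) y - \<rho> y\<bar>) * H (\<omega>, y)"
        by (rule mult_right_mono) simp
      also have "\<dots> = ennreal (\<rho> y) * H (\<omega>, y) + ennreal \<bar>p a (X t \<omega>) y - \<rho> y\<bar> * H (\<omega>, y)"
        by (rule distrib_right)
      also have "\<dots> \<le> ennreal (\<rho> y) * H (\<omega>, y) + ennreal \<bar>p a (X t \<omega>) y - \<rho> y\<bar> * 1"
        by (intro add_left_mono mult_left_mono H1) simp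
      finally show "ennreal (p a (X t \<omega>) y) * H (\<omega>, y) \<le> ennreal (\<rho> y) * H (\<omega>, y) + ennreal \<bar>p a (X t \<omega>) y - \<rho> y\<bar>"
        by simp
    qed
    also have "\<dots> = (\<integral>\<^sup>+y. H (\<omega>, y) \<partial>\<mu>) + ?L (X t \<omega>)"
      by (subst \<mu>_density) (simp add: nn_integral_add nn_integral_density)
    finally show "(\<integral>\<^sup>+y. H (\<omega>, y) \<partial>transition X P a (X t \<omega>)) \<le> (\<integral>\<^sup>+y. H (\<omega>, y) \<partial>\<mu>) + ?L (X t \<omega>)" .
  qed
  also have "\<dots> = (\<integral>\<^sup>+\<omega>. \<integral>\<^sup>+y. H (\<omega>, y) \<partial>\<mu> \<partial>Q) + (\<integral>\<^sup>+\<omega>. ?L (X t \<omega>) \<partial>Q)"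
  proof (rule nn_integral_add)
    have "(\<lambda>\<omega>. \<integral>\<^sup>+y. H (\<omega>, y) \<partial>\<mu>) \<in> borel_measurable (F t)"
      by (rule \<mu>.borel_measurable_nn_integral) simp
    then show "(\<lambda>\<omega>. \<integral>\<^sup>+y. H (\<omega>, y) \<partial>\<mu>) \<in> borel_measurable Q"
      using measurable_F_M measurable_cong_sets[OF sets_Q refl] by blast
    show "(\<lambda>\<omega>. ?L (X t \<omega>)) \<in> borel_measurable Q"
      using measurable_compose[OF Xt L] measurable_cong_sets[OF sets_Q refl] by blast
  qed
  also have "(\<integral>\<^sup>+\<omega>. ?L (X t \<omega>) \<partial>Q) = (\<integral>\<^sup>+x. ?L x \<partial>distr Q borel (X t))"
    by (intro nn_integral_distr[symmetric]) auto
  also have "\<dots> = (\<integral>\<^sup>+x. ?L x \<partial>\<mu>)" by (simp add: distr_X[OF t])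
  also have "\<dots> \<le> ennreal (\<Xi> a)" by (rule nn_integral_tv_distance_le[OF mix a])
  finally show ?thesis by (simp add: add_left_mono)
qed

text \<open>
  Induction on the number of blocks. The last block is separated from the past by a gap of length
  \<open>a\<close>, so \<open>block_decoupling\<close> removes it at the price of \<open>\<Xi> a\<close> and turns \<open>A i\<close> into
  \<open>A i * E i\<close>. The price does not depend on the index set \<open>I\<close>.
\<close>

lemma exp_moments_of_separated_blocks:
  fixes f :: "'i \<Rightarrow> 'a \<Rightarrow> real"
  assumes mix: "beta_mixing X P \<mu> \<Xi>" and \<Xi>: "\<Xi> a \<ge> 0" and I: "finite I" and r: "r \<ge> 0" and a: "a > 0"
    and f: "\<And>i. i \<in> I \<Longrightarrow> continuous_on UNIV (f i)" "\<And>i x. i \<in> I \<Longrightarrow> \<bar>f i x\<bar> \<le> B i"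
    and E: "\<And>i j. i \<in> I \<Longrightarrow> Q.expectation (\<lambda>\<omega>. exp (block (f i) (r + 2 * real j * a) a \<omega>)) \<le> E i"
    and A: "\<And>i. i \<in> I \<Longrightarrow> 0 \<le> A i"
  shows "Q.expectation (\<lambda>\<omega>. min 1 (\<Sum>i\<in>I. A i * exp (\<Sum>j<n. block (f i) (r + 2 * real j * a) a \<omega>)))
    \<le> (\<Sum>i\<in>I. A i * E i ^ n) + real n * \<Xi> a"
  using A
proof (induction n arbitrary: A)
  case 0
  have "0 \<le> sum A I" using 0 by (intro sum_nonneg)
  then show ?case by simp
next
  case (Suc n)
  let ?b = "\<lambda>i j. block (f i) (r + 2 * real j * a) a"
  have bm[measurable]: "?b i j \<in> borel_measurable M" if "i \<in> I" for i j
    using r a that by (intro block_measurable[where B="B i"] f) auto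
  have E0: "0 \<le> E i" if "i \<in> I" for i
    using order_trans[OF _ E[OF that, of 0]] by (auto intro!: integral_nonneg_AE)
  have bint: "integrable Q (\<lambda>\<omega>. exp (?b i j \<omega>))" if "i \<in> I" for i j
  proof (rule Q.integrable_const_bound[where B="exp (a * B i)"])
    have "\<bar>?b i j \<omega>\<bar> \<le> a * B i" if "\<omega> \<in> space M" for \<omega>
      using r a that \<open>i \<in> I\<close> by (intro block_bound f) auto
    then show "AE \<omega> in Q. norm (exp (?b i j \<omega>)) \<le> exp (a * B i)"
      by (intro AE_I2) (auto dest!: abs_le_D1)
  qed (use bm[OF that] in simp)
  have "Q.expectation (\<lambda>\<omega>. min 1 (\<Sum>i\<in>I. A i * exp (\<Sum>j<Suc n. ?b i j \<omega>)))
      \<le> Q.expectation (\<lambda>\<omega>. min 1 (\<Sum>i\<in>I. A i * E i * exp (\<Sum>j<n. ?b i j \<omega>))) + \<Xi> a"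
  proof (cases "n = 0")
    case True
    have "Q.expectation (\<lambda>\<omega>. min 1 (\<Sum>i\<in>I. A i * exp (?b i 0 \<omega>))) \<le> min 1 (\<Sum>i\<in>I. A i * E i)"
    proof (rule min.boundedI)
      have i: "integrable Q (\<lambda>\<omega>. \<Sum>i\<in>I. A i * exp (?b i 0 \<omega>))"
        by (intro Bochner_Integration.integrable_sum integrable_mult_right bint)
      then have m: "integrable Q (\<lambda>\<omega>. min 1 (\<Sum>i\<in>I. A i * exp (?b i 0 \<omega>)))"
        by (intro integrable_min) auto
      have "Q.expectation (\<lambda>\<omega>. min 1 (\<Sum>i\<in>I. A i * exp (?b i 0 \<omega>))) \<le> Q.expectation (\<lambda>\<omega>. 1)"
        using m by (intro integral_mono) auto
      then show "Q.expectation (\<lambda>\<omega>. min 1 (\<Sum>i\<in>I. A i * exp (?b i 0 \<omega>))) \<le> 1"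
        by simp
      have "Q.expectation (\<lambda>\<omega>. min 1 (\<Sum>i\<in>I. A i * exp (?b i 0 \<omega>)))
          \<le> Q.expectation (\<lambda>\<omega>. \<Sum>i\<in>I. A i * exp (?b i 0 \<omega>))"
        using m i by (intro integral_mono) auto
      also have "\<dots> = (\<Sum>i\<in>I. A i * Q.expectation (\<lambda>\<omega>. exp (?b i 0 \<omega>)))"
        using bint by (subst Bochner_Integration.integral_sum) (auto simp del: of_nat_0)
      also have "\<dots> \<le> (\<Sum>i\<in>I. A i * E i)"
        using E Suc.prems by (intro sum_mono mult_left_mono) blast+
      finally show "Q.expectation (\<lambda>\<omega>. min 1 (\<Sum>i\<in>I. A i * exp (?b i 0 \<omega>))) \<le> (\<Sum>i\<in>I. A i * E i)" .
    qed
    then have "Q.expectation (\<lambda>\<omega>. min 1 (\<Sum>i\<in>I. A i * exp (?b i 0 \<omega>))) \<le> min 1 (\<Sum>i\<in>I. A i * E i) + \<Xi> a"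
      using \<Xi> by linarith
    then show ?thesis using True by simp
  next
    case False
    define t where "t = r + 2 * real (n - 1) * a + a"
    have t: "t \<ge> 0" using r a by (simp add: t_def)
    have ta: "t + a = r + 2 * real n * a" using False by (simp add: t_def algebra_simps of_nat_diff)
    define W where "W i \<omega> = A i * exp (\<Sum>j<n. ?b i j \<omega>)" for i \<omega>
    have W: "W i \<in> borel_measurable (F t)" if "i \<in> I" for i
    proof -
      have [measurable]: "?b i j \<in> borel_measurable (F t)" if "j \<in> {..<n}" for j
      proof (rule block_measurable_F[where B="B i"])
        have "real j * a \<le> real (n - 1) * a" using that a by (intro mult_right_mono) auto
        then show "r + 2 * real j * a + a \<le> t" by (simp add: t_def)
      qed (use r a f \<open>i \<in> I\<close> in auto)
      show ?thesis unfolding W_def by measurable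
    qed
    have "Q.expectation (\<lambda>\<omega>. min 1 (\<Sum>i\<in>I. A i * exp (\<Sum>j<Suc n. ?b i j \<omega>)))
        = Q.expectation (\<lambda>\<omega>. min 1 (\<Sum>i\<in>I. W i \<omega> * exp (block (f i) (t + a) a \<omega>)))"
      unfolding ta by (simp add: W_def exp_add mult.assoc)
    also have "\<dots> \<le> Q.expectation (\<lambda>\<omega>. min 1 (\<Sum>i\<in>I. W i \<omega> * Q.expectation (\<lambda>\<omega>'. exp (block (f i) (t + a) a \<omega>')))) + \<Xi> a"
    proof (rule block_decoupling[OF I t a \<Xi> W _ f])
      show "0 \<le> W i \<omega>" if "i \<in> I" for i \<omega> using Suc.prems[OF that] by (simp add: W_def)
    qed (use mixing_step[OF mix t a] in auto)
    also have "Q.expectation (\<lambda>\<omega>. min 1 (\<Sum>i\<in>I. W i \<omega> * Q.expectation (\<lambda>\<omega>'. exp (block (f i) (t + a) a \<omega>'))))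
        \<le> Q.expectation (\<lambda>\<omega>. min 1 (\<Sum>i\<in>I. A i * E i * exp (\<Sum>j<n. ?b i j \<omega>)))"
    proof (rule integral_mono)
      have Wm[measurable]: "W i \<in> borel_measurable M" if "i \<in> I" for i
        using W[OF that] by (rule measurable_F_M)
      have W0: "0 \<le> W i \<omega>" if "i \<in> I" for i \<omega> using Suc.prems[OF that] by (simp add: W_def)
      show "integrable Q (\<lambda>\<omega>. min 1 (\<Sum>i\<in>I. W i \<omega> * Q.expectation (\<lambda>\<omega>'. exp (block (f i) (t + a) a \<omega>'))))"
      proof (intro Q.integrable_const_bound[where B=1] AE_I2)
        fix \<omega>
        have "0 \<le> (\<Sum>i\<in>I. W i \<omega> * Q.expectation (\<lambda>\<omega>'. exp (block (f i) (t + a) a \<omega>')))"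
          using W0 by (intro sum_nonneg mult_nonneg_nonneg integral_nonneg_AE) auto
        then show "norm (min 1 (\<Sum>i\<in>I. W i \<omega> * Q.expectation (\<lambda>\<omega>'. exp (block (f i) (t + a) a \<omega>')))) \<le> 1"
          by simp
      qed measurable
      show "integrable Q (\<lambda>\<omega>. min 1 (\<Sum>i\<in>I. A i * E i * exp (\<Sum>j<n. ?b i j \<omega>)))"
      proof (intro Q.integrable_const_bound[where B=1] AE_I2)
        fix \<omega>
        have "0 \<le> (\<Sum>i\<in>I. A i * E i * exp (\<Sum>j<n. ?b i j \<omega>))"
          using Suc.prems E0 by (intro sum_nonneg mult_nonneg_nonneg) auto
        then show "norm (min 1 (\<Sum>i\<in>I. A i * E i * exp (\<Sum>j<n. ?b i j \<omega>))) \<le> 1" by simp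
      qed measurable
      fix \<omega> assume "\<omega> \<in> space Q"
      have "(\<Sum>i\<in>I. W i \<omega> * Q.expectation (\<lambda>\<omega>'. exp (block (f i) (t + a) a \<omega>'))) \<le> (\<Sum>i\<in>I. W i \<omega> * E i)"
        unfolding ta using W0 E by (intro sum_mono mult_left_mono) auto
      also have "\<dots> = (\<Sum>i\<in>I. A i * E i * exp (\<Sum>j<n. ?b i j \<omega>))"
        by (simp add: W_def mult_ac)
      finally show "min 1 (\<Sum>i\<in>I. W i \<omega> * Q.expectation (\<lambda>\<omega>'. exp (block (f i) (t + a) a \<omega>')))
          \<le> min 1 (\<Sum>i\<in>I. A i * E i * exp (\<Sum>j<n. ?b i j \<omega>))" by (simp add: min.coboundedI2)
    qed
    finally show ?thesis by simp
  qed
  also have "Q.expectation (\<lambda>\<omega>. min 1 (\<Sum>i\<in>I. A i * E i * exp (\<Sum>j<n. ?b i j \<omega>)))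
      \<le> (\<Sum>i\<in>I. A i * E i * E i ^ n) + real n * \<Xi> a"
    using Suc.prems E0 by (intro Suc.IH) simp
  finally show ?case by (simp add: algebra_simps)
qed

end

section \<open>Second moments and a uniform Bernstein inequality\<close>

context stationary_process
begin

lemma block_scale: "block (\<lambda>x. c * f x) r a \<omega> = c * block f r a \<omega>"
  unfolding block_def by simp

lemma block_add:
  fixes f :: "'a \<Rightarrow> real"
  assumes "\<omega> \<in> space M" "r \<ge> 0" "a \<ge> 0" "b \<ge> 0" "continuous_on UNIV f" "\<And>x. \<bar>f x\<bar> \<le> B"
  shows "block f r (a + b) \<omega> = block f r a \<omega> + block f (r + a) b \<omega>"
proof -
  have U: "{r..r + (a + b)} = {r..r + a} \<union> {r + a..r + a + b}" using assms(3,4) by auto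
  have "(LINT s:{r..r + a} \<union> {r + a..r + a + b}|lborel. f (X s \<omega>))
      = (LINT s:{r..r + a}|lborel. f (X s \<omega>)) + (LINT s:{r + a..r + a + b}|lborel. f (X s \<omega>))"
  proof (rule set_integral_Un_AE)
    show "AE s in lborel. \<not> (s \<in> {r..r + a} \<and> s \<in> {r + a..r + a + b})"
      using AE_lborel_singleton[of "r + a"] by eventually_elim auto
    show "set_integrable lborel {r..r + a} (\<lambda>s. f (X s \<omega>))"
      by (rule block_set_integrable[OF assms(1,2,5,6)])
    show "set_integrable lborel {r + a..r + a + b} (\<lambda>s. f (X s \<omega>))"
      using assms(2,3) by (intro block_set_integrable[OF assms(1) _ assms(5,6)]) simp
  qed auto
  then show ?thesis unfolding block_def U .
qed

lemma block_split_even_odd: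
  fixes f :: "'a \<Rightarrow> real"
  assumes "\<omega> \<in> space M" "a \<ge> 0" "continuous_on UNIV f" "\<And>x. \<bar>f x\<bar> \<le> B"
  shows "block f 0 (2 * real n * a) \<omega> =
    (\<Sum>j<n. block f (0 + 2 * real j * a) a \<omega>) + (\<Sum>j<n. block f (a + 2 * real j * a) a \<omega>)"
proof (induction n)
  case 0
  have "block f 0 0 \<omega> = 0"
    using block_add[OF assms(1) order_refl order_refl order_refl assms(3,4)] by simp
  then show ?case by simp
next
  case (Suc n)
  let ?t = "2 * real n * a"
  have t: "?t \<ge> 0" using assms(2) by simp
  have "block f 0 (?t + (a + a)) \<omega> = block f 0 ?t \<omega> + block f ?t (a + a) \<omega>"
    using block_add[OF assms(1) order_refl t _ assms(3,4), of "a + a"] assms(2) by simp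
  also have "block f ?t (a + a) \<omega> = block f ?t a \<omega> + block f (?t + a) a \<omega>"
    using block_add[OF assms(1) t assms(2) assms(2) assms(3,4)] .
  also have "?t + (a + a) = 2 * real (Suc n) * a" by (simp add: algebra_simps)
  finally show ?case using Suc by (simp add: add.commute)
qed

lemma expectation_block_mult:
  fixes f :: "'a \<Rightarrow> real"
  assumes r: "r \<ge> 0" and a: "a \<ge> 0" and f: "continuous_on UNIV f" "\<And>x. \<bar>f x\<bar> \<le> B"
    and Z[measurable]: "Z \<in> borel_measurable M" and Zb: "\<And>\<omega>. \<omega> \<in> space M \<Longrightarrow> \<bar>Z \<omega>\<bar> \<le> C"
  shows "Q.expectation (\<lambda>\<omega>. block f r a \<omega> * Z \<omega>) =
      (LINT s:{r..r + a}|lborel. Q.expectation (\<lambda>\<omega>. f (X s \<omega>) * Z \<omega>))" (is ?eq)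
    and "set_integrable lborel {r..r + a} (\<lambda>s. Q.expectation (\<lambda>\<omega>. f (X s \<omega>) * Z \<omega>))" (is ?int)
proof -
  interpret pair_sigma_finite lborel Q by unfold_locales
  have [measurable]: "f \<in> borel_measurable borel" by (rule borel_measurable_continuous_onI[OF f(1)])
  let ?g = "\<lambda>s \<omega>. indicator {r..r + a} s * (f (X (max 0 s) \<omega>) * Z \<omega>)"
  have B0: "0 \<le> B" using f(2)[of undefined] by linarith
  have int: "integrable (lborel \<Otimes>\<^sub>M Q) (case_prod ?g)"
  proof (rule integrableI_bounded_set[where A="{r..r + a} \<times> space M" and B="B * C"])
    have "{r..r + a} \<times> space M \<in> sets (lborel \<Otimes>\<^sub>M M)" by simp
    then show "{r..r + a} \<times> space M \<in> sets (lborel \<Otimes>\<^sub>M Q)" by (simp cong: sets_pair_measure_cong)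
    show "case_prod ?g \<in> borel_measurable (lborel \<Otimes>\<^sub>M Q)" by measurable
    have "emeasure (lborel \<Otimes>\<^sub>M Q) ({r..r + a} \<times> space M) = emeasure lborel {r..r + a} * emeasure Q (space M)"
      by (rule Q.emeasure_pair_measure_Times) auto
    also have "\<dots> < \<infinity>" using a Q.emeasure_space_1 by (simp add: ennreal_mult_less_top)
    finally show "emeasure (lborel \<Otimes>\<^sub>M Q) ({r..r + a} \<times> space M) < \<infinity>" .
    show "AE x\<in>{r..r + a} \<times> space M in lborel \<Otimes>\<^sub>M Q. norm (case_prod ?g x) \<le> B * C"
    proof (intro AE_I2 impI)
      fix x assume "x \<in> {r..r + a} \<times> space M"
      then obtain s \<omega> where x: "x = (s, \<omega>)" "\<omega> \<in> space M" by auto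
      have "\<bar>f (X (max 0 s) \<omega>)\<bar> * \<bar>Z \<omega>\<bar> \<le> B * C"
        using f(2) Zb[OF x(2)] B0 by (intro mult_mono) auto
      moreover have "0 \<le> B * C" using calculation by (meson abs_ge_zero mult_nonneg_nonneg order_trans)
      ultimately show "norm (case_prod ?g x) \<le> B * C"
        by (simp add: x abs_mult indicator_def)
    qed
    show "AE x in lborel \<Otimes>\<^sub>M Q. x \<notin> {r..r + a} \<times> space M \<longrightarrow> case_prod ?g x = 0"
      by (intro AE_I2) (auto simp: space_pair_measure indicator_def)
  qed
  have eq: "indicator {r..r + a} s *\<^sub>R Q.expectation (\<lambda>\<omega>. f (X s \<omega>) * Z \<omega>) = Q.expectation (\<lambda>\<omega>. ?g s \<omega>)" for s
    using r by (auto simp: indicator_def)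
  have "(\<integral>\<omega>. (\<integral>s. ?g s \<omega> \<partial>lborel) \<partial>Q) = (\<integral>s. (\<integral>\<omega>. ?g s \<omega> \<partial>Q) \<partial>lborel)"
    by (rule Fubini_integral[OF int])
  also have "\<dots> = (LINT s:{r..r + a}|lborel. Q.expectation (\<lambda>\<omega>. f (X s \<omega>) * Z \<omega>))"
    unfolding set_lebesgue_integral_def eq ..
  also have "(\<integral>\<omega>. (\<integral>s. ?g s \<omega> \<partial>lborel) \<partial>Q) = Q.expectation (\<lambda>\<omega>. block f r a \<omega> * Z \<omega>)"
    unfolding block_clamped[OF r] set_lebesgue_integral_def
    by (intro Bochner_Integration.integral_cong refl) (simp flip: mult.assoc)
  finally show ?eq .
  show ?int
    unfolding set_integrable_def eq
    using integrable_fst'[OF int] by simp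
qed

lemma expectation_block:
  fixes f :: "'a \<Rightarrow> real"
  assumes r: "r \<ge> 0" and a: "a \<ge> 0" and f: "continuous_on UNIV f" "\<And>x. \<bar>f x\<bar> \<le> B"
  shows "Q.expectation (block f r a) = a * \<mu>.expectation f"
proof -
  have [measurable]: "f \<in> borel_measurable borel" by (rule borel_measurable_continuous_onI[OF f(1)])
  have "Q.expectation (\<lambda>\<omega>. block f r a \<omega> * 1) = (LINT s:{r..r + a}|lborel. Q.expectation (\<lambda>\<omega>. f (X s \<omega>) * 1))"
    by (rule expectation_block_mult(1)[where C=1 and B=B]) (use assms in auto)
  also have "\<dots> = (LINT s:{r..r + a}|lborel. \<mu>.expectation f)"
  proof (intro set_lebesgue_integral_cong allI impI)
    fix s assume "s \<in> {r..r + a}"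
    then have s: "s \<ge> 0" using r by simp
    have "Q.expectation (\<lambda>\<omega>. f (X s \<omega>)) = integral\<^sup>L (distr Q borel (X s)) f"
      using X_measurable[OF s] by (intro integral_distr[symmetric]) (auto simp: measurable_cong_sets[OF sets_Q refl])
    then show "Q.expectation (\<lambda>\<omega>. f (X s \<omega>) * 1) = \<mu>.expectation f" by (simp add: distr_X[OF s])
  qed simp
  also have "\<dots> = a * \<mu>.expectation f" using a by (simp add: set_lebesgue_integral_def)
  finally show ?thesis by simp
qed

text \<open>
  The second moment is the double integral of the covariances over the block. For a fixed time the
  inner integral is at most twice the integral of \<open>\<gamma>\<close>, once for each sign of the lag.
\<close>

lemma block_second_moment:
  fixes f :: "'a \<Rightarrow> real" and \<gamma> :: "real \<Rightarrow> ennreal"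
  assumes r: "r \<ge> 0" and a: "a > 0" and f: "continuous_on UNIV f" "\<And>x. \<bar>f x\<bar> \<le> B"
    and \<gamma>[measurable]: "\<gamma> \<in> borel_measurable borel"
    and cov: "\<And>t s. t \<ge> 0 \<Longrightarrow> s > 0 \<Longrightarrow> ennreal \<bar>Q.expectation (\<lambda>\<omega>. f (X t \<omega>) * f (X (t + s) \<omega>))\<bar> \<le> \<gamma> s"
    and G: "(\<integral>\<^sup>+s. indicator {0<..} s * \<gamma> s \<partial>lborel) \<le> ennreal G" "G \<ge> 0"
  shows "Q.expectation (\<lambda>\<omega>. (block f r a \<omega>)\<^sup>2) \<le> 2 * a * G"
proof -
  have fm[measurable]: "f \<in> borel_measurable borel" by (rule borel_measurable_continuous_onI[OF f(1)])
  have bm[measurable]: "block f r a \<in> borel_measurable M" by (rule block_measurable[OF r a f])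
  have bb: "\<bar>block f r a \<omega>\<bar> \<le> a * B" if "\<omega> \<in> space M" for \<omega>
    by (rule block_bound[OF that r less_imp_le[OF a] f])
  have sq: "Q.expectation (\<lambda>\<omega>. (block f r a \<omega>)\<^sup>2)
      = (LINT s:{r..r + a}|lborel. Q.expectation (\<lambda>\<omega>. f (X s \<omega>) * block f r a \<omega>))"
    unfolding power2_eq_square by (rule expectation_block_mult(1)[OF r less_imp_le[OF a] f bm bb])
  have inner: "Q.expectation (\<lambda>\<omega>. f (X s \<omega>) * block f r a \<omega>) \<le> 2 * G" if s: "s \<in> {r..r + a}" for s
  proof -
    have s0: "s \<ge> 0" using s r by simp
    note [measurable] = X_measurable[OF s0]
    let ?c = "\<lambda>u. Q.expectation (\<lambda>\<omega>. f (X u \<omega>) * f (X s \<omega>))"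
    have fX: "(\<lambda>\<omega>. f (X s \<omega>)) \<in> borel_measurable M" by measurable
    have int: "set_integrable lborel {r..r + a} ?c"
      by (rule expectation_block_mult(2)[OF r less_imp_le[OF a] f fX]) (rule f(2))
    have "Q.expectation (\<lambda>\<omega>. f (X s \<omega>) * block f r a \<omega>) = (LINT u:{r..r + a}|lborel. ?c u)"
      using expectation_block_mult(1)[OF r less_imp_le[OF a] f fX f(2)] by (simp add: mult.commute)
    also have "\<dots> \<le> (\<integral>u. \<bar>indicator {r..r + a} u * ?c u\<bar> \<partial>lborel)"
      unfolding set_lebesgue_integral_def real_scaleR_def
      by (rule order_trans[OF abs_ge_self integral_abs_bound])
    finally have 1: "Q.expectation (\<lambda>\<omega>. f (X s \<omega>) * block f r a \<omega>)
        \<le> (\<integral>u. \<bar>indicator {r..r + a} u * ?c u\<bar> \<partial>lborel)" .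
    have "ennreal (\<integral>u. \<bar>indicator {r..r + a} u * ?c u\<bar> \<partial>lborel)
        = (\<integral>\<^sup>+u. ennreal \<bar>indicator {r..r + a} u * ?c u\<bar> \<partial>lborel)"
      using int by (intro nn_integral_eq_integral[symmetric] integrable_abs) (auto simp: set_integrable_def)
    also have "\<dots> \<le> (\<integral>\<^sup>+u. indicator {0<..} (u - s) * \<gamma> (u - s) + indicator {0<..} (s - u) * \<gamma> (s - u) \<partial>lborel)"
    proof (intro nn_integral_mono_AE)
      show "AE u in lborel. ennreal \<bar>indicator {r..r + a} u * ?c u\<bar>
          \<le> indicator {0<..} (u - s) * \<gamma> (u - s) + indicator {0<..} (s - u) * \<gamma> (s - u)"
        using AE_lborel_singleton[of s]
      proof eventually_elim
        case (elim u)
        consider "u \<notin> {r..r + a}" | "u \<in> {r..r + a}" "s < u" | "u \<in> {r..r + a}" "u < s"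
          using elim by fastforce
        then show ?case
        proof cases
          case 2
          have "ennreal \<bar>?c u\<bar> \<le> \<gamma> (u - s)"
            using cov[OF s0, of "u - s"] 2 by (simp add: mult.commute)
          then show ?thesis using 2 by simp
        next
          case 3
          have "ennreal \<bar>?c u\<bar> \<le> \<gamma> (s - u)"
            using cov[of u "s - u"] 3 r by simp
          then show ?thesis using 3 by simp
        qed simp
      qed
    qed
    also have "\<dots> = (\<integral>\<^sup>+u. indicator {0<..} (u - s) * \<gamma> (u - s) \<partial>lborel)
        + (\<integral>\<^sup>+u. indicator {0<..} (s - u) * \<gamma> (s - u) \<partial>lborel)"
      by (rule nn_integral_add) auto
    also have "(\<integral>\<^sup>+u. indicator {0<..} (u - s) * \<gamma> (u - s) \<partial>lborel) = (\<integral>\<^sup>+u. indicator {0<..} u * \<gamma> u \<partial>lborel)"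
      using nn_integral_real_affine[of "\<lambda>u. indicator {0<..} u * \<gamma> u" 1 "- s"] by simp
    also have "(\<integral>\<^sup>+u. indicator {0<..} (s - u) * \<gamma> (s - u) \<partial>lborel) = (\<integral>\<^sup>+u. indicator {0<..} u * \<gamma> u \<partial>lborel)"
      using nn_integral_real_affine[of "\<lambda>u. indicator {0<..} u * \<gamma> u" "-1" s] by simp
    also have "(\<integral>\<^sup>+u. indicator {0<..} u * \<gamma> u \<partial>lborel) + (\<integral>\<^sup>+u. indicator {0<..} u * \<gamma> u \<partial>lborel)
        \<le> ennreal G + ennreal G"
      by (intro add_mono G)
    also have "\<dots> = ennreal (2 * G)" using G(2) by (simp flip: ennreal_plus)
    finally have "(\<integral>u. \<bar>indicator {r..r + a} u * ?c u\<bar> \<partial>lborel) \<le> 2 * G"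
      using G(2) by (subst (asm) ennreal_le_iff) auto
    with 1 show ?thesis by linarith
  qed
  have "(LINT s:{r..r + a}|lborel. Q.expectation (\<lambda>\<omega>. f (X s \<omega>) * block f r a \<omega>))
      \<le> (LINT s:{r..r + a}|lborel. 2 * G)"
  proof (rule set_integral_mono)
    show "set_integrable lborel {r..r + a} (\<lambda>s. Q.expectation (\<lambda>\<omega>. f (X s \<omega>) * block f r a \<omega>))"
      by (rule expectation_block_mult(2)[OF r less_imp_le[OF a] f bm bb])
    show "set_integrable lborel {r..r + a} (\<lambda>s. 2 * G)"
      unfolding set_integrable_def using a
      by (intro integrable_scaleR_left integrable_real_indicator) auto
  qed (rule inner)
  also have "\<dots> = 2 * a * G" using a by (simp add: set_lebesgue_integral_def)
  finally show ?thesis using sq by simp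
qed

end

text \<open>
  The parameter is the minimum of \<open>1 / b\<close> and the unconstrained optimum \<open>sqrt (s / V)\<close>.
\<close>

lemma bernstein_parameter:
  fixes b V s :: real
  assumes "b > 0" "V > 0" "s > 0"
  obtains l where "l > 0" "l * b \<le> 1" "s + l\<^sup>2 * V \<le> l * (s * b + 2 * sqrt (s * V))"
proof (cases "1 / b \<le> sqrt (s / V)")
  case True
  have "V / b \<le> sqrt (s * V)"
  proof -
    have "V * (1 / b) \<le> V * sqrt (s / V)" using True assms by (intro mult_left_mono) auto
    also have "V * sqrt (s / V) = (V / sqrt V) * sqrt s" by (simp add: real_sqrt_divide)
    also have "\<dots> = sqrt (s * V)" using assms by (simp add: real_div_sqrt real_sqrt_mult)
    finally show ?thesis by simp
  qed
  then have "(1 / b) * (V / b) \<le> (1 / b) * (2 * sqrt (s * V))"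
    using assms by (intro mult_left_mono) (auto intro: order_trans)
  moreover have "(1 / b)\<^sup>2 * V = (1 / b) * (V / b)" by (simp add: power2_eq_square)
  moreover have "(1 / b) * (s * b + 2 * sqrt (s * V)) = s + (1 / b) * (2 * sqrt (s * V))"
    using assms by (simp add: distrib_left)
  ultimately have "s + (1 / b)\<^sup>2 * V \<le> (1 / b) * (s * b + 2 * sqrt (s * V))" by linarith
  then show ?thesis using assms by (intro that[of "1 / b"]) auto
next
  case False
  let ?l = "sqrt (s / V)"
  have "?l * b \<le> (1 / b) * b" using False assms by (intro mult_right_mono) auto
  moreover have "?l\<^sup>2 * V = s" using assms by simp
  moreover have "?l * sqrt (s * V) = s"
    using assms by (simp flip: real_sqrt_mult add: power2_eq_square[symmetric])
  moreover have "0 \<le> ?l * (s * b)" using assms by simp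
  ultimately show ?thesis using assms
    by (intro that[of ?l]) (auto simp: distrib_left mult.left_commute[of _ 2])
qed

context stationary_density_process
begin

text \<open>
  The event is contained in the event that the functional of \<open>exp_moments_of_separated_blocks\<close>
  equals 1. There the index set is doubled by a sign \<open>\<sigma>\<close> to treat both tails, the functions are
  \<open>\<sigma> * l i * g i\<close>, and \<open>A\<close> is chosen such that every index contributes \<open>exp (- s i)\<close>.
\<close>

lemma uniform_bernstein_separated:
  fixes g :: "'i \<Rightarrow> 'a \<Rightarrow> real"
  assumes mix: "beta_mixing X P \<mu> \<Xi>" and \<Xi>: "\<Xi> a \<ge> 0" and I: "finite I" and r: "r \<ge> 0" and a: "a > 0"
    and n: "n > 0" and B: "B > 0" and v: "v > 0"
    and g: "\<And>i. i \<in> I \<Longrightarrow> continuous_on UNIV (g i)" "\<And>i x. i \<in> I \<Longrightarrow> \<bar>g i x\<bar> \<le> B"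
    and centred: "\<And>i. i \<in> I \<Longrightarrow> \<mu>.expectation (g i) = 0"
    and var: "\<And>i r. i \<in> I \<Longrightarrow> r \<ge> 0 \<Longrightarrow> Q.expectation (\<lambda>\<omega>. (block (g i) r a \<omega>)\<^sup>2) \<le> v"
    and s: "\<And>i. i \<in> I \<Longrightarrow> s i > 0"
  defines "bad \<equiv> {\<omega> \<in> space M. \<exists>i\<in>I. s i * (a * B) + 2 * sqrt (s i * (real n * v)) \<le> \<bar>\<Sum>j<n. block (g i) (r + 2 * real j * a) a \<omega>\<bar>}"
  shows "bad \<in> sets M" and "measure Q bad \<le> 2 * (\<Sum>i\<in>I. exp (- s i)) + real n * \<Xi> a"
proof -
  let ?b = "\<lambda>i j. block (g i) (r + 2 * real j * a) a"
  define thr where "thr i = s i * (a * B) + 2 * sqrt (s i * (real n * v))" for i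
  have bm[measurable]: "?b i j \<in> borel_measurable M" if "i \<in> I" for i j
    using r a that by (intro block_measurable[where B=B] g) auto
  have bad: "bad = (\<Union>i\<in>I. {\<omega> \<in> space M. thr i \<le> \<bar>\<Sum>j<n. ?b i j \<omega>\<bar>})"
    by (auto simp: bad_def thr_def)
  show bad_sets: "bad \<in> sets M"
    unfolding bad using I by (intro sets.finite_UN) measurable
  have "\<exists>l>0. l * (a * B) \<le> 1 \<and> s i + l\<^sup>2 * (real n * v) \<le> l * thr i" if "i \<in> I" for i
    using bernstein_parameter[of "a * B" "real n * v" "s i"] a B n v s[OF that] unfolding thr_def
    by (metis mult_pos_pos of_nat_0_less_iff)
  then obtain l where l: "\<And>i. i \<in> I \<Longrightarrow> l i > 0" "\<And>i. i \<in> I \<Longrightarrow> l i * (a * B) \<le> 1"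
      "\<And>i. i \<in> I \<Longrightarrow> s i + (l i)\<^sup>2 * (real n * v) \<le> l i * thr i"
    by metis
  \<comment> \<open>the second component selects the upper or the lower tail\<close>
  define J where "J = I \<times> {1, -1::real}"
  define f where "f = (\<lambda>(i, \<sigma>) x. (\<sigma> * l i) * g i x)"
  define A where "A = (\<lambda>(i, \<sigma>::real). exp (- (s i + (l i)\<^sup>2 * (real n * v))))"
  define E where "E = (\<lambda>(i, \<sigma>::real). exp ((l i)\<^sup>2 * v))"
  let ?Z = "\<lambda>\<omega>. \<Sum>k\<in>J. A k * exp (\<Sum>j<n. block (f k) (r + 2 * real j * a) a \<omega>)"
  have J: "finite J" using I by (simp add: J_def)
  have E_bound: "Q.expectation (\<lambda>\<omega>. exp (block (f k) (r + 2 * real j * a) a \<omega>)) \<le> E k" if kJ: "k \<in> J" for k j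
  proof -
    obtain i \<sigma> where k: "k = (i, \<sigma>)" "i \<in> I" "\<sigma> = 1 \<or> \<sigma> = -1" using kJ by (auto simp: J_def)
    have pos: "0 \<le> r + 2 * real j * a" using r a by simp
    have "Q.expectation (\<lambda>\<omega>. exp ((\<sigma> * l i) * ?b i j \<omega>)) \<le> exp ((\<sigma> * l i)\<^sup>2 * v)"
    proof (rule Q.mgf_le_exp_variance[where b="a * B"])
      show "\<bar>?b i j \<omega>\<bar> \<le> a * B" if "\<omega> \<in> space Q" for \<omega>
        using that a by (intro block_bound pos g k) auto
      show "Q.expectation (?b i j) = 0"
        using expectation_block[OF pos less_imp_le[OF a] g(1)[OF k(2)] g(2)[OF k(2)]] centred[OF k(2)] by simp
      show "Q.expectation (\<lambda>\<omega>. (?b i j \<omega>)\<^sup>2) \<le> v" by (rule var[OF k(2) pos])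
      show "\<bar>\<sigma> * l i\<bar> * (a * B) \<le> 1" using l(1,2)[OF k(2)] k(3) by auto
    qed (use bm[OF k(2)] in auto)
    moreover have "(\<sigma> * l i)\<^sup>2 = (l i)\<^sup>2" using k(3) by auto
    ultimately show ?thesis by (simp add: k(1) f_def E_def block_scale)
  qed
  have moments: "Q.expectation (\<lambda>\<omega>. min 1 (?Z \<omega>)) \<le> (\<Sum>k\<in>J. A k * E k ^ n) + real n * \<Xi> a"
  proof (rule exp_moments_of_separated_blocks[OF mix \<Xi> J r a _ _ E_bound])
    fix k assume "k \<in> J"
    then obtain i \<sigma> where k: "k = (i, \<sigma>)" "i \<in> I" "\<sigma> = 1 \<or> \<sigma> = -1" by (auto simp: J_def)
    show "continuous_on UNIV (f k)"
      unfolding k f_def using g(1)[OF k(2)] by (auto intro!: continuous_intros)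
    show "\<bar>f k x\<bar> \<le> l (fst k) * B" for x
      using k(3) g(2)[OF k(2), of x] l(1)[OF k(2)] by (auto simp: k(1) f_def abs_mult)
    show "0 \<le> A k" by (simp add: A_def split: prod.split)
  qed
  have "(\<Sum>k\<in>J. A k * E k ^ n) = (\<Sum>k\<in>J. exp (- s (fst k)))"
    by (intro sum.cong refl) (auto simp: A_def E_def mult.left_commute simp flip: exp_of_nat_mult exp_add)
  also have "\<dots> = (\<Sum>i\<in>I. \<Sum>\<sigma>\<in>{1, -1::real}. exp (- s i))"
    unfolding J_def by (subst sum.cartesian_product) (simp add: case_prod_beta')
  also have "\<dots> = 2 * (\<Sum>i\<in>I. exp (- s i))"
    by (simp add: sum_distrib_left)
  finally have moments': "Q.expectation (\<lambda>\<omega>. min 1 (?Z \<omega>)) \<le> 2 * (\<Sum>i\<in>I. exp (- s i)) + real n * \<Xi> a"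
    using moments by simp
  have Zm[measurable]: "?Z \<in> borel_measurable M"
  proof (intro borel_measurable_sum borel_measurable_times borel_measurable_const borel_measurable_exp[THEN measurable_compose[rotated]])
    fix k j assume "k \<in> J"
    then obtain i \<sigma> where k: "k = (i, \<sigma>)" "i \<in> I" by (auto simp: J_def)
    show "block (f k) (r + 2 * real j * a) a \<in> borel_measurable M"
      using bm[OF k(2)] by (simp add: k f_def block_scale[abs_def])
  qed
  have Z0: "0 \<le> ?Z \<omega>" for \<omega> by (intro sum_nonneg) (auto simp: A_def)
  have "measure Q bad = Q.expectation (indicator bad)" using bad_sets by simp
  also have "\<dots> \<le> Q.expectation (\<lambda>\<omega>. min 1 (?Z \<omega>))"
  proof (rule integral_mono)
    show "integrable Q (\<lambda>\<omega>. min 1 (?Z \<omega>))"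
    proof (intro Q.integrable_const_bound[where B=1] AE_I2)
      fix \<omega>
      show "norm (min 1 (?Z \<omega>)) \<le> 1" using Z0[of \<omega>] by simp
    qed measurable
    show "integrable Q (indicator bad :: _ \<Rightarrow> real)"
      using bad_sets by (intro Q.integrable_const_bound[where B=1]) (auto simp: indicator_def)
    fix \<omega> assume "\<omega> \<in> space Q"
    show "indicator bad \<omega> \<le> min 1 (?Z \<omega>)"
    proof (cases "\<omega> \<in> bad")
      case True
      then obtain i where i: "i \<in> I" "thr i \<le> \<bar>\<Sum>j<n. ?b i j \<omega>\<bar>" by (auto simp: bad)
      define \<sigma> :: real where "\<sigma> = (if 0 \<le> (\<Sum>j<n. ?b i j \<omega>) then 1 else -1)"
      have sg: "\<bar>\<Sum>j<n. ?b i j \<omega>\<bar> = \<sigma> * (\<Sum>j<n. ?b i j \<omega>)" by (simp add: \<sigma>_def)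
      have k: "(i, \<sigma>) \<in> J" using i by (simp add: J_def \<sigma>_def)
      have "1 \<le> exp (- (s i + (l i)\<^sup>2 * (real n * v)) + l i * thr i)"
        using l(3)[OF i(1)] by simp
      also have "\<dots> \<le> exp (- (s i + (l i)\<^sup>2 * (real n * v)) + l i * (\<sigma> * (\<Sum>j<n. ?b i j \<omega>)))"
        using i l(1)[OF i(1)] sg by (simp add: mult_left_mono)
      also have "\<dots> = A (i, \<sigma>) * exp (\<Sum>j<n. block (f (i, \<sigma>)) (r + 2 * real j * a) a \<omega>)"
        by (simp add: A_def f_def block_scale mult_ac sum_distrib_left flip: exp_add)
      also have "\<dots> \<le> ?Z \<omega>"
        by (rule member_le_sum[OF k _ J]) (auto simp: A_def)
      finally show ?thesis using True by simp
    qed (use Z0[of \<omega>] in simp)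
  qed
  also note moments'
  finally show "measure Q bad \<le> 2 * (\<Sum>i\<in>I. exp (- s i)) + real n * \<Xi> a" .
qed

lemma uniform_bernstein:
  fixes g :: "'i \<Rightarrow> 'a \<Rightarrow> real"
  assumes mix: "beta_mixing X P \<mu> \<Xi>" and \<Xi>: "\<Xi> a \<ge> 0" and I: "finite I" and a: "a > 0"
    and n: "n > 0" and B: "B > 0" and v: "v > 0"
    and g: "\<And>i. i \<in> I \<Longrightarrow> continuous_on UNIV (g i)" "\<And>i x. i \<in> I \<Longrightarrow> \<bar>g i x\<bar> \<le> B"
    and centred: "\<And>i. i \<in> I \<Longrightarrow> \<mu>.expectation (g i) = 0"
    and var: "\<And>i r. i \<in> I \<Longrightarrow> r \<ge> 0 \<Longrightarrow> Q.expectation (\<lambda>\<omega>. (block (g i) r a \<omega>)\<^sup>2) \<le> v"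
    and s: "\<And>i. i \<in> I \<Longrightarrow> s i > 0"
  obtains bad where "bad \<in> sets M" "measure Q bad \<le> 4 * (\<Sum>i\<in>I. exp (- s i)) + 2 * real n * \<Xi> a"
    "\<And>\<omega> i. \<omega> \<in> space M - bad \<Longrightarrow> i \<in> I \<Longrightarrow>
      \<bar>block (g i) 0 (2 * real n * a) \<omega>\<bar> \<le> 2 * (s i * (a * B) + 2 * sqrt (s i * (real n * v)))"
proof -
  define bad where "bad r = {\<omega> \<in> space M. \<exists>i\<in>I. s i * (a * B) + 2 * sqrt (s i * (real n * v))
      \<le> \<bar>\<Sum>j<n. block (g i) (r + 2 * real j * a) a \<omega>\<bar>}" for r
  have b: "bad r \<in> sets M" "measure Q (bad r) \<le> 2 * (\<Sum>i\<in>I. exp (- s i)) + real n * \<Xi> a" if r: "r \<ge> 0" for r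
    unfolding bad_def
    using uniform_bernstein_separated[where g=g and s=s and I=I and v=v and B=B and a=a and n=n and \<Xi>=\<Xi> and r=r]
      assms(1-8) g centred var s r by blast+
  have b0: "bad 0 \<in> sets M" "measure Q (bad 0) \<le> 2 * (\<Sum>i\<in>I. exp (- s i)) + real n * \<Xi> a"
    using b[of 0] by auto
  have ba: "bad a \<in> sets M" "measure Q (bad a) \<le> 2 * (\<Sum>i\<in>I. exp (- s i)) + real n * \<Xi> a"
    using b[of a] a by auto
  show thesis
  proof (rule that[of "bad 0 \<union> bad a"])
    show "bad 0 \<union> bad a \<in> sets M" using b0 ba by auto
    have "measure Q (bad 0 \<union> bad a) \<le> measure Q (bad 0) + measure Q (bad a)"
      using b0 ba by (intro measure_Un_le) auto
    then show "measure Q (bad 0 \<union> bad a) \<le> 4 * (\<Sum>i\<in>I. exp (- s i)) + 2 * real n * \<Xi> a"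
      using b0 ba by linarith
    fix \<omega> i assume w: "\<omega> \<in> space M - (bad 0 \<union> bad a)" and i: "i \<in> I"
    have "\<bar>\<Sum>j<n. block (g i) (0 + 2 * real j * a) a \<omega>\<bar> \<le> s i * (a * B) + 2 * sqrt (s i * (real n * v))"
      "\<bar>\<Sum>j<n. block (g i) (a + 2 * real j * a) a \<omega>\<bar> \<le> s i * (a * B) + 2 * sqrt (s i * (real n * v))"
      using w i by (auto simp: bad_def not_le intro: less_imp_le)
    moreover have "block (g i) 0 (2 * real n * a) \<omega> =
        (\<Sum>j<n. block (g i) (0 + 2 * real j * a) a \<omega>) + (\<Sum>j<n. block (g i) (a + 2 * real j * a) a \<omega>)"
      using w a by (intro block_split_even_odd[where B=B] g i) auto
    moreover have "\<bar>z\<bar> \<le> 2 * c" if "\<bar>x\<bar> \<le> c" "\<bar>y\<bar> \<le> c" "z = x + y" for x y z c :: real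
      using that by linarith
    ultimately show "\<bar>block (g i) 0 (2 * real n * a) \<omega>\<bar> \<le> 2 * (s i * (a * B) + 2 * sqrt (s i * (real n * v)))"
      by blast
  qed
qed

section \<open>Covariances and the dependence coefficient\<close>

text \<open>
  The \<open>L\<^sup>1\<close> distance on \<open>U \<times> U\<close> between the joint density of \<open>X 0\<close> and \<open>X s\<close> and the product of
  the marginal densities. It bounds the covariances of all functions supported in \<open>U\<close>, and each
  hypothesis on the process gives a bound for it.
\<close>

definition dependence :: "real \<Rightarrow> 'a set \<Rightarrow> ennreal" where
  "dependence s U =
     (\<integral>\<^sup>+x. indicator U x * (\<integral>\<^sup>+y. indicator U y * ennreal \<bar>p s x y - \<rho> y\<bar> \<partial>lborel) \<partial>\<mu>)"

lemma nn_integral_\<mu>: "f \<in> borel_measurable borel \<Longrightarrow> (\<integral>\<^sup>+x. f x \<partial>\<mu>) = (\<integral>\<^sup>+x. ennreal (\<rho> x) * f x \<partial>lborel)"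
  by (subst \<mu>_density) (simp add: nn_integral_density)

lemma nn_integral_p_1:
  assumes "s > 0"
  shows "(\<integral>\<^sup>+y. ennreal (p s x y) \<partial>lborel) = 1"
proof -
  interpret T: prob_space "transition X P s x" using assms by (intro prob_space_transition) simp
  have "emeasure (transition X P s x) UNIV = 1" using T.emeasure_space_1 by simp
  then show ?thesis
    using p_measurable2[OF assms] by (simp add: transition_density[OF assms] emeasure_density)
qed

lemma nn_integral_\<rho>_1: "(\<integral>\<^sup>+y. ennreal (\<rho> y) \<partial>lborel) = 1"
  using nn_integral_\<mu>[of "\<lambda>_. 1"] \<mu>.emeasure_space_1 by simp

lemma nn_integral_transition:
  assumes "s > 0" "f \<in> borel_measurable borel"
  shows "(\<integral>\<^sup>+y. f y \<partial>transition X P s x) = (\<integral>\<^sup>+y. ennreal (p s x y) * f y \<partial>lborel)"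
  using p_measurable2[OF assms(1)] assms(2)
  by (simp add: transition_density[OF assms(1)] nn_integral_density)

lemma nn_integral_X:
  assumes "t \<ge> 0" "f \<in> borel_measurable borel"
  shows "(\<integral>\<^sup>+\<omega>. f (X t \<omega>) \<partial>Q) = (\<integral>\<^sup>+x. f x \<partial>\<mu>)"
proof -
  have "(\<integral>\<^sup>+\<omega>. f (X t \<omega>) \<partial>Q) = (\<integral>\<^sup>+x. f x \<partial>distr Q borel (X t))"
    using X_measurable[OF assms(1)] assms(2)
    by (intro nn_integral_distr[symmetric]) (auto simp: measurable_cong_sets[OF sets_Q refl])
  then show ?thesis by (simp add: distr_X[OF assms(1)])
qed

lemma nn_integral_X_pair:
  assumes t: "t \<ge> 0" and s: "s > 0" and H[measurable]: "H \<in> borel_measurable (borel \<Otimes>\<^sub>M borel)"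
  shows "(\<integral>\<^sup>+\<omega>. H (X t \<omega>, X (t + s) \<omega>) \<partial>Q)
    = (\<integral>\<^sup>+x. ennreal (\<rho> x) * (\<integral>\<^sup>+y. ennreal (p s x y) * H (x, y) \<partial>lborel) \<partial>lborel)"
proof -
  note [measurable] = p_measurable[OF s]
  have Xt[measurable]: "X t \<in> F t \<rightarrow>\<^sub>M borel" using t by (intro X_measurable_F) auto
  have HF: "(\<lambda>z. H (X t (fst z), snd z)) \<in> borel_measurable (F t \<Otimes>\<^sub>M borel)" by measurable
  have m: "(\<lambda>x. \<integral>\<^sup>+y. ennreal (p s x y) * H (x, y) \<partial>lborel) \<in> borel_measurable borel"
  proof (rule lborel.borel_measurable_nn_integral)
    have "(\<lambda>z. ennreal (p s (fst z) (snd z)) * H (fst z, snd z)) \<in> borel_measurable (borel \<Otimes>\<^sub>M borel)"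
      by measurable
    then show "(\<lambda>(x, y). ennreal (p s x y) * H (x, y)) \<in> borel_measurable (borel \<Otimes>\<^sub>M lborel)"
      by (simp add: case_prod_beta')
  qed
  have Hx: "(\<lambda>y. H (x, y)) \<in> borel_measurable borel" for x by measurable
  have "(\<integral>\<^sup>+\<omega>. H (X t \<omega>, X (t + s) \<omega>) \<partial>Q) = (\<integral>\<^sup>+\<omega>. \<integral>\<^sup>+y. H (X t \<omega>, y) \<partial>transition X P s (X t \<omega>) \<partial>Q)"
    using markov_step[OF t less_imp_le[OF s] HF] by simp
  also have "\<dots> = (\<integral>\<^sup>+\<omega>. \<integral>\<^sup>+y. ennreal (p s (X t \<omega>) y) * H (X t \<omega>, y) \<partial>lborel \<partial>Q)"
    by (intro nn_integral_cong nn_integral_transition[OF s] Hx)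
  also have "\<dots> = (\<integral>\<^sup>+x. \<integral>\<^sup>+y. ennreal (p s x y) * H (x, y) \<partial>lborel \<partial>\<mu>)"
    by (rule nn_integral_X[OF t m])
  also have "\<dots> = (\<integral>\<^sup>+x. ennreal (\<rho> x) * (\<integral>\<^sup>+y. ennreal (p s x y) * H (x, y) \<partial>lborel) \<partial>lborel)"
    by (rule nn_integral_\<mu>[OF m])
  finally show ?thesis .
qed

lemma distr_X_pair:
  assumes t: "t \<ge> 0" and s: "s > 0"
  shows "distr Q (borel \<Otimes>\<^sub>M borel) (\<lambda>\<omega>. (X t \<omega>, X (t + s) \<omega>))
    = density (lborel \<Otimes>\<^sub>M lborel) (\<lambda>z. ennreal (\<rho> (fst z) * p s (fst z) (snd z)))"
proof (rule measure_eqI)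
  note [measurable] = p_measurable[OF s]
  have [measurable]: "X t \<in> M \<rightarrow>\<^sub>M borel" "X (t + s) \<in> M \<rightarrow>\<^sub>M borel" using t s by (auto intro: X_measurable)
  show "sets (distr Q (borel \<Otimes>\<^sub>M borel) (\<lambda>\<omega>. (X t \<omega>, X (t + s) \<omega>)))
    = sets (density (lborel \<Otimes>\<^sub>M lborel) (\<lambda>z. ennreal (\<rho> (fst z) * p s (fst z) (snd z))))"
    by (simp cong: sets_pair_measure_cong)
  fix A assume "A \<in> sets (distr Q (borel \<Otimes>\<^sub>M borel) (\<lambda>\<omega>. (X t \<omega>, X (t + s) \<omega>)))"
  then have A[measurable]: "A \<in> sets (borel \<Otimes>\<^sub>M borel)" by simp
  then have A': "A \<in> sets (lborel \<Otimes>\<^sub>M lborel)" by (simp cong: sets_pair_measure_cong)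
  have m: "(\<lambda>z. ennreal (\<rho> (fst z) * p s (fst z) (snd z))) \<in> borel_measurable (lborel \<Otimes>\<^sub>M lborel)"
    by (simp cong: measurable_cong_sets sets_pair_measure_cong) measurable
  have iA: "indicator A \<in> borel_measurable (borel \<Otimes>\<^sub>M borel)" by measurable
  have m2: "(\<lambda>z. ennreal (\<rho> (fst z) * p s (fst z) (snd z)) * indicator A z) \<in> borel_measurable (lborel \<Otimes>\<^sub>M lborel)"
    using m A' by measurable
  have "emeasure (distr Q (borel \<Otimes>\<^sub>M borel) (\<lambda>\<omega>. (X t \<omega>, X (t + s) \<omega>))) A
      = (\<integral>\<^sup>+z. indicator A z \<partial>distr Q (borel \<Otimes>\<^sub>M borel) (\<lambda>\<omega>. (X t \<omega>, X (t + s) \<omega>)))"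
    by simp
  also have "\<dots> = (\<integral>\<^sup>+\<omega>. indicator A (X t \<omega>, X (t + s) \<omega>) \<partial>Q)"
    by (rule nn_integral_distr) measurable
  also have "\<dots> = (\<integral>\<^sup>+x. ennreal (\<rho> x) * (\<integral>\<^sup>+y. ennreal (p s x y) * indicator A (x, y) \<partial>lborel) \<partial>lborel)"
    by (rule nn_integral_X_pair[OF t s iA])
  also have "\<dots> = (\<integral>\<^sup>+x. \<integral>\<^sup>+y. ennreal (\<rho> x * p s x y) * indicator A (x, y) \<partial>lborel \<partial>lborel)"
  proof (intro nn_integral_cong)
    fix x
    have "(\<lambda>y. ennreal (p s x y) * indicator A (x, y)) \<in> borel_measurable borel"
      using p_measurable2[OF s] by measurable
    then show "ennreal (\<rho> x) * (\<integral>\<^sup>+y. ennreal (p s x y) * indicator A (x, y) \<partial>lborel)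
      = (\<integral>\<^sup>+y. ennreal (\<rho> x * p s x y) * indicator A (x, y) \<partial>lborel)"
      using \<rho>_nonneg by (subst nn_integral_cmult[symmetric]) (auto simp: ennreal_mult' mult.assoc)
  qed
  also have "\<dots> = (\<integral>\<^sup>+z. ennreal (\<rho> (fst z) * p s (fst z) (snd z)) * indicator A z \<partial>(lborel \<Otimes>\<^sub>M lborel))"
    using lborel.nn_integral_fst[OF m2] by simp
  also have "\<dots> = emeasure (density (lborel \<Otimes>\<^sub>M lborel) (\<lambda>z. ennreal (\<rho> (fst z) * p s (fst z) (snd z)))) A"
    by (rule emeasure_density[symmetric, OF m A'])
  finally show "emeasure (distr Q (borel \<Otimes>\<^sub>M borel) (\<lambda>\<omega>. (X t \<omega>, X (t + s) \<omega>))) A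
    = emeasure (density (lborel \<Otimes>\<^sub>M lborel) (\<lambda>z. ennreal (\<rho> (fst z) * p s (fst z) (snd z)))) A" .
qed

text \<open>
  Both \<open>E (f (X t) * f (X (t + s)))\<close> and the square of the mean are integrals of the same bounded
  function over \<open>U \<times> U\<close>, with the densities \<open>\<rho> x * p s x y\<close> and \<open>\<rho> x * \<rho> y\<close>.
\<close>

lemma covariance_le_dependence:
  fixes f :: "'a \<Rightarrow> real"
  assumes t: "t \<ge> 0" and s: "s > 0" and f[measurable]: "f \<in> borel_measurable borel"
    and B: "\<And>x. \<bar>f x\<bar> \<le> B" and U[measurable]: "U \<in> sets borel" and supp: "\<And>x. x \<notin> U \<Longrightarrow> f x = 0"
  shows "ennreal \<bar>Q.expectation (\<lambda>\<omega>. (f (X t \<omega>) - \<mu>.expectation f) * (f (X (t + s) \<omega>) - \<mu>.expectation f))\<bar>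
    \<le> ennreal (B\<^sup>2) * dependence s U"
proof -
  define m where "m = \<mu>.expectation f"
  note pm[measurable] = p_measurable[OF s]
  note p0 = p_nonneg[OF s]
  have ts: "t + s \<ge> 0" using t s by simp
  have Xm[measurable]: "X t \<in> M \<rightarrow>\<^sub>M borel" "X (t + s) \<in> M \<rightarrow>\<^sub>M borel"
    using t ts by (auto intro: X_measurable)
  let ?D = "lborel \<Otimes>\<^sub>M lborel :: ('a \<times> 'a) measure"
  have Dm: "borel_measurable ?D = borel_measurable (borel \<Otimes>\<^sub>M borel)"
    by (intro measurable_cong_sets sets_pair_measure_cong) auto
  have B0: "0 \<le> B" using B[of undefined] by linarith
  have EX: "Q.expectation (\<lambda>\<omega>. f (X r \<omega>)) = m" if "r \<ge> 0" for r
  proof -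
    have "Q.expectation (\<lambda>\<omega>. f (X r \<omega>)) = integral\<^sup>L (distr Q borel (X r)) f"
      using X_measurable[OF that] by (intro integral_distr[symmetric]) (auto simp: measurable_cong_sets[OF sets_Q refl])
    then show ?thesis by (simp add: distr_X[OF that] m_def)
  qed
  have i1: "integrable Q (\<lambda>\<omega>. f (X t \<omega>))" "integrable Q (\<lambda>\<omega>. f (X (t + s) \<omega>))"
    using B by (auto intro!: Q.integrable_const_bound[where B=B])
  have i2: "integrable Q (\<lambda>\<omega>. f (X t \<omega>) * f (X (t + s) \<omega>))"
    using B B0 by (intro Q.integrable_const_bound[where B="B * B"]) (auto simp: abs_mult intro!: mult_mono)
  have "Q.expectation (\<lambda>\<omega>. (f (X t \<omega>) - m) * (f (X (t + s) \<omega>) - m))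
      = Q.expectation (\<lambda>\<omega>. f (X t \<omega>) * f (X (t + s) \<omega>) - m * f (X t \<omega>) - m * f (X (t + s) \<omega>) + m * m)"
    by (simp add: algebra_simps)
  also have "\<dots> = Q.expectation (\<lambda>\<omega>. f (X t \<omega>) * f (X (t + s) \<omega>)) - m * m"
    using i1 i2 EX[OF t] EX[OF ts] by simp
  finally have cov: "Q.expectation (\<lambda>\<omega>. (f (X t \<omega>) - m) * (f (X (t + s) \<omega>) - m))
      = Q.expectation (\<lambda>\<omega>. f (X t \<omega>) * f (X (t + s) \<omega>)) - m * m" .
  let ?ff = "\<lambda>z. f (fst z) * f (snd z)"
  have ffm: "?ff \<in> borel_measurable (borel \<Otimes>\<^sub>M borel)" by measurable
  have ff: "\<bar>?ff z\<bar> \<le> B * B" for z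
    using B B0 by (auto simp: abs_mult intro!: mult_mono)
  let ?k = "\<lambda>z. \<rho> (fst z) * p s (fst z) (snd z)"
  let ?l = "\<lambda>z. \<rho> (fst z) * \<rho> (snd z)"
  have km: "?k \<in> borel_measurable ?D" unfolding Dm by measurable
  have lm: "?l \<in> borel_measurable ?D" unfolding Dm by measurable
  have ki: "integrable ?D ?k"
  proof (rule integrableI_nonneg[OF km])
    show "AE z in ?D. 0 \<le> ?k z" using \<rho>_nonneg p0 by (intro AE_I2) simp
    have "(\<integral>\<^sup>+z. ennreal (?k z) \<partial>?D) = (\<integral>\<^sup>+x. \<integral>\<^sup>+y. ennreal (\<rho> x) * ennreal (p s x y) \<partial>lborel \<partial>lborel)"
      using km by (subst lborel.nn_integral_fst[symmetric]) (auto simp: ennreal_mult' \<rho>_nonneg)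
    also have "\<dots> = 1"
      using p_measurable2[OF s] by (simp add: nn_integral_cmult nn_integral_p_1[OF s] nn_integral_\<rho>_1)
    finally show "(\<integral>\<^sup>+z. ennreal (?k z) \<partial>?D) < \<infinity>" by simp
  qed
  have li: "integrable ?D ?l"
  proof (rule integrableI_nonneg[OF lm])
    show "AE z in ?D. 0 \<le> ?l z" using \<rho>_nonneg by (intro AE_I2) simp
    have "(\<integral>\<^sup>+z. ennreal (?l z) \<partial>?D) = (\<integral>\<^sup>+x. \<integral>\<^sup>+y. ennreal (\<rho> x) * ennreal (\<rho> y) \<partial>lborel \<partial>lborel)"
      using lm by (subst lborel.nn_integral_fst[symmetric]) (auto simp: ennreal_mult' \<rho>_nonneg)
    also have "\<dots> = 1"
      by (simp add: nn_integral_cmult nn_integral_\<rho>_1)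
    finally show "(\<integral>\<^sup>+z. ennreal (?l z) \<partial>?D) < \<infinity>" by simp
  qed
  have mult_ff: "integrable ?D (\<lambda>z. k z * ?ff z)" if k: "integrable ?D k" for k :: "'a \<times> 'a \<Rightarrow> real"
  proof (rule Bochner_Integration.integrable_bound[OF integrable_mult_left[OF k, of "B * B"]])
    show "(\<lambda>z. k z * ?ff z) \<in> borel_measurable ?D"
      using borel_measurable_integrable[OF k] ffm unfolding Dm by (rule borel_measurable_times)
    show "AE z in ?D. norm (k z * ?ff z) \<le> norm (k z * (B * B))"
    proof (rule AE_I2)
      fix z
      have "\<bar>k z\<bar> * \<bar>?ff z\<bar> \<le> \<bar>k z\<bar> * (B * B)" by (intro mult_left_mono ff) simp
      then show "norm (k z * ?ff z) \<le> norm (k z * (B * B))" using B0 by (simp add: abs_mult)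
    qed
  qed
  note kfi = mult_ff[OF ki] and lfi = mult_ff[OF li]
  have "Q.expectation (\<lambda>\<omega>. f (X t \<omega>) * f (X (t + s) \<omega>))
      = (\<integral>z. ?ff z \<partial>distr Q (borel \<Otimes>\<^sub>M borel) (\<lambda>\<omega>. (X t \<omega>, X (t + s) \<omega>)))"
    by (subst integral_distr) auto
  also have "\<dots> = (\<integral>z. ?k z * ?ff z \<partial>?D)"
    unfolding distr_X_pair[OF t s] using \<rho>_nonneg p0 km ffm
    by (subst integral_density) (auto simp: Dm)
  finally have E1: "Q.expectation (\<lambda>\<omega>. f (X t \<omega>) * f (X (t + s) \<omega>)) = (\<integral>z. ?k z * ?ff z \<partial>?D)" .
  have m: "m = (\<integral>y. \<rho> y * f y \<partial>lborel)"
    unfolding m_def using \<rho>_nonneg by (subst \<mu>_density, subst integral_density) auto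
  have "(\<integral>z. ?l z * ?ff z \<partial>?D) = (\<integral>x. \<integral>y. (\<rho> x * f x) * (\<rho> y * f y) \<partial>lborel \<partial>lborel)"
    using lborel_pair.integral_fst'[OF lfi] by (simp add: mult_ac)
  also have "\<dots> = m * m" using m by simp
  finally have E2: "m * m = (\<integral>z. ?l z * ?ff z \<partial>?D)" ..
  have "Q.expectation (\<lambda>\<omega>. (f (X t \<omega>) - m) * (f (X (t + s) \<omega>) - m)) = (\<integral>z. ?k z * ?ff z - ?l z * ?ff z \<partial>?D)"
    unfolding cov E1 E2 using kfi lfi by simp
  then have "ennreal \<bar>Q.expectation (\<lambda>\<omega>. (f (X t \<omega>) - m) * (f (X (t + s) \<omega>) - m))\<bar>
      \<le> ennreal (\<integral>z. \<bar>?k z * ?ff z - ?l z * ?ff z\<bar> \<partial>?D)"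
    by (auto intro!: ennreal_leI integral_abs_bound)
  also have "\<dots> = (\<integral>\<^sup>+z. ennreal \<bar>?k z * ?ff z - ?l z * ?ff z\<bar> \<partial>?D)"
    using kfi lfi by (intro nn_integral_eq_integral[symmetric]) auto
  also have "\<dots> \<le> (\<integral>\<^sup>+z. ennreal (B\<^sup>2) * (ennreal (\<rho> (fst z)) * (indicator U (fst z) *
      (indicator U (snd z) * ennreal \<bar>p s (fst z) (snd z) - \<rho> (snd z)\<bar>))) \<partial>?D)"
  proof (rule nn_integral_mono)
    fix z :: "'a \<times> 'a"
    show "ennreal \<bar>?k z * ?ff z - ?l z * ?ff z\<bar> \<le> ennreal (B\<^sup>2) * (ennreal (\<rho> (fst z)) * (indicator U (fst z) *
      (indicator U (snd z) * ennreal \<bar>p s (fst z) (snd z) - \<rho> (snd z)\<bar>)))"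
    proof (cases "fst z \<in> U \<and> snd z \<in> U")
      case True
      have "\<bar>?k z * ?ff z - ?l z * ?ff z\<bar> = \<bar>?ff z\<bar> * (\<rho> (fst z) * \<bar>p s (fst z) (snd z) - \<rho> (snd z)\<bar>)"
      proof -
        have "?k z * ?ff z - ?l z * ?ff z = ?ff z * (\<rho> (fst z) * (p s (fst z) (snd z) - \<rho> (snd z)))"
          by (simp add: algebra_simps)
        then show ?thesis using \<rho>_nonneg[of "fst z"] by (simp add: abs_mult)
      qed
      also have "\<dots> \<le> B\<^sup>2 * (\<rho> (fst z) * \<bar>p s (fst z) (snd z) - \<rho> (snd z)\<bar>)"
        using ff[of z] \<rho>_nonneg by (intro mult_right_mono) (auto simp: power2_eq_square)
      finally show ?thesis
        using True \<rho>_nonneg by (simp add: ennreal_mult'[symmetric] ennreal_leI)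
    next
      case False
      then have ff0: "?ff z = 0" using supp by auto
      show ?thesis unfolding ff0 by simp
    qed
  qed
  also have "\<dots> = (\<integral>\<^sup>+x. \<integral>\<^sup>+y. ennreal (B\<^sup>2) * (ennreal (\<rho> x) * (indicator U x *
      (indicator U y * ennreal \<bar>p s x y - \<rho> y\<bar>))) \<partial>lborel \<partial>lborel)"
    by (subst lborel.nn_integral_fst[symmetric]) (auto simp: Dm)
  also have "\<dots> = (\<integral>\<^sup>+x. ennreal (B\<^sup>2) * (ennreal (\<rho> x) * (indicator U x *
      (\<integral>\<^sup>+y. indicator U y * ennreal \<bar>p s x y - \<rho> y\<bar> \<partial>lborel))) \<partial>lborel)"
    using p_measurable2[OF s] by (simp add: nn_integral_cmult)
  also have "\<dots> = ennreal (B\<^sup>2) * (\<integral>\<^sup>+x. ennreal (\<rho> x) * (indicator U x *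
      (\<integral>\<^sup>+y. indicator U y * ennreal \<bar>p s x y - \<rho> y\<bar> \<partial>lborel)) \<partial>lborel)"
    by (rule nn_integral_cmult) measurable
  also have "\<dots> = ennreal (B\<^sup>2) * dependence s U"
    unfolding dependence_def by (subst nn_integral_\<mu>) measurable
  finally show ?thesis by (simp add: m_def)
qed

end

section \<open>Bounds on the dependence coefficient\<close>

lemma psi_squared:
  assumes h: "0 < h" "h < 1"
  shows "(psi 1 (h ^ 1))\<^sup>2 = 1"
    and "(psi 2 (h ^ 2))\<^sup>2 = 1 + ln (1 / h\<^sup>2)"
    and "d \<ge> 3 \<Longrightarrow> (psi d (h ^ d))\<^sup>2 = h powr (2 - real d)"
proof -
  show "(psi 1 (h ^ 1))\<^sup>2 = 1" by (simp add: psi_def)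
  have "1 \<le> 1 / h\<^sup>2" using h by (simp add: power_le_one)
  then show "(psi 2 (h ^ 2))\<^sup>2 = 1 + ln (1 / h\<^sup>2)" by (simp add: psi_def)
  assume d: "d \<ge> 3"
  have "(psi d (h ^ d))\<^sup>2 = ((h powr real d) powr (1 / real d - 1 / 2)) powr 2"
    using d h by (simp add: psi_def powr_realpow)
  also have "\<dots> = h powr (2 - real d)"
  proof -
    have "real d * (1 / real d - 1 / 2) * 2 = 2 - real d"
      using d by (simp add: right_diff_distrib left_diff_distrib)
    then show ?thesis unfolding powr_powr by simp
  qed
  finally show "(psi d (h ^ d))\<^sup>2 = h powr (2 - real d)" .
qed

lemma psi_squared_bounds:
  assumes h: "0 < h" "h < 1" and d: "d \<ge> 1"
  shows "1 \<le> (psi d (h ^ d))\<^sup>2"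
    and "d \<ge> 2 \<Longrightarrow> ln (1 / h) \<le> (psi d (h ^ d))\<^sup>2"
    and "d \<ge> 2 \<Longrightarrow> h ^ d * h\<^sup>2 \<le> h ^ (2 * d) * (psi d (h ^ d))\<^sup>2"
proof -
  consider "d = 1" | "d = 2" | "d \<ge> 3" using d by linarith
  then have "1 \<le> (psi d (h ^ d))\<^sup>2 \<and> (d \<ge> 2 \<longrightarrow> ln (1 / h) \<le> (psi d (h ^ d))\<^sup>2)
    \<and> (d \<ge> 2 \<longrightarrow> h ^ d * h\<^sup>2 \<le> h ^ (2 * d) * (psi d (h ^ d))\<^sup>2)"
  proof cases
    case 1
    then show ?thesis using psi_squared(1)[OF h] by simp
  next
    case 2
    have l: "0 \<le> ln (1 / h)" using h by simp
    have e: "ln (1 / h\<^sup>2) = 2 * ln (1 / h)"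
      using h by (simp add: ln_div ln_realpow)
    have "h ^ 4 * 1 \<le> h ^ 4 * (1 + 2 * ln (1 / h))"
      using l h by (intro mult_left_mono) auto
    then show ?thesis
      using psi_squared(2)[OF h] 2 l e by (simp flip: power_add)
  next
    case 3
    have p: "(psi d (h ^ d))\<^sup>2 = h powr (2 - real d)" by (rule psi_squared(3)[OF h 3])
    have "ln (1 / h) \<le> 1 / h - 1" using h by (intro ln_le_minus_one) simp
    also have "\<dots> \<le> h powr (- 1)" using h by (simp add: powr_minus_divide)
    also have "\<dots> \<le> h powr (2 - real d)"
      using 3 h by (intro powr_mono') auto
    finally have 1: "ln (1 / h) \<le> h powr (2 - real d)" .
    have "h powr 0 \<le> h powr (2 - real d)" using 3 h by (intro powr_mono') auto
    then have 2: "1 \<le> h powr (2 - real d)" using h by simp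
    have "h ^ d * h\<^sup>2 = h powr (real d + 2)"
      using h by (simp add: powr_add powr_realpow)
    also have "\<dots> = h powr (real (2 * d)) * h powr (2 - real d)"
      by (simp flip: powr_add)
    also have "h powr (real (2 * d)) = h ^ (2 * d)" using h(1) by (rule powr_realpow)
    finally show ?thesis using 1 2 p by simp
  qed
  then show "1 \<le> (psi d (h ^ d))\<^sup>2"
    "d \<ge> 2 \<Longrightarrow> ln (1 / h) \<le> (psi d (h ^ d))\<^sup>2"
    "d \<ge> 2 \<Longrightarrow> h ^ d * h\<^sup>2 \<le> h ^ (2 * d) * (psi d (h ^ d))\<^sup>2" by auto
qed

text \<open>
  This integral is the origin of the three regimes of \<open>psi\<close>: the singularity of the transition density
  at time 0 is integrable for \<open>d = 1\<close>, logarithmic for \<open>d = 2\<close> and of polynomial order for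
  \<open>d \<ge> 3\<close>.
\<close>

lemma nn_integral_heat_kernel_singularity:
  assumes h: "0 < h" "h < 1" and d: "d \<ge> 2"
  shows "(\<integral>\<^sup>+s. ennreal (s powr (- real d / 2)) * indicator {h\<^sup>2..1} s \<partial>lborel) \<le> ennreal (2 * (psi d (h ^ d))\<^sup>2)"
proof (cases "d = 2")
  case True
  have "(\<integral>\<^sup>+s. ennreal (s powr (- real d / 2)) * indicator {h\<^sup>2..1} s \<partial>lborel) = ennreal (ln 1 - ln (h\<^sup>2))"
  proof (rule nn_integral_FTC_Icc)
    fix s :: real assume "s \<in> {h\<^sup>2..1}"
    then have "h\<^sup>2 \<le> s" by simp
    moreover have "0 < h\<^sup>2" using h by simp
    ultimately have s: "s > 0" by linarith
    then have "s powr (- real d / 2) = 1 / s" using True by (simp add: powr_minus_divide)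
    then show "(ln has_real_derivative s powr (- real d / 2)) (at s)"
      using s DERIV_ln_divide[of s] by simp
  qed (use h in \<open>auto simp: power_le_one\<close>)
  also have "ln 1 - ln (h\<^sup>2) = ln (1 / h\<^sup>2)" using h by (simp add: ln_div)
  also have "ennreal (ln (1 / h\<^sup>2)) \<le> ennreal (2 * (psi d (h ^ d))\<^sup>2)"
  proof (rule ennreal_leI)
    have "1 \<le> 1 / h\<^sup>2" using h by (simp add: power_le_one)
    then have "0 \<le> ln (1 / h\<^sup>2)" by simp
    then show "ln (1 / h\<^sup>2) \<le> 2 * (psi d (h ^ d))\<^sup>2"
      using psi_squared(2)[OF h] True by simp
  qed
  finally show ?thesis .
next
  case False
  then have d: "d \<ge> 3" using d by simp
  define e where "e = 1 - real d / 2"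
  have e: "e \<le> - 1 / 2" using d by (simp add: e_def)
  have "(\<integral>\<^sup>+s. ennreal (s powr (- real d / 2)) * indicator {h\<^sup>2..1} s \<partial>lborel)
      = ennreal (1 powr e / e - (h\<^sup>2) powr e / e)"
  proof (rule nn_integral_FTC_Icc)
    fix s :: real assume "s \<in> {h\<^sup>2..1}"
    then have "h\<^sup>2 \<le> s" by simp
    moreover have "0 < h\<^sup>2" using h by simp
    ultimately have s: "s > 0" by linarith
    show "((\<lambda>s. s powr e / e) has_real_derivative s powr (- real d / 2)) (at s)"
      using s e by (auto intro!: derivative_eq_intros simp: e_def)
  qed (use h in \<open>auto simp: power_le_one\<close>)
  also have "\<dots> \<le> ennreal (2 * (psi d (h ^ d))\<^sup>2)"
  proof (rule ennreal_leI)
    have p: "(h\<^sup>2) powr e = (psi d (h ^ d))\<^sup>2"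
    proof -
      have "(h\<^sup>2) powr e = (h powr 2) powr e" using h by simp
      also have "\<dots> = h powr (2 - real d)" unfolding powr_powr by (simp add: e_def)
      finally show ?thesis by (simp add: psi_squared(3)[OF h d])
    qed
    have "(psi d (h ^ d))\<^sup>2 * (1 / - e) \<le> (psi d (h ^ d))\<^sup>2 * 2"
      using e by (intro mult_left_mono) (auto simp: field_simps)
    moreover have "(psi d (h ^ d))\<^sup>2 * (1 / - e) = - ((psi d (h ^ d))\<^sup>2 / e)" by simp
    moreover have "1 powr e / e \<le> 0" using e by (intro divide_nonneg_nonpos) auto
    ultimately show "1 powr e / e - (h\<^sup>2) powr e / e \<le> 2 * (psi d (h ^ d))\<^sup>2"
      unfolding p by linarith
  qed
  finally show ?thesis .
qed

context stationary_density_process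
begin

lemma emeasure_transition_measurable:
  assumes "s \<ge> 0" "U \<in> sets borel"
  shows "(\<lambda>x. emeasure (transition X P s x) U) \<in> borel_measurable borel"
  using measurable_compose[OF measurable_prob_algebraD[OF kernel_transition[OF assms(1)]]
      measurable_emeasure_subprob_algebra[OF assms(2)]] .

lemma dependence_le_joint:
  assumes s: "s > 0" and U[measurable]: "U \<in> sets borel"
  shows "dependence s U \<le> (\<integral>\<^sup>+x. indicator U x * emeasure (transition X P s x) U \<partial>\<mu>) + emeasure \<mu> U * emeasure \<mu> U"
proof -
  note [measurable] = p_measurable2[OF s]
  have tm: "(\<lambda>x. emeasure (transition X P s x) U) \<in> borel_measurable borel"
    using s by (intro emeasure_transition_measurable U) simp
  have "dependence s U \<le> (\<integral>\<^sup>+x. indicator U x * emeasure (transition X P s x) U + indicator U x * emeasure \<mu> U \<partial>\<mu>)"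
    unfolding dependence_def
  proof (rule nn_integral_mono)
    fix x
    have "(\<integral>\<^sup>+y. indicator U y * ennreal \<bar>p s x y - \<rho> y\<bar> \<partial>lborel)
        \<le> (\<integral>\<^sup>+y. ennreal (p s x y) * indicator U y + ennreal (\<rho> y) * indicator U y \<partial>lborel)"
    proof (rule nn_integral_mono)
      fix y
      have "\<bar>p s x y - \<rho> y\<bar> \<le> p s x y + \<rho> y" using p_nonneg[OF s, of x y] \<rho>_nonneg[of y] by linarith
      then have "ennreal \<bar>p s x y - \<rho> y\<bar> \<le> ennreal (p s x y) + ennreal (\<rho> y)"
        using p_nonneg[OF s] \<rho>_nonneg by (simp flip: ennreal_plus)
      then show "indicator U y * ennreal \<bar>p s x y - \<rho> y\<bar> \<le> ennreal (p s x y) * indicator U y + ennreal (\<rho> y) * indicator U y"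
        by (simp add: indicator_def)
    qed
    also have "\<dots> = emeasure (transition X P s x) U + emeasure \<mu> U"
      by (subst \<mu>_density) (simp add: nn_integral_add transition_density[OF s] emeasure_density)
    finally show "indicator U x * (\<integral>\<^sup>+y. indicator U y * ennreal \<bar>p s x y - \<rho> y\<bar> \<partial>lborel)
        \<le> indicator U x * emeasure (transition X P s x) U + indicator U x * emeasure \<mu> U"
      by (simp add: indicator_def)
  qed
  also have "\<dots> = (\<integral>\<^sup>+x. indicator U x * emeasure (transition X P s x) U \<partial>\<mu>) + (\<integral>\<^sup>+x. indicator U x * emeasure \<mu> U \<partial>\<mu>)"
    using tm by (intro nn_integral_add) auto
  also have "(\<integral>\<^sup>+x. indicator U x * emeasure \<mu> U \<partial>\<mu>) = emeasure \<mu> U * emeasure \<mu> U"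
    by (simp add: nn_integral_multc)
  finally show ?thesis .
qed

lemma dependence_le_bounded_transition:
  assumes s: "s > 0" and U[measurable]: "U \<in> sets borel" and c: "\<And>x. emeasure (transition X P s x) U \<le> c"
  shows "dependence s U \<le> emeasure \<mu> U * (c + emeasure \<mu> U)"
proof -
  have "(\<integral>\<^sup>+x. indicator U x * emeasure (transition X P s x) U \<partial>\<mu>) \<le> (\<integral>\<^sup>+x. indicator U x * c \<partial>\<mu>)"
    by (intro nn_integral_mono mult_left_mono c) simp
  also have "\<dots> = emeasure \<mu> U * c" by (simp add: nn_integral_multc)
  finally show ?thesis
    using dependence_le_joint[OF s U] by (simp add: distrib_left) (meson add_right_mono order_trans)
qed

lemma transition_le_density_bound:
  assumes s: "s > 0" and U[measurable]: "U \<in> sets borel" and c: "\<And>y. p s x y \<le> c"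
  shows "emeasure (transition X P s x) U \<le> ennreal c * emeasure lborel U"
proof -
  note [measurable] = p_measurable2[OF s]
  have "emeasure (transition X P s x) U = (\<integral>\<^sup>+y. ennreal (p s x y) * indicator U y \<partial>lborel)"
    by (simp add: transition_density[OF s] emeasure_density)
  also have "\<dots> \<le> (\<integral>\<^sup>+y. ennreal c * indicator U y \<partial>lborel)"
    by (intro nn_integral_mono mult_right_mono ennreal_leI c) simp
  also have "\<dots> = ennreal c * emeasure lborel U" by (simp add: nn_integral_cmult)
  finally show ?thesis .
qed

lemma emeasure_\<mu>_eq: "s \<ge> 0 \<Longrightarrow> U \<in> sets borel \<Longrightarrow> emeasure \<mu> U = (\<integral>\<^sup>+x. emeasure (transition X P s x) U \<partial>\<mu>)"
proof -
  assume s: "s \<ge> 0" and U: "U \<in> sets borel"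
  have k: "transition X P s \<in> \<mu> \<rightarrow>\<^sub>M subprob_algebra borel"
    using measurable_prob_algebraD[OF kernel_transition[OF s]] by (simp add: measurable_cong_sets[OF sets_\<mu> refl])
  have "\<mu> \<bind> transition X P s = \<mu>"
    using invariant s by (simp add: invariant_distribution_def)
  then show ?thesis
    using emeasure_bind[OF _ k U] \<mu>.not_empty by simp
qed

lemma emeasure_\<mu>_le:
  assumes R: "\<And>x y. p 1 x y \<le> R" and U: "U \<in> sets borel"
  shows "emeasure \<mu> U \<le> ennreal R * emeasure lborel U"
proof -
  have "emeasure \<mu> U = (\<integral>\<^sup>+x. emeasure (transition X P 1 x) U \<partial>\<mu>)"
    using U by (intro emeasure_\<mu>_eq) auto
  also have "\<dots> \<le> (\<integral>\<^sup>+x. ennreal R * emeasure lborel U \<partial>\<mu>)"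
    by (intro nn_integral_mono transition_le_density_bound R U) simp
  also have "\<dots> = ennreal R * emeasure lborel U" using \<mu>.emeasure_space_1 by simp
  finally show ?thesis .
qed

text \<open>
  Conditioning at time \<open>s - 1\<close> leaves one unit of time to move into \<open>U\<close>, so the bound on the density
  at time 1 controls all later times.
\<close>

lemma dependence_le_after_time_1:
  assumes s: "s > 1" and U[measurable]: "U \<in> sets borel" and R: "\<And>x y. p 1 x y \<le> R"
  shows "dependence s U \<le> emeasure \<mu> U * (ennreal R * emeasure lborel U + emeasure \<mu> U)"
proof -
  have X0: "X 0 \<in> F (s - 1) \<rightarrow>\<^sub>M borel" using s by (intro X_measurable_F) auto
  have XM[measurable]: "X 0 \<in> M \<rightarrow>\<^sub>M borel" "X s \<in> M \<rightarrow>\<^sub>M borel" using s by (auto intro: X_measurable)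
  have s1: "s - 1 \<ge> 0" and sp: "s > 0" using s by auto
  note tm = emeasure_transition_measurable[OF _ U]
  have "(\<integral>\<^sup>+x. indicator U x * emeasure (transition X P s x) U \<partial>\<mu>)
      = (\<integral>\<^sup>+\<omega>. indicator U (X 0 \<omega>) * emeasure (transition X P s (X 0 \<omega>)) U \<partial>Q)"
    using tm[of s] sp by (intro nn_integral_X[symmetric]) auto
  also have "\<dots> = (\<integral>\<^sup>+\<omega>. indicator (X 0 -` U \<inter> space M) \<omega> * emeasure (transition X P s (X 0 \<omega>)) U \<partial>Q)"
    by (intro nn_integral_cong) (auto simp: indicator_def)
  also have "\<dots> = (\<integral>\<^sup>+\<omega>. indicator (X 0 -` U \<inter> space M) \<omega> * indicator U (X (0 + s) \<omega>) \<partial>Q)"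
    using sp measurable_sets[OF X_measurable_F[of 0 0] U]
    by (intro markov_Q[symmetric]) auto
  also have "\<dots> = (\<integral>\<^sup>+\<omega>. indicator (X 0 -` U \<inter> space M) \<omega> * indicator U (X ((s - 1) + 1) \<omega>) \<partial>Q)" by simp
  also have "\<dots> = (\<integral>\<^sup>+\<omega>. indicator (X 0 -` U \<inter> space M) \<omega> * emeasure (transition X P 1 (X (s - 1) \<omega>)) U \<partial>Q)"
    using s1 measurable_sets[OF X0 U] by (intro markov_Q) auto
  also have "\<dots> \<le> (\<integral>\<^sup>+\<omega>. indicator (X 0 -` U \<inter> space M) \<omega> * (ennreal R * emeasure lborel U) \<partial>Q)"
    by (intro nn_integral_mono mult_left_mono transition_le_density_bound R U) auto
  also have "\<dots> = (\<integral>\<^sup>+\<omega>. indicator U (X 0 \<omega>) * (ennreal R * emeasure lborel U) \<partial>Q)"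
    by (intro nn_integral_cong) (auto simp: indicator_def)
  also have "\<dots> = (\<integral>\<^sup>+x. indicator U x * (ennreal R * emeasure lborel U) \<partial>\<mu>)"
    by (intro nn_integral_X) auto
  also have "\<dots> = emeasure \<mu> U * (ennreal R * emeasure lborel U)"
    by (simp add: nn_integral_multc)
  finally show ?thesis
    using dependence_le_joint[OF sp U] by (simp add: distrib_left) (meson add_right_mono order_trans)
qed

lemma dependence_le_mixing:
  assumes mix: "beta_mixing X P \<mu> \<Xi>" and s: "s > 0"
  shows "dependence s U \<le> ennreal (\<Xi> s)"
proof -
  have "dependence s U \<le> (\<integral>\<^sup>+x. \<integral>\<^sup>+y. ennreal \<bar>p s x y - \<rho> y\<bar> \<partial>lborel \<partial>\<mu>)"
    unfolding dependence_def
  proof (rule nn_integral_mono)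
    fix x
    have "indicator U x * (\<integral>\<^sup>+y. indicator U y * ennreal \<bar>p s x y - \<rho> y\<bar> \<partial>lborel)
        \<le> 1 * (\<integral>\<^sup>+y. 1 * ennreal \<bar>p s x y - \<rho> y\<bar> \<partial>lborel)"
      by (intro mult_mono nn_integral_mono) (auto simp: indicator_def)
    then show "indicator U x * (\<integral>\<^sup>+y. indicator U y * ennreal \<bar>p s x y - \<rho> y\<bar> \<partial>lborel)
        \<le> (\<integral>\<^sup>+y. ennreal \<bar>p s x y - \<rho> y\<bar> \<partial>lborel)" by simp
  qed
  also have "\<dots> \<le> ennreal (\<Xi> s)" by (rule nn_integral_tv_distance_le[OF mix s])
  finally show ?thesis .
qed

lemma dependence_le_uniform:
  assumes s: "s > 0" and U[measurable]: "U \<in> sets borel" "\<Lambda> \<in> sets borel"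
    and full: "emeasure \<mu> \<Lambda> = 1" and c: "\<And>x y. x \<in> U \<inter> \<Lambda> \<Longrightarrow> y \<in> U \<Longrightarrow> \<bar>p s x y - \<rho> y\<bar> \<le> c"
  shows "dependence s U \<le> emeasure \<mu> U * (ennreal c * emeasure lborel U)"
proof -
  have "AE x in \<mu>. x \<in> \<Lambda>"
    using full by (intro \<mu>.AE_prob_1) (simp add: measure_def)
  then have "dependence s U \<le> (\<integral>\<^sup>+x. indicator U x * (ennreal c * emeasure lborel U) \<partial>\<mu>)"
    unfolding dependence_def
  proof (intro nn_integral_mono_AE, eventually_elim)
    case (elim x)
    show ?case
    proof (cases "x \<in> U")
      case True
      have "(\<integral>\<^sup>+y. indicator U y * ennreal \<bar>p s x y - \<rho> y\<bar> \<partial>lborel) \<le> (\<integral>\<^sup>+y. ennreal c * indicator U y \<partial>lborel)"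
        using c True elim by (intro nn_integral_mono) (auto simp: indicator_def intro!: ennreal_leI)
      also have "\<dots> = ennreal c * emeasure lborel U" by (simp add: nn_integral_cmult)
      finally show ?thesis using True by simp
    qed simp
  qed
  also have "\<dots> = emeasure \<mu> U * (ennreal c * emeasure lborel U)"
    by (simp add: nn_integral_multc)
  finally show ?thesis .
qed

end

text \<open>
  The order of the time integral of the dependence coefficient of a set of volume \<open>h ^ d\<close>.
\<close>

definition variance_scale :: "nat \<Rightarrow> real \<Rightarrow> real" where
  "variance_scale d h = h ^ (2 * d) * (psi d (h ^ d))\<^sup>2"

context stationary_density_process
begin

definition dependence_budget :: "real set \<Rightarrow> 'a set \<Rightarrow> real \<Rightarrow> bool" where
  "dependence_budget A U G \<longleftrightarrow> (\<exists>\<gamma>\<in>borel_measurable borel. (\<forall>s\<in>A. dependence s U \<le> \<gamma> s) \<and>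
     (\<integral>\<^sup>+s. indicator A s * \<gamma> s \<partial>lborel) \<le> ennreal G)"

lemma dependence_budgetI:
  assumes "\<gamma> \<in> borel_measurable borel" "\<And>s. s \<in> A \<Longrightarrow> dependence s U \<le> \<gamma> s"
    "(\<integral>\<^sup>+s. indicator A s * \<gamma> s \<partial>lborel) \<le> ennreal G"
  shows "dependence_budget A U G"
  using assms unfolding dependence_budget_def by blast

lemma emeasure_\<mu>_le_volume:
  assumes "R \<ge> 0" "\<And>x y. p 1 x y \<le> R" "U \<in> sets borel" "V \<ge> 0" "emeasure lborel U \<le> ennreal V"
  shows "emeasure \<mu> U \<le> ennreal (R * V)"
proof -
  have "emeasure \<mu> U \<le> ennreal R * emeasure lborel U" by (rule emeasure_\<mu>_le[OF assms(2,3)])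
  also have "\<dots> \<le> ennreal R * ennreal V" by (intro mult_left_mono assms) simp
  finally show ?thesis using assms(1,4) by (simp add: ennreal_mult)
qed

text \<open>
  For \<open>d \<ge> 2\<close> the time \<open>h\<^sup>2\<close> separates, up to constants, the range where the bound \<open>2 * \<mu> U\<close> is better from the range
  where the bound \<open>s powr (- d / 2)\<close> on the density is better. For \<open>d = 1\<close> the density bound is
  integrable and serves on the whole interval.
\<close>

lemma short_time_dependence:
  assumes short: "short_time_bound p"
  obtains C R where "C \<ge> 0" "R \<ge> 0" "\<And>x y. p 1 x y \<le> R"
    "\<And>h U. 0 < h \<Longrightarrow> h < 1 \<Longrightarrow> U \<in> sets borel \<Longrightarrow> emeasure lborel U \<le> ennreal (2 * h ^ DIM('a)) \<Longrightarrow>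
      dependence_budget {0<..1} U (C * variance_scale DIM('a) h)"
proof (cases "DIM('a) = 1")
  case True
  then obtain \<alpha> where \<alpha>: "\<And>t. t \<in> {0<..1} \<Longrightarrow> 0 \<le> \<alpha> t" "\<And>t x y. t \<in> {0<..1} \<Longrightarrow> p t x y \<le> \<alpha> t"
      and int: "set_integrable lborel {0<..1} \<alpha>"
    using short unfolding short_time_bound_def by blast
  define R where "R = \<alpha> 1"
  define \<alpha>' where "\<alpha>' s = indicator {0<..1} s * \<alpha> s" for s :: real
  have \<alpha>'i: "integrable lborel \<alpha>'"
    using int by (simp add: set_integrable_def \<alpha>'_def[abs_def])
  then have \<alpha>'m[measurable]: "\<alpha>' \<in> borel_measurable borel" by auto
  have \<alpha>'0: "0 \<le> \<alpha>' s" for s using \<alpha>(1)[of s] by (simp add: \<alpha>'_def indicator_def)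
  define A where "A = (\<integral>s. \<alpha>' s \<partial>lborel)"
  have A: "A \<ge> 0" unfolding A_def by (intro integral_nonneg_AE AE_I2 \<alpha>'0)
  have R: "R \<ge> 0" "\<And>x y. p 1 x y \<le> R" using \<alpha>[of 1] by (auto simp: R_def)
  show thesis
  proof (rule that[of "4 * R * (A + R)" R])
    fix h :: real and U :: "'a set"
    assume h: "0 < h" "h < 1" and U: "U \<in> sets borel" and vol: "emeasure lborel U \<le> ennreal (2 * h ^ DIM('a))"
    define V where "V = 2 * h ^ DIM('a)"
    have V: "V \<ge> 0" using h by (simp add: V_def)
    have vol: "emeasure lborel U \<le> ennreal V" using vol by (simp add: V_def)
    have mU: "emeasure \<mu> U \<le> ennreal (R * V)" by (rule emeasure_\<mu>_le_volume[OF R(1) R(2) U V vol])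
    show "dependence_budget {0<..1} U (4 * R * (A + R) * variance_scale DIM('a) h)"
    proof (rule dependence_budgetI[where \<gamma>="\<lambda>s. ennreal (R * V * (\<alpha>' s * V + R * V))"])
      fix s :: real assume "s \<in> {0<..1}"
      then have s: "0 < s" "s \<le> 1" by auto
      have "emeasure (transition X P s x) U \<le> ennreal (\<alpha>' s * V)" for x
      proof -
        have "emeasure (transition X P s x) U \<le> ennreal (\<alpha>' s) * emeasure lborel U"
          using s \<alpha>(2)[of s] by (intro transition_le_density_bound U) (auto simp: \<alpha>'_def)
        also have "\<dots> \<le> ennreal (\<alpha>' s) * ennreal V" by (intro mult_left_mono vol) simp
        finally show ?thesis using \<alpha>'0[of s] V by (simp add: ennreal_mult)
      qed
      then have "dependence s U \<le> emeasure \<mu> U * (ennreal (\<alpha>' s * V) + emeasure \<mu> U)"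
        using s by (intro dependence_le_bounded_transition U) auto
      also have "\<dots> \<le> ennreal (R * V) * (ennreal (\<alpha>' s * V) + ennreal (R * V))"
        using mU by (intro mult_mono add_mono) auto
      also have "\<dots> = ennreal (R * V * (\<alpha>' s * V + R * V))"
        using R V \<alpha>'0 by (simp add: ennreal_mult ennreal_plus)
      finally show "dependence s U \<le> ennreal (R * V * (\<alpha>' s * V + R * V))" .
    next
      have "(\<integral>\<^sup>+s. indicator {0<..1} s * ennreal (R * V * (\<alpha>' s * V + R * V)) \<partial>lborel)
          = (\<integral>\<^sup>+s. ennreal (R * V * V * (\<alpha>' s + R * indicator {0<..1} s)) \<partial>lborel)"
        by (intro nn_integral_cong) (auto simp: indicator_def \<alpha>'_def algebra_simps)
      also have "\<dots> = ennreal (\<integral>s. R * V * V * (\<alpha>' s + R * indicator {0<..1} s) \<partial>lborel)"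
        using R V \<alpha>'0 \<alpha>'i
        by (intro nn_integral_eq_integral integrable_mult_right Bochner_Integration.integrable_add
            integrable_real_indicator AE_I2 mult_nonneg_nonneg add_nonneg_nonneg) auto
      also have "(\<integral>s. R * V * V * (\<alpha>' s + R * indicator {0<..1} s) \<partial>lborel) = R * V * V * (A + R)"
        using \<alpha>'i by (simp add: A_def)
      also have "\<dots> = 4 * R * (A + R) * variance_scale DIM('a) h"
        using True by (simp add: V_def psi_def variance_scale_def power2_eq_square)
      finally show "(\<integral>\<^sup>+s. indicator {0<..1} s * ennreal (R * V * (\<alpha>' s * V + R * V)) \<partial>lborel)
          \<le> ennreal (4 * R * (A + R) * variance_scale DIM('a) h)" by simp
    qed measurable
  qed (use R A in auto)
next
  case False
  then have d: "DIM('a) \<ge> 2" using DIM_positive[where 'a='a] by linarith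
  then obtain c where c: "c > 0" "\<And>t x y. t \<in> {0<..1} \<Longrightarrow> p t x y \<le> c * t powr (- real DIM('a) / 2)"
    using short unfolding short_time_bound_def by blast
  have R: "p 1 x y \<le> c" for x y using c(2)[of 1] by simp
  show thesis
  proof (rule that[of "4 * c + 8 * c * c + 4 * c * c" c])
    fix h :: real and U :: "'a set"
    assume h: "0 < h" "h < 1" and U: "U \<in> sets borel" and vol: "emeasure lborel U \<le> ennreal (2 * h ^ DIM('a))"
    define V where "V = 2 * h ^ DIM('a)"
    define \<psi> where "\<psi> = (psi DIM('a) (h ^ DIM('a)))\<^sup>2"
    have \<psi>: "1 \<le> \<psi>" "h ^ DIM('a) * h\<^sup>2 \<le> h ^ (2 * DIM('a)) * \<psi>"
      using psi_squared_bounds[OF h, of "DIM('a)"] d by (auto simp: \<psi>_def)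
    have V: "V \<ge> 0" using h by (simp add: V_def)
    have vol: "emeasure lborel U \<le> ennreal V" using vol by (simp add: V_def)
    have mU: "emeasure \<mu> U \<le> ennreal (c * V)" by (rule emeasure_\<mu>_le_volume[OF less_imp_le[OF c(1)] R U V vol])
    let ?q = "\<lambda>s::real. s powr (- real DIM('a) / 2)"
    let ?\<gamma> = "\<lambda>s. ennreal (2 * c * V) * indicator {0..h\<^sup>2} s
        + (ennreal (c * c * V * V) * (ennreal (?q s) * indicator {h\<^sup>2..1} s) + ennreal (c * c * V * V) * indicator {0..1} s)"
    show "dependence_budget {0<..1} U ((4 * c + 8 * c * c + 4 * c * c) * variance_scale DIM('a) h)"
    proof (rule dependence_budgetI[where \<gamma>="?\<gamma>"])
      fix s :: real assume "s \<in> {0<..1}"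
      then have s: "0 < s" "s \<le> 1" by auto
      show "dependence s U \<le> ?\<gamma> s"
      proof (cases "s \<le> h\<^sup>2")
        case True
        have "dependence s U \<le> emeasure \<mu> U * (1 + emeasure \<mu> U)"
          using s prob_space.emeasure_le_1[OF prob_space_transition]
          by (intro dependence_le_bounded_transition U) auto
        also have "\<dots> \<le> ennreal (c * V) * (1 + 1)"
          using mU \<mu>.emeasure_le_1 by (intro mult_mono add_mono) auto
        also have "\<dots> = ennreal (c * V) + ennreal (c * V)" by (simp only: distrib_left mult_1_right)
        also have "\<dots> = ennreal (2 * c * V)" using c V by (simp flip: ennreal_plus)
        also have "\<dots> \<le> ?\<gamma> s" using s True by simp
        finally show ?thesis .
      next
        case False
        have "emeasure (transition X P s x) U \<le> ennreal (c * ?q s * V)" for x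
        proof -
          have "emeasure (transition X P s x) U \<le> ennreal (c * ?q s) * emeasure lborel U"
            using s c(2)[of s] by (intro transition_le_density_bound U) auto
          also have "\<dots> \<le> ennreal (c * ?q s) * ennreal V" by (intro mult_left_mono vol) simp
          finally show ?thesis using c(1) V by (simp add: ennreal_mult)
        qed
        then have "dependence s U \<le> emeasure \<mu> U * (ennreal (c * ?q s * V) + emeasure \<mu> U)"
          using s by (intro dependence_le_bounded_transition U) auto
        also have "\<dots> \<le> ennreal (c * V) * (ennreal (c * ?q s * V) + ennreal (c * V))"
          using mU by (intro mult_mono add_mono) auto
        also have "\<dots> = ennreal (c * c * V * V * ?q s + c * c * V * V)"
          using c V by (simp add: algebra_simps flip: ennreal_mult ennreal_plus)
        also have "\<dots> = ?\<gamma> s" using s False c V by (simp add: ennreal_mult ennreal_plus)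
        finally show ?thesis .
      qed
    next
      have "(\<integral>\<^sup>+s. indicator {0<..1} s * ?\<gamma> s \<partial>lborel) \<le> (\<integral>\<^sup>+s. ?\<gamma> s \<partial>lborel)"
        by (intro nn_integral_mono) (simp add: indicator_def)
      also have "\<dots> = ennreal (2 * c * V) * emeasure lborel {0..h\<^sup>2}
          + (ennreal (c * c * V * V) * (\<integral>\<^sup>+s. ennreal (?q s) * indicator {h\<^sup>2..1} s \<partial>lborel)
          + ennreal (c * c * V * V) * emeasure lborel {0..1::real})"
        by (simp add: nn_integral_add nn_integral_cmult nn_integral_cmult_indicator)
      also have "\<dots> \<le> ennreal (2 * c * V) * ennreal (h\<^sup>2) + (ennreal (c * c * V * V) * ennreal (2 * \<psi>) + ennreal (c * c * V * V) * ennreal 1)"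
        unfolding \<psi>_def using nn_integral_heat_kernel_singularity[OF h d]
        by (intro add_mono mult_left_mono) auto
      also have "\<dots> = ennreal (2 * c * V * h\<^sup>2 + (c * c * V * V * (2 * \<psi>) + c * c * V * V))"
        using c V h \<psi> by (simp add: ennreal_mult ennreal_plus)
      also have "\<dots> \<le> ennreal ((4 * c + 8 * c * c + 4 * c * c) * (h ^ (2 * DIM('a)) * \<psi>))"
      proof (rule ennreal_leI)
        have VV: "V * V = 4 * h ^ (2 * DIM('a))" by (simp add: V_def power_even_eq power2_eq_square)
        have "2 * c * V * h\<^sup>2 = 4 * c * (h ^ DIM('a) * h\<^sup>2)" by (simp add: V_def)
        also have "\<dots> \<le> 4 * c * (h ^ (2 * DIM('a)) * \<psi>)" using c \<psi> by (intro mult_left_mono) auto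
        finally have 1: "2 * c * V * h\<^sup>2 \<le> 4 * c * (h ^ (2 * DIM('a)) * \<psi>)" .
        have 2: "c * c * V * V * (2 * \<psi>) = 8 * c * c * (h ^ (2 * DIM('a)) * \<psi>)"
          using VV by (simp add: mult.assoc)
        have "c * c * V * V = 4 * c * c * (h ^ (2 * DIM('a)) * 1)"
          using VV by (simp add: mult.assoc)
        also have "\<dots> \<le> 4 * c * c * (h ^ (2 * DIM('a)) * \<psi>)"
          using c h \<psi> by (intro mult_left_mono) auto
        finally have 3: "c * c * V * V \<le> 4 * c * c * (h ^ (2 * DIM('a)) * \<psi>)" .
        show "2 * c * V * h\<^sup>2 + (c * c * V * V * (2 * \<psi>) + c * c * V * V)
            \<le> (4 * c + 8 * c * c + 4 * c * c) * (h ^ (2 * DIM('a)) * \<psi>)"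
          using 1 2 3 by (simp only: distrib_right)
      qed
      finally show "(\<integral>\<^sup>+s. indicator {0<..1} s * ?\<gamma> s \<partial>lborel)
          \<le> ennreal ((4 * c + 8 * c * c + 4 * c * c) * variance_scale DIM('a) h)"
        by (simp add: \<psi>_def variance_scale_def)
    qed measurable
  qed (use R c in auto)
qed

lemma long_time_dependence_local:
  assumes luc: "local_uniform_convergence \<mu> p \<rho>" and S: "compact S"
    and R: "R \<ge> 0" "\<And>x y. p 1 x y \<le> R"
  obtains C where "C \<ge> 0"
    "\<And>h U. 0 < h \<Longrightarrow> h < 1 \<Longrightarrow> U \<in> sets borel \<Longrightarrow> U \<subseteq> S \<Longrightarrow> emeasure lborel U \<le> ennreal (2 * h ^ DIM('a)) \<Longrightarrow>
      dependence_budget {1<..} U (C * variance_scale DIM('a) h)"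
proof -
  obtain \<Lambda> r where \<Lambda>: "\<Lambda> \<in> sets borel" "emeasure \<mu> \<Lambda> = 1"
    and r: "\<forall>S. compact S \<longrightarrow>
           set_borel_measurable borel {0<..} (r S) \<and> (\<forall>t>0. 0 \<le> r S t) \<and>
           (\<forall>t>1. \<forall>x\<in>S \<inter> \<Lambda>. \<forall>y\<in>S. \<bar>p t x y - \<rho> y\<bar> \<le> r S t) \<and>
           set_integrable lborel {1<..} (r S)"
    using luc unfolding local_uniform_convergence_def by (elim bexE exE conjE)
  from mp[OF spec[OF r] S] have r0: "\<And>t. t > 0 \<Longrightarrow> 0 \<le> r S t"
    and r1: "\<And>t x y. t > 1 \<Longrightarrow> x \<in> S \<inter> \<Lambda> \<Longrightarrow> y \<in> S \<Longrightarrow> \<bar>p t x y - \<rho> y\<bar> \<le> r S t"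
    and ri: "set_integrable lborel {1<..} (r S)" by auto
  define r' where "r' s = indicator {1<..} s * r S s" for s :: real
  have r'i: "integrable lborel r'"
    using ri by (simp add: set_integrable_def r'_def[abs_def])
  then have r'm[measurable]: "r' \<in> borel_measurable borel" by auto
  have r'0: "0 \<le> r' s" for s using r0[of s] by (simp add: r'_def indicator_def)
  define A where "A = (\<integral>s. r' s \<partial>lborel)"
  have A: "A \<ge> 0" unfolding A_def by (intro integral_nonneg_AE AE_I2 r'0)
  show thesis
  proof (rule that[of "4 * R * A"])
    fix h :: real and U :: "'a set"
    assume h: "0 < h" "h < 1" and U: "U \<in> sets borel" "U \<subseteq> S" and vol: "emeasure lborel U \<le> ennreal (2 * h ^ DIM('a))"
    define V where "V = 2 * h ^ DIM('a)"
    define \<psi> where "\<psi> = (psi DIM('a) (h ^ DIM('a)))\<^sup>2"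
    have \<psi>: "1 \<le> \<psi>"
      using psi_squared_bounds(1)[OF h, of "DIM('a)"] DIM_positive[where 'a='a] unfolding \<psi>_def by linarith
    have V: "V \<ge> 0" using h by (simp add: V_def)
    have vol: "emeasure lborel U \<le> ennreal V" using vol by (simp add: V_def)
    have mU: "emeasure \<mu> U \<le> ennreal (R * V)" by (rule emeasure_\<mu>_le_volume[OF R(1) R(2) U(1) V vol])
    show "dependence_budget {1<..} U (4 * R * A * variance_scale DIM('a) h)"
    proof (rule dependence_budgetI[where \<gamma>="\<lambda>s. ennreal (R * V * V * r' s)"])
      fix s :: real assume "s \<in> {1<..}"
      then have s: "s > 1" by simp
      have "dependence s U \<le> emeasure \<mu> U * (ennreal (r' s) * emeasure lborel U)"
        using s U r1[OF s] by (intro dependence_le_uniform[OF _ U(1) \<Lambda>]) (auto simp: r'_def)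
      also have "\<dots> \<le> ennreal (R * V) * (ennreal (r' s) * ennreal V)"
        using mU vol by (intro mult_mono) auto
      also have "\<dots> = ennreal (R * V * V * r' s)"
        using R V r'0 by (simp add: mult_ac flip: ennreal_mult)
      finally show "dependence s U \<le> ennreal (R * V * V * r' s)" .
    next
      have "(\<integral>\<^sup>+s. indicator {1<..} s * ennreal (R * V * V * r' s) \<partial>lborel)
          \<le> (\<integral>\<^sup>+s. ennreal (R * V * V * r' s) \<partial>lborel)"
        by (intro nn_integral_mono) (simp add: indicator_def)
      also have "\<dots> = ennreal (\<integral>s. R * V * V * r' s \<partial>lborel)"
        using R V r'0 r'i by (intro nn_integral_eq_integral integrable_mult_right) auto
      also have "(\<integral>s. R * V * V * r' s \<partial>lborel) = R * A * (V * V)"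
        by (simp add: A_def)
      also have "\<dots> = 4 * R * A * (h ^ (2 * DIM('a)) * 1)"
        by (simp add: V_def power_even_eq power2_eq_square)
      also have "ennreal \<dots> \<le> ennreal (4 * R * A * (h ^ (2 * DIM('a)) * \<psi>))"
        using R A h \<psi> by (intro ennreal_leI mult_left_mono) auto
      finally show "(\<integral>\<^sup>+s. indicator {1<..} s * ennreal (R * V * V * r' s) \<partial>lborel)
          \<le> ennreal (4 * R * A * variance_scale DIM('a) h)"
        by (simp add: \<psi>_def variance_scale_def)
    qed measurable
  qed (use R A in auto)
qed

text \<open>
  Up to a time of order \<open>ln (1 / h)\<close> the density bound is used, after that the mixing rate is at
  most a constant times \<open>h ^ (2 * d)\<close>. The loss of \<open>ln (1 / h)\<close> is absorbed by \<open>psi\<close> only for \<open>d \<ge> 2\<close>, see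
  \<open>psi_squared_bounds\<close>.
\<close>

lemma long_time_dependence_exponential:
  assumes mix: "beta_mixing X P \<mu> \<Xi>" "exponential_rate \<Xi>" and d: "DIM('a) \<ge> 2"
    and R: "R \<ge> 0" "\<And>x y. p 1 x y \<le> R"
  obtains C where "C \<ge> 0"
    "\<And>h U. 0 < h \<Longrightarrow> h < 1 \<Longrightarrow> U \<in> sets borel \<Longrightarrow> emeasure lborel U \<le> ennreal (2 * h ^ DIM('a)) \<Longrightarrow>
      dependence_budget {1<..} U (C * variance_scale DIM('a) h)"
proof -
  obtain c \<kappa> where c: "c > 0" "\<kappa> > 0" and \<Xi>: "\<Xi> = (\<lambda>t. c * exp (- \<kappa> * t))"
    using mix(2) by (auto simp: exponential_rate_def)
  show thesis
  proof (rule that[of "8 * R * R * (2 * real DIM('a) / \<kappa>) + c / \<kappa>"])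
    fix h :: real and U :: "'a set"
    assume h: "0 < h" "h < 1" and U: "U \<in> sets borel" and vol: "emeasure lborel U \<le> ennreal (2 * h ^ DIM('a))"
    define V where "V = 2 * h ^ DIM('a)"
    define \<psi> where "\<psi> = (psi DIM('a) (h ^ DIM('a)))\<^sup>2"
    have \<psi>: "1 \<le> \<psi>" "ln (1 / h) \<le> \<psi>"
      using psi_squared_bounds(1,2)[OF h, of "DIM('a)"] d unfolding \<psi>_def by auto
    have V: "V \<ge> 0" using h by (simp add: V_def)
    have vol: "emeasure lborel U \<le> ennreal V" using vol by (simp add: V_def)
    have mU: "emeasure \<mu> U \<le> ennreal (R * V)" by (rule emeasure_\<mu>_le_volume[OF R(1) R(2) U(1) V vol])
    \<comment> \<open>the time after which the mixing rate has decayed by the factor \<open>h ^ (2 * d)\<close>\<close>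
    define s1 where "s1 = 2 * real DIM('a) * ln (1 / h) / \<kappa>"
    have s1: "s1 \<ge> 0" using h c by (simp add: s1_def)
    have "exp (- \<kappa> * s1) = exp (real (2 * DIM('a)) * ln h)"
      using c h by (simp add: s1_def ln_div)
    also have "\<dots> = h ^ (2 * DIM('a))"
      using h by (subst exp_of_nat_mult) simp
    finally have es1: "exp (- \<kappa> * s1) = h ^ (2 * DIM('a))" .
    let ?\<gamma> = "\<lambda>s. ennreal (2 * R * R * V * V) * indicator {0..s1} s + ennreal (c * exp (- \<kappa> * s)) * indicator {s1..} s"
    show "dependence_budget {1<..} U ((8 * R * R * (2 * real DIM('a) / \<kappa>) + c / \<kappa>) * variance_scale DIM('a) h)"
    proof (rule dependence_budgetI[where \<gamma>="?\<gamma>"])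
      fix s :: real assume "s \<in> {1<..}"
      then have s: "s > 1" by simp
      show "dependence s U \<le> ?\<gamma> s"
      proof (cases "s \<le> s1")
        case True
        have "dependence s U \<le> emeasure \<mu> U * (ennreal R * emeasure lborel U + emeasure \<mu> U)"
          by (rule dependence_le_after_time_1[OF s U R(2)])
        also have "\<dots> \<le> ennreal (R * V) * (ennreal R * ennreal V + ennreal (R * V))"
          using mU vol by (intro mult_mono add_mono) auto
        also have "\<dots> = ennreal (2 * R * R * V * V)"
          using R V by (simp add: algebra_simps flip: ennreal_mult ennreal_plus)
        also have "\<dots> \<le> ?\<gamma> s" using s True by simp
        finally show ?thesis .
      next
        case False
        have "dependence s U \<le> ennreal (\<Xi> s)" using s by (intro dependence_le_mixing[OF mix(1)]) simp
        also have "\<dots> = ?\<gamma> s" using False by (simp add: \<Xi>)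
        finally show ?thesis .
      qed
    next
      have tail: "(\<integral>\<^sup>+s. ennreal (c * exp (- \<kappa> * s)) * indicator {s1..} s \<partial>lborel)
          = ennreal (0 - (- c / \<kappa> * exp (- \<kappa> * s1)))"
      proof (rule nn_integral_FTC_atLeast)
        show "DERIV (\<lambda>s. - c / \<kappa> * exp (- \<kappa> * s)) s :> c * exp (- \<kappa> * s)" for s
          using c by (auto intro!: derivative_eq_intros)
        have "((\<lambda>s. - c / \<kappa> * exp (- (\<kappa> * s))) \<longlongrightarrow> - c / \<kappa> * 0) at_top"
          using c by (intro tendsto_mult tendsto_const filterlim_compose[OF exp_at_bot]
              filterlim_compose[OF filterlim_uminus_at_bot_at_top] filterlim_tendsto_pos_mult_at_top[OF tendsto_const _ filterlim_ident])
        then show "((\<lambda>s. - c / \<kappa> * exp (- \<kappa> * s)) \<longlongrightarrow> 0) at_top" by simp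
      qed (use c in auto)
      have "(\<integral>\<^sup>+s. indicator {1<..} s * ?\<gamma> s \<partial>lborel) \<le> (\<integral>\<^sup>+s. ?\<gamma> s \<partial>lborel)"
        by (intro nn_integral_mono) (simp add: indicator_def)
      also have "\<dots> = ennreal (2 * R * R * V * V) * emeasure lborel {0..s1}
          + (\<integral>\<^sup>+s. ennreal (c * exp (- \<kappa> * s)) * indicator {s1..} s \<partial>lborel)"
        by (simp add: nn_integral_add nn_integral_cmult nn_integral_cmult_indicator)
      also have "\<dots> = ennreal (2 * R * R * V * V * s1 + c / \<kappa> * h ^ (2 * DIM('a)))"
        unfolding tail es1 using R V c h s1 by (simp add: ennreal_mult ennreal_plus)
      also have "\<dots> \<le> ennreal ((8 * R * R * (2 * real DIM('a) / \<kappa>) + c / \<kappa>) * (h ^ (2 * DIM('a)) * \<psi>))"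
      proof (rule ennreal_leI)
        have VV: "V * V = 4 * h ^ (2 * DIM('a))" by (simp add: V_def power_even_eq power2_eq_square)
        have "2 * R * R * V * V * s1 = 2 * R * R * (V * V) * s1" by simp
        also have "\<dots> = 8 * R * R * (2 * real DIM('a) / \<kappa>) * (h ^ (2 * DIM('a)) * ln (1 / h))"
          unfolding VV by (simp add: s1_def)
        also have "\<dots> \<le> 8 * R * R * (2 * real DIM('a) / \<kappa>) * (h ^ (2 * DIM('a)) * \<psi>)"
          using R c h \<psi> by (intro mult_left_mono) auto
        finally have 1: "2 * R * R * V * V * s1 \<le> 8 * R * R * (2 * real DIM('a) / \<kappa>) * (h ^ (2 * DIM('a)) * \<psi>)" .
        have "c / \<kappa> * (h ^ (2 * DIM('a)) * 1) \<le> c / \<kappa> * (h ^ (2 * DIM('a)) * \<psi>)"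
          using c h \<psi> by (intro mult_left_mono) auto
        then show "2 * R * R * V * V * s1 + c / \<kappa> * h ^ (2 * DIM('a))
            \<le> (8 * R * R * (2 * real DIM('a) / \<kappa>) + c / \<kappa>) * (h ^ (2 * DIM('a)) * \<psi>)"
          using 1 by (simp only: distrib_right mult_1_right)
      qed
      finally show "(\<integral>\<^sup>+s. indicator {1<..} s * ?\<gamma> s \<partial>lborel)
          \<le> ennreal ((8 * R * R * (2 * real DIM('a) / \<kappa>) + c / \<kappa>) * variance_scale DIM('a) h)"
        by (simp add: \<psi>_def variance_scale_def)
    qed measurable
  qed (use R c in auto)
qed

text \<open>
  The constant is uniform in the bandwidth, in the set \<open>U\<close> and in the function, because only the volume
  of \<open>U\<close> and the compact set \<open>S\<close> enter the bounds on the dependence.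
\<close>

lemma block_variance:
  assumes short: "short_time_bound p" and S: "compact S"
    and long: "local_uniform_convergence \<mu> p \<rho> \<or> (DIM('a) \<ge> 2 \<and> exponentially_beta_mixing X P \<mu>)"
  obtains C where "C > 0"
    "\<And>h U f B r a. 0 < h \<Longrightarrow> h < 1 \<Longrightarrow> U \<in> sets borel \<Longrightarrow> U \<subseteq> S \<Longrightarrow> emeasure lborel U \<le> ennreal (2 * h ^ DIM('a)) \<Longrightarrow>
      continuous_on UNIV f \<Longrightarrow> (\<And>x. \<bar>f x\<bar> \<le> B) \<Longrightarrow> (\<And>x. x \<notin> U \<Longrightarrow> f x = 0) \<Longrightarrow> r \<ge> 0 \<Longrightarrow> a > 0 \<Longrightarrow>
      Q.expectation (\<lambda>\<omega>. (block (\<lambda>x. f x - \<mu>.expectation f) r a \<omega>)\<^sup>2)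
        \<le> C * a * (B\<^sup>2 * variance_scale DIM('a) h)"
proof -
  obtain C1 R where C1: "C1 \<ge> 0" and R: "R \<ge> 0" "\<And>x y. p 1 x y \<le> R"
    and s1: "\<And>h U. 0 < h \<Longrightarrow> h < 1 \<Longrightarrow> U \<in> sets borel \<Longrightarrow> emeasure lborel U \<le> ennreal (2 * h ^ DIM('a)) \<Longrightarrow>
      dependence_budget {0<..1} U (C1 * variance_scale DIM('a) h)"
    by (fact short_time_dependence[OF short])
  have "\<exists>C2\<ge>0. \<forall>h U. 0 < h \<longrightarrow> h < 1 \<longrightarrow> U \<in> sets borel \<longrightarrow> U \<subseteq> S \<longrightarrow>
      emeasure lborel U \<le> ennreal (2 * h ^ DIM('a)) \<longrightarrow> dependence_budget {1<..} U (C2 * variance_scale DIM('a) h)"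
    using long
  proof
    assume "local_uniform_convergence \<mu> p \<rho>"
    obtain C where C: "C \<ge> 0" "\<And>h U. 0 < h \<Longrightarrow> h < 1 \<Longrightarrow> U \<in> sets borel \<Longrightarrow> U \<subseteq> S \<Longrightarrow>
        emeasure lborel U \<le> ennreal (2 * h ^ DIM('a)) \<Longrightarrow> dependence_budget {1<..} U (C * variance_scale DIM('a) h)"
      by (fact long_time_dependence_local[OF \<open>local_uniform_convergence \<mu> p \<rho>\<close> S R])
    then show ?thesis by (intro exI[of _ C] conjI allI impI)
  next
    assume e: "DIM('a) \<ge> 2 \<and> exponentially_beta_mixing X P \<mu>"
    then obtain \<Xi> where \<Xi>: "beta_mixing X P \<mu> \<Xi>" "exponential_rate \<Xi>"
      by (auto simp: exponentially_beta_mixing_def)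
    obtain C where C: "C \<ge> 0" "\<And>h U. 0 < h \<Longrightarrow> h < 1 \<Longrightarrow> U \<in> sets borel \<Longrightarrow>
        emeasure lborel U \<le> ennreal (2 * h ^ DIM('a)) \<Longrightarrow> dependence_budget {1<..} U (C * variance_scale DIM('a) h)"
      by (fact long_time_dependence_exponential[OF \<Xi> conjunct1[OF e] R])
    then show ?thesis by (intro exI[of _ C] conjI allI impI)
  qed
  then obtain C2 where C2: "C2 \<ge> 0" and s2': "\<forall>h U. 0 < h \<longrightarrow> h < 1 \<longrightarrow> U \<in> sets borel \<longrightarrow> U \<subseteq> S \<longrightarrow>
      emeasure lborel U \<le> ennreal (2 * h ^ DIM('a)) \<longrightarrow> dependence_budget {1<..} U (C2 * variance_scale DIM('a) h)" by (elim exE conjE)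
  note s2 = s2'[rule_format]
  show thesis
  proof (rule that[of "2 * (C1 + C2) + 1"])
    show "2 * (C1 + C2) + 1 > 0" using C1 C2 by simp
    fix h U and f :: "'a \<Rightarrow> real" and B r a :: real
    assume h: "0 < h" "h < 1" and U: "U \<in> sets borel" "U \<subseteq> S" "emeasure lborel U \<le> ennreal (2 * h ^ DIM('a))"
      and f: "continuous_on UNIV f" "\<And>x. \<bar>f x\<bar> \<le> B" "\<And>x. x \<notin> U \<Longrightarrow> f x = 0" and r: "r \<ge> 0" and a: "a > 0"
    have fm[measurable]: "f \<in> borel_measurable borel" by (rule borel_measurable_continuous_onI[OF f(1)])
    define W where "W = variance_scale DIM('a) h"
    have W: "W \<ge> 0" using h by (simp add: W_def variance_scale_def)
    obtain \<gamma>1 where [measurable]: "\<gamma>1 \<in> borel_measurable borel"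
      and \<gamma>1: "\<And>s. 0 < s \<Longrightarrow> s \<le> 1 \<Longrightarrow> dependence s U \<le> \<gamma>1 s" "(\<integral>\<^sup>+s. indicator {0<..1} s * \<gamma>1 s \<partial>lborel) \<le> ennreal (C1 * W)"
      using s1[OF h U(1,3)] unfolding W_def dependence_budget_def by auto
    obtain \<gamma>2 where [measurable]: "\<gamma>2 \<in> borel_measurable borel"
      and \<gamma>2: "\<And>s. 1 < s \<Longrightarrow> dependence s U \<le> \<gamma>2 s" "(\<integral>\<^sup>+s. indicator {1<..} s * \<gamma>2 s \<partial>lborel) \<le> ennreal (C2 * W)"
      using s2[OF h U] unfolding W_def dependence_budget_def by auto
    define m where "m = \<mu>.expectation f"
    have "0 \<le> B" using f(2)[of undefined] by linarith
    then have "\<bar>m\<bar> \<le> \<mu>.expectation (\<lambda>_. B)"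
      unfolding m_def real_norm_def[symmetric] using f(2)
      by (intro Bochner_Integration.integral_norm_bound_integral \<mu>.integrable_const_bound[where B=B]) auto
    then have m: "\<bar>m\<bar> \<le> B" using \<mu>.prob_space by simp
    let ?\<gamma> = "\<lambda>s. ennreal (B\<^sup>2) * (indicator {0<..1} s * \<gamma>1 s + indicator {1<..} s * \<gamma>2 s)"
    have "Q.expectation (\<lambda>\<omega>. (block (\<lambda>x. f x - m) r a \<omega>)\<^sup>2) \<le> 2 * a * (B\<^sup>2 * (C1 * W + C2 * W))"
    proof (rule block_second_moment[where B="2 * B" and \<gamma>="?\<gamma>"])
      show "continuous_on UNIV (\<lambda>x. f x - m)" using f(1) by (intro continuous_intros)
      show "\<bar>f x - m\<bar> \<le> 2 * B" for x using f(2)[of x] m by linarith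
      show "ennreal \<bar>Q.expectation (\<lambda>\<omega>. (f (X t \<omega>) - m) * (f (X (t + s) \<omega>) - m))\<bar> \<le> ?\<gamma> s"
        if t: "t \<ge> 0" and s: "s > 0" for t s
      proof -
        have "ennreal \<bar>Q.expectation (\<lambda>\<omega>. (f (X t \<omega>) - m) * (f (X (t + s) \<omega>) - m))\<bar> \<le> ennreal (B\<^sup>2) * dependence s U"
          unfolding m_def by (rule covariance_le_dependence[OF t s fm f(2) U(1) f(3)])
        also have "dependence s U \<le> indicator {0<..1} s * \<gamma>1 s + indicator {1<..} s * \<gamma>2 s"
          using \<gamma>1(1)[of s] \<gamma>2(1)[of s] s by (cases "s \<le> 1") auto
        finally show ?thesis by (simp add: mult_left_mono)
      qed
      have "(\<integral>\<^sup>+s. indicator {0<..} s * ?\<gamma> s \<partial>lborel)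
          \<le> (\<integral>\<^sup>+s. ?\<gamma> s \<partial>lborel)" by (intro nn_integral_mono) (simp add: indicator_def)
      also have "\<dots> = ennreal (B\<^sup>2) * ((\<integral>\<^sup>+s. indicator {0<..1} s * \<gamma>1 s \<partial>lborel) + (\<integral>\<^sup>+s. indicator {1<..} s * \<gamma>2 s \<partial>lborel))"
        by (simp add: nn_integral_cmult nn_integral_add)
      also have "\<dots> \<le> ennreal (B\<^sup>2) * (ennreal (C1 * W) + ennreal (C2 * W))"
        by (intro mult_left_mono add_mono \<gamma>1 \<gamma>2) simp
      also have "\<dots> = ennreal (B\<^sup>2 * (C1 * W + C2 * W))"
        using C1 C2 W by (simp add: ennreal_mult ennreal_plus)
      finally show "(\<integral>\<^sup>+s. indicator {0<..} s * ?\<gamma> s \<partial>lborel) \<le> ennreal (B\<^sup>2 * (C1 * W + C2 * W))" .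
      show "0 \<le> B\<^sup>2 * (C1 * W + C2 * W)" using C1 C2 W by simp
    qed (use r a in measurable)
    also have "\<dots> \<le> (2 * (C1 + C2) + 1) * a * (B\<^sup>2 * W)"
      using a W by (simp add: algebra_simps)
    finally show "Q.expectation (\<lambda>\<omega>. (block (\<lambda>x. f x - \<mu>.expectation f) r a \<omega>)\<^sup>2)
        \<le> (2 * (C1 + C2) + 1) * a * (B\<^sup>2 * variance_scale DIM('a) h)"
      by (simp add: m_def W_def)
  qed
qed

end

section \<open>Dyadic grids and the kernel\<close>

definition grid_point :: "real \<Rightarrow> nat \<Rightarrow> real ^ 'd \<Rightarrow> real ^ 'd" where
  "grid_point h j x = (\<chi> i. h / 2 ^ j * of_int \<lfloor>x $ i * 2 ^ j / h\<rfloor>)"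

lemma grid_point_close:
  fixes x :: "real ^ 'd"
  assumes h: "h > 0"
  shows "norm (x - grid_point h j x) \<le> CARD('d) * (h / 2 ^ j)"
proof -
  define e where "e = h / 2 ^ j"
  have e: "e > 0" using h by (simp add: e_def)
  have c: "\<bar>(x - grid_point h j x) $ i\<bar> \<le> e" for i
  proof -
    have "(x - grid_point h j x) $ i = e * (x $ i / e - of_int \<lfloor>x $ i / e\<rfloor>)"
      using e h by (simp add: grid_point_def e_def right_diff_distrib)
    moreover have "0 \<le> x $ i / e - of_int \<lfloor>x $ i / e\<rfloor>" "x $ i / e - of_int \<lfloor>x $ i / e\<rfloor> \<le> 1" by linarith+
    then have "0 \<le> e * (x $ i / e - of_int \<lfloor>x $ i / e\<rfloor>)" "e * (x $ i / e - of_int \<lfloor>x $ i / e\<rfloor>) \<le> e * 1"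
      using e by (auto intro!: mult_left_mono mult_nonneg_nonneg simp del: mult_1_right)
    ultimately show ?thesis by simp
  qed
  have "norm (x - grid_point h j x) \<le> (\<Sum>i\<in>UNIV. \<bar>(x - grid_point h j x) $ i\<bar>)"
    by (rule norm_le_l1_cart)
  also have "\<dots> \<le> (\<Sum>i\<in>(UNIV :: 'd set). e)" by (intro sum_mono c)
  finally show ?thesis by (simp add: e_def)
qed

lemma card_grid_points:
  fixes D :: "(real ^ 'd) set"
  assumes h: "0 < h" "h \<le> 1" and R: "R \<ge> 0" "\<And>x. x \<in> D \<Longrightarrow> norm x \<le> R"
  shows "finite (grid_point h j ` D)"
    and "real (card (grid_point h j ` D)) \<le> ((2 * R + 3) * 2 ^ j / h) ^ CARD('d)"
proof -
  define Y where "Y = R * 2 ^ j / h"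
  have Y: "Y \<ge> 0" using R h by (simp add: Y_def)
  define V where "V = PiE (UNIV :: 'd set) (\<lambda>_. {-\<lceil>Y\<rceil>..\<lceil>Y\<rceil>})"
  define F :: "('d \<Rightarrow> int) \<Rightarrow> real ^ 'd" where "F v = (\<chi> i. h / 2 ^ j * of_int (v i))" for v
  have V: "finite V" unfolding V_def by (intro finite_PiE) auto
  have sub: "grid_point h j ` D \<subseteq> F ` V"
  proof
    fix y assume "y \<in> grid_point h j ` D"
    then obtain x where x: "x \<in> D" "y = grid_point h j x" by auto
    define v where "v = (\<lambda>i. \<lfloor>x $ i * 2 ^ j / h\<rfloor>)"
    have "v \<in> V"
    proof -
      have "v i \<in> {-\<lceil>Y\<rceil>..\<lceil>Y\<rceil>}" for i
      proof -
        have "\<bar>x $ i\<bar> \<le> R" using component_le_norm_cart[of x i] R(2)[OF x(1)] by linarith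
        then have "\<bar>x $ i\<bar> * (2 ^ j / h) \<le> R * (2 ^ j / h)" using h by (intro mult_right_mono) auto
        then have "\<bar>x $ i * 2 ^ j / h\<bar> \<le> Y" using h by (simp add: Y_def abs_mult)
        then have "- Y \<le> x $ i * 2 ^ j / h" "x $ i * 2 ^ j / h \<le> Y" by linarith+
        then show ?thesis by (simp add: v_def) linarith
      qed
      then show ?thesis by (auto simp: V_def)
    qed
    moreover have "y = F v" by (simp add: x F_def v_def grid_point_def)
    ultimately show "y \<in> F ` V" by auto
  qed
  then show "finite (grid_point h j ` D)" using finite_imageI[OF V] by (rule finite_subset)
  have "card (grid_point h j ` D) \<le> card V"
    using card_mono[OF finite_imageI[OF V] sub] card_image_le[OF V, of F] by linarith
  also have "card V = (nat (2 * \<lceil>Y\<rceil> + 1)) ^ CARD('d)"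
    unfolding V_def by (simp add: card_PiE algebra_simps)
  finally have "real (card (grid_point h j ` D)) \<le> real (nat (2 * \<lceil>Y\<rceil> + 1)) ^ CARD('d)"
    by (metis of_nat_le_iff of_nat_power)
  also have "\<dots> \<le> ((2 * R + 3) * 2 ^ j / h) ^ CARD('d)"
  proof (rule power_mono)
    have c0: "0 \<le> \<lceil>Y\<rceil>" using Y by simp
    have "1 * h \<le> 2 ^ j * 1" using h by (intro mult_mono) auto
    then have one: "1 \<le> 2 ^ j / h" using h by (simp add: field_simps)
    have "real (nat (2 * \<lceil>Y\<rceil> + 1)) = 2 * of_int \<lceil>Y\<rceil> + 1" using c0 by simp
    also have "\<dots> \<le> 2 * Y + 3" by linarith
    also have "\<dots> \<le> 2 * R * (2 ^ j / h) + 3 * (2 ^ j / h)" using one by (simp add: Y_def)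
    finally show "real (nat (2 * \<lceil>Y\<rceil> + 1)) \<le> (2 * R + 3) * 2 ^ j / h" by (simp add: algebra_simps add_divide_distrib)
  qed simp
  finally show "real (card (grid_point h j ` D)) \<le> ((2 * R + 3) * 2 ^ j / h) ^ CARD('d)" .
qed

text \<open>
  Telescoping along the grid points of \<open>x\<close>; the Lipschitz constant is used for the last step only.
\<close>

lemma chaining_bound:
  fixes G :: "real ^ 'd \<Rightarrow> real"
  assumes h: "h > 0" and lip: "\<And>x y. \<bar>G x - G y\<bar> \<le> \<Lambda> * norm (x - y)" and \<Lambda>: "\<Lambda> \<ge> 0"
  shows "\<bar>G x\<bar> \<le> \<bar>G (grid_point h 0 x)\<bar> + (\<Sum>j<J. \<bar>G (grid_point h (Suc j) x) - G (grid_point h j x)\<bar>)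
    + \<Lambda> * (CARD('d) * (h / 2 ^ J))"
proof -
  have tel: "\<bar>G (grid_point h J x)\<bar> \<le> \<bar>G (grid_point h 0 x)\<bar> + (\<Sum>j<J. \<bar>G (grid_point h (Suc j) x) - G (grid_point h j x)\<bar>)"
    by (induction J) auto
  have "\<bar>G x - G (grid_point h J x)\<bar> \<le> \<Lambda> * norm (x - grid_point h J x)" by (rule lip)
  also have "\<dots> \<le> \<Lambda> * (CARD('d) * (h / 2 ^ J))"
    by (intro mult_left_mono grid_point_close h \<Lambda>)
  finally show ?thesis using tel by linarith
qed

lemma sum_dyadic_weights:
  "(\<Sum>j<J. 1 / 2 ^ j) \<le> (2::real)" "(\<Sum>j<J. (real j + 1) / 2 ^ j) \<le> (4::real)"
proof -
  have "(\<Sum>j<J. 1 / 2 ^ j) = 2 - 2 / (2::real) ^ J"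
    by (induction J) (auto simp: field_simps)
  then show "(\<Sum>j<J. 1 / 2 ^ j) \<le> (2::real)" by simp
  have "(\<Sum>j<J. (real j + 1) / 2 ^ j) = 4 - (2 * real J + 4) / (2::real) ^ J"
  proof (induction J)
    case (Suc J)
    show ?case unfolding sum.lessThan_Suc Suc by (simp add: field_simps)
  qed simp
  then show "(\<Sum>j<J. (real j + 1) / 2 ^ j) \<le> (4::real)" by simp
qed

lemma smooth_kernel_support:
  fixes K :: "real ^ 'd \<Rightarrow> real"
  assumes K: "smooth_kernel K" and x: "K x \<noteq> 0"
  shows "x \<in> cbox (\<chi> i. - 1 / 2) (\<chi> i. 1 / 2)"
proof -
  have "closure {x. K x \<noteq> 0} \<subseteq> cbox (\<chi> i. - 1 / 2) (\<chi> i. 1 / 2)"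
    using K unfolding smooth_kernel_def by (elim conjE)
  moreover have "x \<in> closure {x. K x \<noteq> 0}"
    using x by (intro subsetD[OF closure_subset]) simp
  ultimately show ?thesis by (rule subsetD)
qed

lemma smooth_kernel_bounds:
  fixes K :: "real ^ 'd \<Rightarrow> real"
  assumes "smooth_kernel K"
  obtains L B where "L \<ge> 0" "B \<ge> 0" "\<And>x y. \<bar>K x - K y\<bar> \<le> L * norm (x - y)" "\<And>x. \<bar>K x\<bar> \<le> B"
proof -
  obtain L where L: "L-lipschitz_on UNIV K" using assms unfolding smooth_kernel_def by blast
  have lip: "\<bar>K x - K y\<bar> \<le> L * norm (x - y)" for x y
    using lipschitz_onD[OF L, of x y] by (simp add: dist_norm)

  have "compact (K ` cbox (\<chi> i. - 1 / 2) (\<chi> i. 1 / 2))"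
    using lipschitz_on_continuous_on[OF L] by (intro compact_continuous_image) (auto intro: continuous_on_subset)
  then have "bounded (K ` cbox (\<chi> i. - 1 / 2) (\<chi> i. 1 / 2))" by (rule compact_imp_bounded)
  then obtain B where B: "\<And>y. y \<in> K ` cbox (\<chi> i. - 1 / 2) (\<chi> i. 1 / 2) \<Longrightarrow> norm y \<le> B"
    unfolding bounded_iff by blast
  have "\<bar>K x\<bar> \<le> \<bar>B\<bar>" for x
  proof (cases "K x = 0")
    case False
    then have "x \<in> cbox (\<chi> i. - 1 / 2) (\<chi> i. 1 / 2)" by (rule smooth_kernel_support[OF assms])
    then show ?thesis using B[of "K x"] by auto
  qed simp
  with that[of L "\<bar>B\<bar>"] lip lipschitz_on_nonneg[OF L] show thesis by auto
qed

definition kernel_cube :: "real \<Rightarrow> real ^ 'd \<Rightarrow> (real ^ 'd) set" where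
  "kernel_cube h x = cbox (x - (\<chi> i. h / 2)) (x + (\<chi> i. h / 2))"

lemma scaled_kernel_support:
  fixes K :: "real ^ 'd \<Rightarrow> real"
  assumes K: "smooth_kernel K" and h: "h > 0" and nz: "scaled_kernel K h (x - z) \<noteq> 0"
  shows "z \<in> kernel_cube h x"
proof -
  have "K ((1 / h) *\<^sub>R (x - z)) \<noteq> 0" using nz by (auto simp: scaled_kernel_def)
  then have "(1 / h) *\<^sub>R (x - z) \<in> cbox (\<chi> i. - 1 / 2) (\<chi> i. 1 / 2)"
    by (rule smooth_kernel_support[OF K])
  then have "- 1 / 2 \<le> (x $ i - z $ i) / h \<and> (x $ i - z $ i) / h \<le> 1 / 2" for i
    by (auto simp: mem_box_cart)
  then show ?thesis
    using h by (auto simp: kernel_cube_def mem_box_cart field_simps)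
qed

lemma emeasure_kernel_cube:
  fixes x :: "real ^ 'd"
  assumes "h > 0"
  shows "emeasure lborel (kernel_cube h x) = ennreal (h ^ CARD('d))"
proof -
  have "x \<in> kernel_cube h x" using assms by (simp add: kernel_cube_def mem_box_cart)
  then have "kernel_cube h x \<noteq> {}" by blast
  then have "measure lborel (kernel_cube h x) = (\<Prod>i\<in>(UNIV::'d set). h)"
    unfolding kernel_cube_def by (subst content_cbox_cart) auto
  moreover have "emeasure lborel (kernel_cube h x) = ennreal (measure lborel (kernel_cube h x))"
    unfolding kernel_cube_def by (intro emeasure_eq_ennreal_measure) (simp add: emeasure_lborel_cbox_eq)
  ultimately show ?thesis by simp
qed

lemma kernel_cube_norm:
  fixes x :: "real ^ 'd" and h :: real
  assumes h: "h > 0" and z: "z \<in> kernel_cube h x"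
  shows "norm z \<le> norm x + CARD('d) * h"
proof -
  have "\<bar>(z - x) $ i\<bar> \<le> h" for i
  proof -
    have "x $ i - h / 2 \<le> z $ i" "z $ i \<le> x $ i + h / 2"
      using z by (auto simp: kernel_cube_def mem_box_cart)
    then show ?thesis using h by (simp add: abs_le_iff)
  qed
  then have "norm (z - x) \<le> (\<Sum>i\<in>(UNIV::'d set). h)"
    by (intro order_trans[OF norm_le_l1_cart] sum_mono)
  then show ?thesis using norm_triangle_sub[of z x] by simp
qed

section \<open>Fluctuations of the kernel estimator\<close>

context stationary_process
begin

lemma block_diff:
  fixes f g :: "'a \<Rightarrow> real"
  assumes "\<omega> \<in> space M" "r \<ge> 0" "continuous_on UNIV f" "\<And>x. \<bar>f x\<bar> \<le> B"
    "continuous_on UNIV g" "\<And>x. \<bar>g x\<bar> \<le> C"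
  shows "block (\<lambda>x. f x - g x) r a \<omega> = block f r a \<omega> - block g r a \<omega>"
  unfolding block_def
  by (rule set_integral_diff(2)) (rule block_set_integrable[OF assms(1,2,3,4)] block_set_integrable[OF assms(1,2,5,6)])+

lemma block_const: "a \<ge> 0 \<Longrightarrow> block (\<lambda>_. c) r a \<omega> = a * c"
  by (simp add: block_def set_lebesgue_integral_def)

end

locale kernel_estimation = stationary_density_process M X P \<mu> p \<rho>
  for M :: "'w measure"
    and X :: "real \<Rightarrow> 'w \<Rightarrow> real ^ 'd"
    and P :: "real ^ 'd \<Rightarrow> 'w measure"
    and \<mu> :: "(real ^ 'd) measure"
    and p \<rho> +
  fixes K :: "real ^ 'd \<Rightarrow> real" and L B :: real
  assumes K: "smooth_kernel K" and L: "L \<ge> 0" and B: "B \<ge> 0"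
    and K_lipschitz: "\<And>x y. \<bar>K x - K y\<bar> \<le> L * norm (x - y)" and K_bound: "\<And>x. \<bar>K x\<bar> \<le> B"
begin

abbreviation kern :: "real \<Rightarrow> real ^ 'd \<Rightarrow> real ^ 'd \<Rightarrow> real" where
  "kern h x z \<equiv> scaled_kernel K h (x - z)"

lemma kern_bound: "h > 0 \<Longrightarrow> \<bar>kern h x z\<bar> \<le> B / h ^ CARD('d)"
  using K_bound by (simp add: scaled_kernel_def divide_right_mono)

lemma scaled_kernel_lipschitz:
  assumes h: "h > 0"
  shows "\<bar>scaled_kernel K h x - scaled_kernel K h y\<bar> \<le> L * norm (x - y) / (h * h ^ CARD('d))"
proof -
  have "\<bar>K ((1 / h) *\<^sub>R x) - K ((1 / h) *\<^sub>R y)\<bar> \<le> L * norm ((1 / h) *\<^sub>R x - (1 / h) *\<^sub>R y)"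
    by (rule K_lipschitz)
  also have "\<dots> = L * norm (x - y) / h"
    using h by (simp flip: scaleR_right_diff_distrib)
  finally have "\<bar>K ((1 / h) *\<^sub>R x) - K ((1 / h) *\<^sub>R y)\<bar> / h ^ CARD('d) \<le> L * norm (x - y) / h / h ^ CARD('d)"
    using h by (intro divide_right_mono) auto
  then show ?thesis
    using h by (simp add: scaled_kernel_def flip: diff_divide_distrib)
qed

lemma kern_lipschitz:
  assumes "h > 0"
  shows "\<bar>kern h x z - kern h y z\<bar> \<le> L * norm (x - y) / (h * h ^ CARD('d))"
  using scaled_kernel_lipschitz[OF assms, of "x - z" "y - z"] by simp

lemma kern_continuous:
  assumes h: "h > 0"
  shows "continuous_on UNIV (kern h x)"
proof -
  have "(L / (h * h ^ CARD('d)))-lipschitz_on UNIV (kern h x)"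
  proof (rule lipschitz_onI)
    show "dist (kern h x y) (kern h x z) \<le> L / (h * h ^ CARD('d)) * dist y z" for y z
      using scaled_kernel_lipschitz[OF h, of "x - y" "x - z"]
      by (simp add: dist_norm norm_minus_commute)
    show "0 \<le> L / (h * h ^ CARD('d))" using L h by simp
  qed
  then show ?thesis by (rule lipschitz_on_continuous_on)
qed

definition fluctuation :: "real \<Rightarrow> real \<Rightarrow> 'w \<Rightarrow> real ^ 'd \<Rightarrow> real" where
  "fluctuation h T \<omega> x = block (\<lambda>z. kern h x z - \<mu>.expectation (kern h x)) 0 T \<omega>"

lemma expectation_le:
  fixes f :: "real ^ 'd \<Rightarrow> real"
  assumes "\<And>x. \<bar>f x\<bar> \<le> C"
  shows "\<bar>\<mu>.expectation f\<bar> \<le> C"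
proof -
  have C: "0 \<le> C" using assms[of undefined] by linarith
  show ?thesis
  proof (cases "integrable \<mu> f")
    case True
    have "norm (\<mu>.expectation f) \<le> \<mu>.expectation (\<lambda>_. C)"
      using assms C True by (intro Bochner_Integration.integral_norm_bound_integral) auto
    then show ?thesis using \<mu>.prob_space by simp
  qed (use C in \<open>simp add: not_integrable_integral_eq\<close>)
qed

lemma integrable_kern: "h > 0 \<Longrightarrow> integrable \<mu> (kern h x)"
  using kern_bound[of h x] borel_measurable_continuous_onI[OF kern_continuous[of h x]]
  by (intro \<mu>.integrable_const_bound[where B="B / h ^ CARD('d)"]) auto

lemma kde_fluctuation:
  assumes h: "h > 0" and T: "T > 0" and w: "\<omega> \<in> space M"
  shows "kde K X h T x \<omega> - (\<integral>\<omega>'. kde K X h T x \<omega>' \<partial>Q) = fluctuation h T \<omega> x / T"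
proof -
  have kde: "kde K X h T x = (\<lambda>\<omega>. (1 / T) * block (kern h x) 0 T \<omega>)"
    by (simp add: kde_def block_def fun_eq_iff)
  have "(\<integral>\<omega>'. kde K X h T x \<omega>' \<partial>Q) = (1 / T) * (T * \<mu>.expectation (kern h x))"
    unfolding kde using expectation_block[OF order_refl less_imp_le[OF T] kern_continuous[OF h] kern_bound[OF h]]
    by simp
  moreover have "fluctuation h T \<omega> x = block (kern h x) 0 T \<omega> - T * \<mu>.expectation (kern h x)"
    unfolding fluctuation_def
    using block_diff[where f="kern h x" and g="\<lambda>_. \<mu>.expectation (kern h x)" and r=0 and a=T
        and C="\<bar>\<mu>.expectation (kern h x)\<bar>", OF w order_refl kern_continuous[OF h] kern_bound[OF h]] T
    by (simp add: block_const)
  ultimately show ?thesis using T by (simp add: kde diff_divide_distrib)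
qed

lemma centred_kern_bound:
  assumes h: "h > 0"
  shows "\<bar>kern h x z - \<mu>.expectation (kern h x)\<bar> \<le> 2 * (B / h ^ CARD('d))"
  using kern_bound[OF h, of x z] expectation_le[where f="kern h x", OF kern_bound[OF h]] by linarith

lemma fluctuation_lipschitz:
  assumes h: "h > 0" and T: "T > 0" and w: "\<omega> \<in> space M"
  shows "\<bar>fluctuation h T \<omega> x - fluctuation h T \<omega> y\<bar> \<le> T * (2 * L / (h * h ^ CARD('d))) * norm (x - y)"
proof -
  define l where "l = L * norm (x - y) / (h * h ^ CARD('d))"
  have c: "continuous_on UNIV (\<lambda>z. kern h x z - \<mu>.expectation (kern h x))" for x
    using kern_continuous[OF h, of x] by (intro continuous_intros)
  have "\<bar>kern h x z - kern h y z\<bar> \<le> l" for z unfolding l_def by (rule kern_lipschitz[OF h])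
  then have "\<bar>\<mu>.expectation (\<lambda>z. kern h x z - kern h y z)\<bar> \<le> l" by (rule expectation_le)
  then have e: "\<bar>\<mu>.expectation (kern h x) - \<mu>.expectation (kern h y)\<bar> \<le> l"
    using integrable_kern[OF h] by simp
  have "fluctuation h T \<omega> x - fluctuation h T \<omega> y
      = block (\<lambda>z. (kern h x z - \<mu>.expectation (kern h x)) - (kern h y z - \<mu>.expectation (kern h y))) 0 T \<omega>"
    unfolding fluctuation_def
    by (rule block_diff[symmetric, OF w order_refl c centred_kern_bound[OF h] c centred_kern_bound[OF h]])
  also have "\<bar>\<dots>\<bar> \<le> T * (2 * l)"
  proof (rule block_bound[OF w order_refl less_imp_le[OF T]])
    show "\<bar>kern h x z - \<mu>.expectation (kern h x) - (kern h y z - \<mu>.expectation (kern h y))\<bar> \<le> 2 * l" for z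
      using e kern_lipschitz[OF h, of x z y] unfolding l_def by linarith
  qed (intro continuous_intros c)
  finally show ?thesis by (simp add: l_def)
qed

text \<open>
  The functions to which the Bernstein inequality is applied. An index consists of a level and a pair of
  points of consecutive grids, the finer one first. At level \<open>j\<close> the grid distance is of order
  \<open>h / 2 ^ (j - 1)\<close>, and the factor \<open>2 ^ (j - 1)\<close> brings all levels to the same size. At level 0
  the chain starts with a single point of the coarsest grid.
\<close>

definition increment :: "real \<Rightarrow> nat \<times> (real ^ 'd) \<times> (real ^ 'd) \<Rightarrow> real ^ 'd \<Rightarrow> real" where
  "increment h = (\<lambda>(j, x, y) z. if j = 0 then kern h x z else 2 ^ (j - 1) * (kern h x z - kern h y z))"

definition links :: "real \<Rightarrow> nat \<Rightarrow> (real ^ 'd) set \<Rightarrow> ((real ^ 'd) \<times> (real ^ 'd)) set" where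
  "links h j D = (\<lambda>x. (grid_point h j x, grid_point h (j - 1) x)) ` D"

lemma increment_continuous:
  assumes h: "h > 0"
  shows "continuous_on UNIV (increment h i)"
proof -
  obtain j x y where i: "i = (j, x, y)" by (cases i)
  show ?thesis
    unfolding i increment_def using kern_continuous[OF h]
    by (cases "j = 0") (auto intro!: continuous_intros)
qed

lemma increment_bound:
  assumes h: "h > 0" and i: "q \<in> links h j D"
  shows "\<bar>increment h (j, q) z\<bar> \<le> (B + 2 * L * CARD('d) + 1) / h ^ CARD('d)"
proof -
  obtain x where q: "q = (grid_point h j x, grid_point h (j - 1) x)" using i by (auto simp: links_def)
  show ?thesis
  proof (cases j)
    case 0
    have "\<bar>kern h (grid_point h 0 x) z\<bar> \<le> B / h ^ CARD('d)" by (rule kern_bound[OF h])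
    also have "\<dots> \<le> (B + 2 * L * CARD('d) + 1) / h ^ CARD('d)"
      using h L by (intro divide_right_mono) auto
    finally show ?thesis using 0 by (simp add: increment_def q)
  next
    case (Suc k)
    let ?d = "real CARD('d)"
    have "norm (grid_point h (Suc k) x - grid_point h k x)
        \<le> norm (x - grid_point h k x) + norm (x - grid_point h (Suc k) x)"
      using norm_triangle_ineq4[of "x - grid_point h k x" "x - grid_point h (Suc k) x"] by simp
    also have "\<dots> \<le> ?d * (h / 2 ^ k) + ?d * (h / 2 ^ Suc k)"
      by (intro add_mono grid_point_close h)
    also have "\<dots> \<le> 2 * ?d * (h / 2 ^ k)"
    proof -
      have "?d * (h / 2 ^ Suc k) \<le> ?d * (h / 2 ^ k)"
        using h by (intro mult_left_mono divide_left_mono) auto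
      then have "?d * (h / 2 ^ k) + ?d * (h / 2 ^ Suc k) \<le> ?d * (h / 2 ^ k) + ?d * (h / 2 ^ k)"
        by (rule add_left_mono)
      also have "\<dots> = 2 * ?d * (h / 2 ^ k)" by simp
      finally show ?thesis .
    qed
    finally have n: "norm (grid_point h (Suc k) x - grid_point h k x) \<le> 2 * ?d * (h / 2 ^ k)" .
    have "\<bar>kern h (grid_point h (Suc k) x) z - kern h (grid_point h k x) z\<bar>
        \<le> L * norm (grid_point h (Suc k) x - grid_point h k x) / (h * h ^ CARD('d))"
      by (rule kern_lipschitz[OF h])
    also have "\<dots> \<le> L * (2 * ?d * (h / 2 ^ k)) / (h * h ^ CARD('d))"
      using h L n by (intro divide_right_mono mult_left_mono) auto
    also have "\<dots> = (2 * L * ?d / h ^ CARD('d)) / 2 ^ k" using h by (simp add: mult_ac)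
    finally have "2 ^ k * \<bar>kern h (grid_point h (Suc k) x) z - kern h (grid_point h k x) z\<bar>
        \<le> 2 ^ k * ((2 * L * ?d / h ^ CARD('d)) / 2 ^ k)" by (intro mult_left_mono) auto
    also have "\<dots> = 2 * L * ?d / h ^ CARD('d)" by simp
    also have "\<dots> \<le> (B + 2 * L * ?d + 1) / h ^ CARD('d)"
      using h B by (intro divide_right_mono) auto
    finally show ?thesis using Suc by (simp add: increment_def q abs_mult)
  qed
qed

lemma fluctuation_increment:
  assumes h: "h > 0" and w: "\<omega> \<in> space M"
  shows "block (\<lambda>z. increment h (0, x, y) z - \<mu>.expectation (increment h (0, x, y))) 0 T \<omega> = fluctuation h T \<omega> x"
    and "block (\<lambda>z. increment h (Suc k, x, y) z - \<mu>.expectation (increment h (Suc k, x, y))) 0 T \<omega>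
      = 2 ^ k * (fluctuation h T \<omega> x - fluctuation h T \<omega> y)"
proof -
  have inc0: "increment h (0, x, y) = kern h x" by (simp add: increment_def)
  show "block (\<lambda>z. increment h (0, x, y) z - \<mu>.expectation (increment h (0, x, y))) 0 T \<omega> = fluctuation h T \<omega> x"
    by (simp add: fluctuation_def inc0)
  have c: "continuous_on UNIV (\<lambda>z. kern h x z - \<mu>.expectation (kern h x))" for x
    using kern_continuous[OF h, of x] by (intro continuous_intros)
  have inc: "increment h (Suc k, x, y) = (\<lambda>z. 2 ^ k * (kern h x z - kern h y z))"
    by (simp add: increment_def)
  have "(\<lambda>z. increment h (Suc k, x, y) z - \<mu>.expectation (increment h (Suc k, x, y)))
      = (\<lambda>z. 2 ^ k * ((kern h x z - \<mu>.expectation (kern h x)) - (kern h y z - \<mu>.expectation (kern h y))))"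
    unfolding inc using integrable_kern[OF h] by (simp add: algebra_simps)
  then have "block (\<lambda>z. increment h (Suc k, x, y) z - \<mu>.expectation (increment h (Suc k, x, y))) 0 T \<omega>
      = 2 ^ k * block (\<lambda>z. (kern h x z - \<mu>.expectation (kern h x)) - (kern h y z - \<mu>.expectation (kern h y))) 0 T \<omega>"
    by (simp only: block_scale)
  also have "block (\<lambda>z. (kern h x z - \<mu>.expectation (kern h x)) - (kern h y z - \<mu>.expectation (kern h y))) 0 T \<omega>
      = fluctuation h T \<omega> x - fluctuation h T \<omega> y"
    unfolding fluctuation_def
    by (rule block_diff[OF w order_refl c centred_kern_bound[OF h] c centred_kern_bound[OF h]])
  finally show "block (\<lambda>z. increment h (Suc k, x, y) z - \<mu>.expectation (increment h (Suc k, x, y))) 0 T \<omega>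
      = 2 ^ k * (fluctuation h T \<omega> x - fluctuation h T \<omega> y)" .
qed

text \<open>
  Each of the two points of a pair contributes \<open>d\<close> to the exponent. The factor 2 changes only
  constants, since the count enters through its logarithm.
\<close>

lemma card_links:
  assumes h: "0 < h" "h \<le> 1" and R: "R \<ge> 0" "\<And>x. x \<in> D \<Longrightarrow> norm x \<le> R"
  shows "finite (links h j D)" "real (card (links h j D)) \<le> ((2 * R + 3) * 2 ^ j / h) ^ (2 * CARD('d))"
proof -
  have sub: "links h j D \<subseteq> grid_point h j ` D \<times> grid_point h (j - 1) ` D"
    by (auto simp: links_def)
  note c = card_grid_points[OF h R]
  have fin: "finite (grid_point h j ` D \<times> grid_point h (j - 1) ` D)" using c(1) by simp
  then show "finite (links h j D)" using sub by (rule finite_subset[rotated])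
  have "real (card (links h j D)) \<le> real (card (grid_point h j ` D)) * real (card (grid_point h (j - 1) ` D))"
    using card_mono[OF fin sub] by (simp add: card_cartesian_product flip: of_nat_mult)
  also have "\<dots> \<le> ((2 * R + 3) * 2 ^ j / h) ^ CARD('d) * ((2 * R + 3) * 2 ^ (j - 1) / h) ^ CARD('d)"
    using h R(1) by (intro mult_mono c(2)) auto
  also have "\<dots> \<le> ((2 * R + 3) * 2 ^ j / h) ^ CARD('d) * ((2 * R + 3) * 2 ^ j / h) ^ CARD('d)"
  proof (rule mult_left_mono[OF power_mono])
    have "(2 * R + 3) * 2 ^ (j - 1) \<le> (2 * R + 3) * 2 ^ j"
      using R(1) by (intro mult_left_mono power_increasing) auto
    then show "(2 * R + 3) * 2 ^ (j - 1) / h \<le> (2 * R + 3) * 2 ^ j / h"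
      using h by (intro divide_right_mono) auto
  qed (use h R(1) in auto)
  also have "\<dots> = ((2 * R + 3) * 2 ^ j / h) ^ (2 * CARD('d))" by (simp only: mult_2 power_add)
  finally show "real (card (links h j D)) \<le> ((2 * R + 3) * 2 ^ j / h) ^ (2 * CARD('d))" .
qed

lemma increment_support:
  assumes h: "h > 0" and nz: "increment h (j, x, y) z \<noteq> 0"
  shows "z \<in> kernel_cube h x \<union> kernel_cube h y"
proof -
  have "kern h x z \<noteq> 0 \<or> kern h y z \<noteq> 0" using nz by (auto simp: increment_def split: if_splits)
  then show ?thesis using scaled_kernel_support[OF K h] by blast
qed

lemma links_support:
  assumes h: "0 < h" "h \<le> 1" and R: "\<And>x. x \<in> D \<Longrightarrow> norm x \<le> R" and q: "(x, y) \<in> links h j D"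
  shows "kernel_cube h x \<union> kernel_cube h y \<subseteq> cball 0 (R + 2 * CARD('d))"
proof -
  let ?d = "real CARD('d)"
  have g: "norm (grid_point h k x') \<le> R + ?d" if "x' \<in> D" for k and x' :: "real ^ 'd"
  proof -
    have "norm (grid_point h k x') \<le> norm x' + norm (x' - grid_point h k x')"
      using norm_triangle_ineq4[of x' "x' - grid_point h k x'"] by simp
    also have "\<dots> \<le> R + ?d * (h / 2 ^ k)" by (intro add_mono R that grid_point_close h)
    also have "h / 2 ^ k \<le> 1"
      using h by (simp add: divide_le_eq) (meson one_le_numeral one_le_power order_trans)
    finally show ?thesis by (simp add: mult_left_mono)
  qed
  have n: "norm x \<le> R + ?d" "norm y \<le> R + ?d" using q g by (auto simp: links_def)
  have dh: "?d * h \<le> ?d * 1" using h by (intro mult_left_mono) auto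
  have "norm z \<le> R + 2 * ?d" if "z \<in> kernel_cube h x \<or> z \<in> kernel_cube h y" for z
    using that
  proof
    assume "z \<in> kernel_cube h x"
    from kernel_cube_norm[OF h(1) this] n dh show ?thesis by linarith
  next
    assume "z \<in> kernel_cube h y"
    from kernel_cube_norm[OF h(1) this] n dh show ?thesis by linarith
  qed
  then show ?thesis by auto
qed

section \<open>The uniform deviation bound\<close>

text \<open>
  The Bernstein inequality is applied to all increments up to level \<open>J\<close>, and the chaining bound adds
  up the results. The constant depends on neither \<open>\<Xi>\<close>, \<open>u\<close>, \<open>h\<close> nor \<open>T\<close>, which the second
  part of the theorem needs.
\<close>

lemma uniform_deviation_bound:
  fixes D :: "(real ^ 'd) set"
  assumes short: "short_time_bound p"
    and long: "local_uniform_convergence \<mu> p \<rho> \<or> (CARD('d) \<ge> 2 \<and> exponentially_beta_mixing X P \<mu>)"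
    and D: "bounded D"
  obtains C where "C > 0"
    "\<And>\<Xi> h u a n T. beta_mixing X P \<mu> \<Xi> \<Longrightarrow> \<Xi> a \<ge> 0 \<Longrightarrow> 0 < h \<Longrightarrow> h < 1 \<Longrightarrow> u \<ge> 1 \<Longrightarrow> a > 0 \<Longrightarrow> n > 0 \<Longrightarrow>
      T = 2 * real n * a \<Longrightarrow>
      \<exists>bad\<in>sets M. measure Q bad \<le> exp (- u) / 2 + 2 * real n * \<Xi> a \<and>
        (\<forall>\<omega>\<in>space M - bad. \<forall>x\<in>D. \<bar>kde K X h T x \<omega> - (\<integral>\<omega>'. kde K X h T x \<omega>' \<partial>Q)\<bar>
          \<le> C * (max u (ln (1 / h)) * a / (T * h ^ CARD('d))
            + T powr (- 1 / 2) * psi CARD('d) (h ^ CARD('d)) * sqrt (max u (ln (1 / h)))))"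
proof -
  obtain R' where R': "\<And>x. x \<in> D \<Longrightarrow> norm x \<le> R'" using D by (auto simp: bounded_iff)
  define R where "R = max 0 R'"
  have R: "R \<ge> 0" "\<And>x. x \<in> D \<Longrightarrow> norm x \<le> R" using R' by (auto simp: R_def le_max_iff_disj)
  let ?d = "real CARD('d)"
  define S where "S = (cball 0 (R + 2 * ?d) :: (real ^ 'd) set)"
  have S: "compact S" by (simp add: S_def)
  have dim: "DIM(real ^ 'd) = CARD('d)" by simp
  obtain Cv where Cv: "Cv > 0" and variance:
    "\<And>h U f B r a. 0 < h \<Longrightarrow> h < 1 \<Longrightarrow> U \<in> sets borel \<Longrightarrow> U \<subseteq> S \<Longrightarrow> emeasure lborel U \<le> ennreal (2 * h ^ CARD('d)) \<Longrightarrow>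
      continuous_on UNIV f \<Longrightarrow> (\<And>x. \<bar>f x\<bar> \<le> B) \<Longrightarrow> (\<And>x. x \<notin> U \<Longrightarrow> f x = 0) \<Longrightarrow> r \<ge> 0 \<Longrightarrow> a > 0 \<Longrightarrow>
      Q.expectation (\<lambda>\<omega>. (block (\<lambda>x. f x - \<mu>.expectation f) r a \<omega>)\<^sup>2)
        \<le> Cv * a * (B\<^sup>2 * variance_scale CARD('d) h)"
    by (fact block_variance[OF short S, unfolded dim, OF long])
  define CK where "CK = B + 2 * L * ?d + 1"
  have CK: "CK > 0" using B L by (simp add: CK_def add_nonneg_pos)
  define Cg where "Cg = 2 * R + 3"
  have Cg: "Cg \<ge> 1" using R by (simp add: Cg_def)
  define c1 where "c1 = 1 + 2 * ?d + 2 * ?d * ln Cg + ln 16"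
  define c2 where "c2 = 2 * ?d + 1"
  have c1: "c1 \<ge> 1" using Cg by (simp add: c1_def)
  have c2: "c2 \<ge> 0" by (simp add: c2_def)
  define C where "C = (3 * c1 + 4 * c2 + 1) * (4 * CK + 4 * CK * sqrt (Cv / 2))"
  have C: "C > 0" using c1 c2 CK Cv by (simp add: C_def add_pos_nonneg)
  show thesis
  proof (rule that[OF C])
    fix \<Xi> :: "real \<Rightarrow> real" and h u a T :: real and n :: nat
    assume mix: "beta_mixing X P \<mu> \<Xi>" and \<Xi>: "\<Xi> a \<ge> 0" and h: "0 < h" "h < 1" and u: "u \<ge> 1"
      and a: "a > 0" and n: "n > 0" and T_eq: "T = 2 * real n * a"
    have T: "T > 0" using a n by (simp add: T_eq)
    define A where "A = max u (ln (1 / h))"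
    have A: "A \<ge> 1" "u \<le> A" "ln (1 / h) \<le> A" using u by (auto simp: A_def)
    define Bh where "Bh = CK / h ^ CARD('d)"
    have Bh: "Bh > 0" using CK h by (simp add: Bh_def)
    define \<psi> where "\<psi> = psi CARD('d) (h ^ CARD('d))"
    have \<psi>: "\<psi>\<^sup>2 \<ge> 1" using psi_squared_bounds(1)[OF h, of "CARD('d)"] by (simp add: \<psi>_def Suc_leI)
    have \<psi>0: "\<psi> \<ge> 0"
    proof -
      have "1 \<le> 1 / h\<^sup>2" using h by (simp add: power_le_one)
      then show ?thesis by (simp add: \<psi>_def psi_def)
    qed
    define v where "v = Cv * a * (Bh\<^sup>2 * variance_scale CARD('d) h)"
    have v_eq: "v = Cv * a * (CK\<^sup>2 * \<psi>\<^sup>2)"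
      using h by (simp add: v_def variance_scale_def \<psi>_def Bh_def power_divide power_even_eq)
    have "\<psi>\<^sup>2 > 0" using \<psi> by linarith
    then have v: "v > 0" unfolding v_eq using Cv a CK by (intro mult_pos_pos) auto
    \<comment> \<open>chosen such that the terms \<open>exp (- s j)\<close> of all links of level \<open>j\<close> sum up to at most \<open>exp (- u) / (16 * 2 ^ j)\<close>\<close>
    define s where "s j = u + 2 * ?d * ln (Cg * 2 ^ j / h) + ln 16 + real j * ln 2" for j
    have s_le: "s j \<le> A * (c1 + c2 * real j)" for j
    proof -
      have "ln (Cg * 2 ^ j / h) = ln Cg + real j * ln 2 + ln (1 / h)"
        using Cg h by (simp add: ln_mult ln_div ln_realpow)
      then have "s j = u + 2 * ?d * ln (1 / h) + (2 * ?d * ln Cg + ln 16) + real j * ((2 * ?d + 1) * ln 2)"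
        by (simp add: s_def algebra_simps)
      also have "\<dots> \<le> A + 2 * ?d * A + A * (2 * ?d * ln Cg + ln 16) + A * (real j * (2 * ?d + 1))"
      proof (intro add_mono)
        show "u \<le> A" by (rule A)
        show "2 * ?d * ln (1 / h) \<le> 2 * ?d * A" using A by (intro mult_left_mono) auto
        have "0 \<le> 2 * ?d * ln Cg + ln 16" using Cg by simp
        then show "2 * ?d * ln Cg + ln 16 \<le> A * (2 * ?d * ln Cg + ln 16)"
          using A(1) mult_right_mono[of 1 A "2 * ?d * ln Cg + ln 16"] by simp
        have "real j * ((2 * ?d + 1) * ln 2) \<le> real j * ((2 * ?d + 1) * 1)"
          using ln_2_less_1 by (intro mult_left_mono) auto
        also have "\<dots> \<le> A * (real j * (2 * ?d + 1))"
          using A(1) mult_right_mono[of 1 A "real j * (2 * ?d + 1)"] by simp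
        finally show "real j * ((2 * ?d + 1) * ln 2) \<le> A * (real j * (2 * ?d + 1))" .
      qed
      also have "\<dots> = A * (c1 + c2 * real j)" by (simp add: c1_def c2_def algebra_simps)
      finally show ?thesis .
    qed
    have Cgh: "Cg * 2 ^ j / h \<ge> 1" for j
    proof -
      have "1 * 1 \<le> Cg * 2 ^ j" using Cg by (intro mult_mono) auto
      then show ?thesis using h by (simp add: le_divide_eq)
    qed
    have s_pos: "s j > 0" for j
    proof -
      have "0 \<le> ln (Cg * 2 ^ j / h)" using Cgh by simp
      then show ?thesis using u by (simp add: s_def add_pos_nonneg)
    qed
    \<comment> \<open>the Bernstein threshold for \<open>s = A\<close>; level \<open>j\<close> has at most \<open>c1 + c2 * j\<close> times this threshold\<close>
    define E where "E = 2 * (A * (a * (2 * Bh)) + 2 * sqrt (A * (real n * v)))"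
    have E: "E > 0"
      using A a Bh v n by (simp add: E_def add_pos_nonneg)
    define \<Lambda> where "\<Lambda> = T * (2 * L / (h * h ^ CARD('d)))"
    have \<Lambda>: "\<Lambda> \<ge> 0" using T L h by (simp add: \<Lambda>_def)
    \<comment> \<open>no estimate depends on \<open>J\<close>, so it may be as large as the remainder of the chaining requires\<close>
    obtain J where J: "\<Lambda> * (?d * h) / E < 2 ^ J" using real_arch_pow[of 2 "\<Lambda> * (?d * h) / E"] by auto
    have rem: "\<Lambda> * (?d * (h / 2 ^ J)) \<le> E"
    proof -
      have "\<Lambda> * (?d * h) \<le> E * 2 ^ J" using J E by (simp add: divide_less_eq mult.commute less_imp_le)
      then show ?thesis by (simp add: divide_le_eq)
    qed
    define I where "I = (SIGMA j:{..<Suc J}. links h j D)"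
    note card = card_links[OF h(1) less_imp_le[OF h(2)] R]
    have I: "finite I" unfolding I_def using card(1) by (intro finite_SigmaI) auto
    define g where "g i = (\<lambda>z. increment h i z - \<mu>.expectation (increment h i))" for i
    have incr: "\<bar>increment h i z\<bar> \<le> Bh" if i: "i \<in> I" for i z
    proof -
      obtain j q where "i = (j, q)" "q \<in> links h j D" using i by (auto simp: I_def)
      then show ?thesis unfolding Bh_def CK_def using increment_bound[OF h(1)] by blast
    qed
    have g_cont: "continuous_on UNIV (g i)" for i
      unfolding g_def using increment_continuous[OF h(1), of i] by (intro continuous_intros)
    have incr_int: "integrable \<mu> (increment h i)" if i: "i \<in> I" for i
      using incr[OF i] borel_measurable_continuous_onI[OF increment_continuous[OF h(1), of i]]
      by (intro \<mu>.integrable_const_bound[where B=Bh]) auto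
    obtain bad where bad: "bad \<in> sets M" "measure Q bad \<le> 4 * (\<Sum>i\<in>I. exp (- s (fst i))) + 2 * real n * \<Xi> a"
      and good: "\<And>\<omega> i. \<omega> \<in> space M - bad \<Longrightarrow> i \<in> I \<Longrightarrow>
        \<bar>block (g i) 0 (2 * real n * a) \<omega>\<bar> \<le> 2 * (s (fst i) * (a * (2 * Bh)) + 2 * sqrt (s (fst i) * (real n * v)))"
    proof (rule uniform_bernstein[where g=g and s="\<lambda>i. s (fst i)" and I=I and B="2 * Bh" and v=v, OF mix \<Xi> I a n _ v])
      show "\<bar>g i z\<bar> \<le> 2 * Bh" if i: "i \<in> I" for i z
        using incr[OF i, of z] expectation_le[where f="increment h i", OF incr[OF i]] unfolding g_def by linarith
      show "\<mu>.expectation (g i) = 0" if i: "i \<in> I" for i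
        unfolding g_def using incr_int[OF i] \<mu>.prob_space by simp
      show "Q.expectation (\<lambda>\<omega>. (block (g i) r a \<omega>)\<^sup>2) \<le> v" if i: "i \<in> I" and r: "r \<ge> 0" for i r
      proof -
        obtain j x y where ij: "i = (j, x, y)" and l: "(x, y) \<in> links h j D" using i by (auto simp: I_def)
        let ?U = "kernel_cube h x \<union> kernel_cube h y"
        have U: "?U \<in> sets borel" by (auto simp: kernel_cube_def)
        have US: "?U \<subseteq> S" unfolding S_def using links_support[OF h(1) less_imp_le[OF h(2)] R(2) l] by simp
        show ?thesis
          unfolding g_def v_def
        proof (rule variance[OF h U US])
          have "emeasure lborel ?U \<le> emeasure lborel (kernel_cube h x) + emeasure lborel (kernel_cube h y)"
            by (intro emeasure_subadditive) (auto simp: kernel_cube_def)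
          also have "\<dots> = ennreal (2 * h ^ CARD('d))"
            using h by (simp add: emeasure_kernel_cube flip: ennreal_plus)
          finally show "emeasure lborel ?U \<le> ennreal (2 * h ^ CARD('d))" .
          show "increment h i z = 0" if "z \<notin> ?U" for z
            using increment_support[OF h(1), of j x y z] that unfolding ij by blast
        qed (use increment_continuous[OF h(1)] incr[OF i] r a in auto)
      qed
    qed (use Bh s_pos g_cont in auto)
    have "(\<Sum>i\<in>I. exp (- s (fst i))) = (\<Sum>j<Suc J. \<Sum>q\<in>links h j D. exp (- s j))"
      unfolding I_def using card(1) by (subst sum.Sigma) (auto simp: case_prod_beta')
    also have "\<dots> \<le> (\<Sum>j<Suc J. exp (- u) / 16 * (1 / 2 ^ j))"
    proof (rule sum_mono)
      fix j
      let ?y = "(Cg * 2 ^ j / h)"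
      have y: "?y > 0" using Cgh[of j] by linarith
      have e: "exp (- s j) = exp (- u) / 16 * (1 / 2 ^ j) / ?y ^ (2 * CARD('d))"
      proof -
        have "exp (2 * ?d * ln ?y) = exp (real (2 * CARD('d)) * ln ?y)" by simp
        also have "\<dots> = ?y ^ (2 * CARD('d))" using y by (subst exp_of_nat_mult) simp
        finally have 1: "exp (2 * ?d * ln ?y) = ?y ^ (2 * CARD('d))" .
        have 2: "exp (real j * ln 2) = (2::real) ^ j" by (subst exp_of_nat_mult) simp
        have "exp (- s j) = exp (- u) / (exp (2 * ?d * ln ?y) * exp (ln 16) * exp (real j * ln 2))"
        proof -
          have "- s j = - u - (2 * ?d * ln ?y + ln 16 + real j * ln 2)" unfolding s_def by linarith
          then show ?thesis by (simp only: exp_diff exp_add)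
        qed
        then show ?thesis unfolding 1 2 by (simp add: mult_ac)
      qed
      have "(\<Sum>q\<in>links h j D. exp (- s j)) = real (card (links h j D)) * exp (- s j)" by simp
      also have "\<dots> \<le> ?y ^ (2 * CARD('d)) * exp (- s j)"
        unfolding Cg_def by (intro mult_right_mono card(2)) auto
      also have "\<dots> = exp (- u) / 16 * (1 / 2 ^ j)" unfolding e using Cg h(1) by simp
      finally show "(\<Sum>q\<in>links h j D. exp (- s j)) \<le> exp (- u) / 16 * (1 / 2 ^ j)" .
    qed
    also have "\<dots> = exp (- u) / 16 * (\<Sum>j<Suc J. 1 / 2 ^ j)" by (simp only: sum_distrib_left)
    also have "\<dots> \<le> exp (- u) / 16 * 2" by (intro mult_left_mono sum_dyadic_weights) simp
    finally have "measure Q bad \<le> exp (- u) / 2 + 2 * real n * \<Xi> a" using bad(2) by simp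
    moreover have "\<bar>kde K X h T x \<omega> - (\<integral>\<omega>'. kde K X h T x \<omega>' \<partial>Q)\<bar>
          \<le> C * (A * a / (T * h ^ CARD('d)) + T powr (- 1 / 2) * \<psi> * sqrt A)"
      if w: "\<omega> \<in> space M - bad" and x: "x \<in> D" for \<omega> x
    proof -
      have wM: "\<omega> \<in> space M" using w by simp
      let ?G = "fluctuation h T \<omega>"
      let ?x = "\<lambda>j. grid_point h j x"
      have thr: "2 * (s j * (a * (2 * Bh)) + 2 * sqrt (s j * (real n * v))) \<le> (c1 + c2 * real j) * E" for j
      proof -
        let ?k = "c1 + c2 * real j"
        have k: "?k \<ge> 1" using c1 c2 by (simp add: add_increasing2)
        have "s j * (a * (2 * Bh)) \<le> (A * ?k) * (a * (2 * Bh))"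
          using s_le[of j] a Bh by (intro mult_right_mono) auto
        moreover have "sqrt (s j * (real n * v)) \<le> ?k * sqrt (A * (real n * v))"
        proof -
          have "s j * (real n * v) \<le> (A * ?k) * (real n * v)"
            using s_le[of j] v by (intro mult_right_mono) auto
          also have "\<dots> \<le> (A * (real n * v)) * ?k\<^sup>2"
          proof -
            have "?k \<le> ?k\<^sup>2" using k by (simp add: self_le_power)
            then have "(A * (real n * v)) * ?k \<le> (A * (real n * v)) * ?k\<^sup>2"
              using A v by (intro mult_left_mono) auto
            then show ?thesis by (simp add: mult_ac)
          qed
          finally have "sqrt (s j * (real n * v)) \<le> sqrt ((A * (real n * v)) * ?k\<^sup>2)" by simp
          also have "\<dots> = ?k * sqrt (A * (real n * v))" using k by (simp add: real_sqrt_mult)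
          finally show ?thesis .
        qed
        moreover have "2 * (x + 2 * y) \<le> 2 * (x' + 2 * y')" if "x \<le> x'" "y \<le> y'" for x y x' y' :: real
          using that by (intro mult_left_mono add_mono) auto
        ultimately have "2 * (s j * (a * (2 * Bh)) + 2 * sqrt (s j * (real n * v)))
            \<le> 2 * ((A * ?k) * (a * (2 * Bh)) + 2 * (?k * sqrt (A * (real n * v))))" by blast
        also have "\<dots> = ?k * E" by (simp add: E_def algebra_simps)
        finally show ?thesis .
      qed
      have lk: "(j, ?x j, ?x (j - 1)) \<in> I" if "j < Suc J" for j
        using that x by (auto simp: I_def links_def)
      have G0: "\<bar>?G (?x 0)\<bar> \<le> c1 * E"
      proof -
        have "\<bar>block (g (0, ?x 0, ?x (0 - 1))) 0 T \<omega>\<bar> \<le> (c1 + c2 * real 0) * E"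
          using good[OF w lk[of 0]] thr[of 0] unfolding T_eq fst_conv by linarith
        then show ?thesis unfolding g_def fluctuation_increment(1)[OF h(1) wM] by simp
      qed
      have Gj: "\<bar>?G (?x (Suc j)) - ?G (?x j)\<bar> \<le> (c1 + c2 * (real j + 1)) * E / 2 ^ j" if j: "j < J" for j
      proof -
        have "\<bar>block (g (Suc j, ?x (Suc j), ?x (Suc j - 1))) 0 T \<omega>\<bar> \<le> (c1 + c2 * real (Suc j)) * E"
          using good[OF w lk[of "Suc j"]] thr[of "Suc j"] j unfolding T_eq fst_conv by linarith
        then have "2 ^ j * \<bar>?G (?x (Suc j)) - ?G (?x j)\<bar> \<le> (c1 + c2 * (real j + 1)) * E"
          unfolding g_def fluctuation_increment(2)[OF h(1) wM] by (simp add: abs_mult add.commute)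
        then show ?thesis by (simp add: le_divide_eq mult.commute)
      qed
      have "\<bar>?G x\<bar> \<le> \<bar>?G (?x 0)\<bar> + (\<Sum>j<J. \<bar>?G (?x (Suc j)) - ?G (?x j)\<bar>) + \<Lambda> * (?d * (h / 2 ^ J))"
        by (rule chaining_bound[OF h(1) _ \<Lambda>]) (unfold \<Lambda>_def, rule fluctuation_lipschitz[OF h(1) T wM])
      also have "\<dots> \<le> c1 * E + (\<Sum>j<J. (c1 + c2 * (real j + 1)) * E / 2 ^ j) + E"
        using G0 Gj rem by (intro add_mono sum_mono) auto
      also have "(\<Sum>j<J. (c1 + c2 * (real j + 1)) * E / 2 ^ j)
          = c1 * E * (\<Sum>j<J. 1 / 2 ^ j) + c2 * E * (\<Sum>j<J. (real j + 1) / 2 ^ j)"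
        by (simp add: sum_distrib_left algebra_simps add_divide_distrib flip: sum.distrib)
      also have "\<dots> \<le> c1 * E * 2 + c2 * E * 4"
        using c1 c2 E by (intro add_mono mult_left_mono sum_dyadic_weights) auto
      finally have G: "\<bar>?G x\<bar> \<le> (3 * c1 + 4 * c2 + 1) * E" by (simp add: algebra_simps)
      have E_T: "E / T \<le> (4 * CK + 4 * CK * sqrt (Cv / 2)) * (A * a / (T * h ^ CARD('d)) + T powr (- 1 / 2) * \<psi> * sqrt A)"
      proof -
        have nv: "real n * v = T * ((Cv / 2) * (CK\<^sup>2 * \<psi>\<^sup>2))" by (simp add: v_eq T_eq)
        have "sqrt (A * (real n * v)) = sqrt A * (sqrt T * (sqrt (Cv / 2) * (CK * \<psi>)))"
          unfolding nv real_sqrt_mult using CK \<psi>0 by simp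
        then have "E / T = 4 * CK * (A * a / (T * h ^ CARD('d))) + 4 * CK * sqrt (Cv / 2) * ((sqrt T / T) * \<psi> * sqrt A)"
          by (simp add: E_def Bh_def add_divide_distrib mult_ac)
        also have "sqrt T / T = T powr (- 1 / 2)"
          using T by (simp add: sqrt_divide_self_eq powr_minus powr_half_sqrt)
        also have "4 * CK * (A * a / (T * h ^ CARD('d))) + 4 * CK * sqrt (Cv / 2) * (T powr (- 1 / 2) * \<psi> * sqrt A)
            \<le> (4 * CK + 4 * CK * sqrt (Cv / 2)) * (A * a / (T * h ^ CARD('d)) + T powr (- 1 / 2) * \<psi> * sqrt A)"
        proof -
          have "0 \<le> A * a / (T * h ^ CARD('d))" "0 \<le> T powr (- 1 / 2) * \<psi> * sqrt A" using A a T h \<psi>0 by auto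
          moreover have "0 \<le> 4 * CK" "0 \<le> 4 * CK * sqrt (Cv / 2)" using CK Cv by auto
          ultimately have "0 \<le> 4 * CK * (T powr (- 1 / 2) * \<psi> * sqrt A)"
            "0 \<le> 4 * CK * sqrt (Cv / 2) * (A * a / (T * h ^ CARD('d)))" by (metis mult_nonneg_nonneg)+
          then show ?thesis by (simp only: distrib_left distrib_right)
        qed
        finally show ?thesis .
      qed
      have "\<bar>?G x\<bar> / T \<le> (3 * c1 + 4 * c2 + 1) * E / T" using G T by (intro divide_right_mono) auto
      also have "\<dots> = (3 * c1 + 4 * c2 + 1) * (E / T)" by simp
      also have "\<dots> \<le> (3 * c1 + 4 * c2 + 1) * ((4 * CK + 4 * CK * sqrt (Cv / 2)) * (A * a / (T * h ^ CARD('d)) + T powr (- 1 / 2) * \<psi> * sqrt A))"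
        using c1 c2 by (intro mult_left_mono E_T) auto
      also have "\<dots> = C * (A * a / (T * h ^ CARD('d)) + T powr (- 1 / 2) * \<psi> * sqrt A)"
        by (simp only: C_def mult.assoc)
      finally show ?thesis
        unfolding kde_fluctuation[OF h(1) T wM] using T by simp
    qed
    ultimately show "\<exists>bad\<in>sets M. measure Q bad \<le> exp (- u) / 2 + 2 * real n * \<Xi> a \<and>
        (\<forall>\<omega>\<in>space M - bad. \<forall>x\<in>D. \<bar>kde K X h T x \<omega> - (\<integral>\<omega>'. kde K X h T x \<omega>' \<partial>Q)\<bar>
          \<le> C * (max u (ln (1 / h)) * a / (T * h ^ CARD('d))
            + T powr (- 1 / 2) * psi CARD('d) (h ^ CARD('d)) * sqrt (max u (ln (1 / h)))))"
      using bad(1) unfolding A_def \<psi>_def by blast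
  qed
qed

end

section \<open>Rate functions and the choice of the block length\<close>

text \<open>
  The events of the theorem are defined by suprema over uncountable sets. Covering them by a measurable event avoids
  proving their measurability, and gives monotonicity in \<open>S\<close>.
\<close>

definition outer_prob_le :: "'w measure \<Rightarrow> 'w set \<Rightarrow> real \<Rightarrow> bool" where
  "outer_prob_le Q S e \<longleftrightarrow> (\<exists>bad\<in>sets Q. S \<subseteq> bad \<and> measure Q bad \<le> e)"

lemma outer_prob_le_subset: "outer_prob_le Q S e \<Longrightarrow> S' \<subseteq> S \<Longrightarrow> outer_prob_le Q S' e"
  unfolding outer_prob_le_def by blast

text \<open>
  If \<open>S\<close> is not measurable, its measure is 0 by convention.
\<close>

lemma measure_le_outer_prob:
  assumes "prob_space Q" "outer_prob_le Q S e"
  shows "measure Q S \<le> e"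
proof -
  interpret prob_space Q by fact
  obtain bad where bad: "bad \<in> sets Q" "S \<subseteq> bad" "measure Q bad \<le> e"
    using assms(2) by (auto simp: outer_prob_le_def)
  show ?thesis
  proof (cases "S \<in> sets Q")
    case True
    show ?thesis using finite_measure_mono[OF bad(2,1)] bad(3) by linarith
  next
    case False
    moreover have "0 \<le> e" using measure_nonneg bad(3) by (rule order_trans)
    ultimately show ?thesis by (simp add: measure_notin_sets)
  qed
qed

definition deviation_threshold :: "nat \<Rightarrow> (real \<Rightarrow> real) \<Rightarrow> real \<Rightarrow> real \<Rightarrow> real \<Rightarrow> real" where
  "deviation_threshold d \<Xi> h T u = (u + ln T) / (T * h ^ d) * rate_inv \<Xi> (T powr (- u)) +
     T powr (- 1/2) * psi d (h ^ d) * sqrt (max u (ln (1 / h)))"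

lemma rate_nonneg:
  assumes "beta_mixing X P \<mu> \<Xi>" "t > 0"
  shows "0 \<le> \<Xi> t"
proof (rule tendsto_upperbound[where F=at_top and f=\<Xi>])
  show "(\<Xi> \<longlongrightarrow> 0) at_top" using assms(1) by (simp add: beta_mixing_def)
  have "antimono_on {0<..} \<Xi>" using assms(1) by (simp add: beta_mixing_def)
  show "\<forall>\<^sub>F s in at_top. \<Xi> s \<le> \<Xi> t"
    using eventually_ge_at_top[of t]
  proof eventually_elim
    case (elim s)
    then show ?case using monotone_onD[OF \<open>antimono_on {0<..} \<Xi>\<close>, of t s] assms(2) by simp
  qed
qed simp

lemma rate_pos:
  assumes "beta_mixing X P \<mu> \<Xi>" "strict_antimono_on {0<..} \<Xi>" "t > 0"
  shows "0 < \<Xi> t"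
proof -
  have "0 \<le> \<Xi> (t + 1)" using assms(3) by (intro rate_nonneg[OF assms(1)]) simp
  also have "\<dots> < \<Xi> t" using monotone_onD[OF assms(2), of t "t + 1"] assms(3) by simp
  finally show ?thesis .
qed

lemma rate_inv_set_nonempty:
  assumes "beta_mixing X P \<mu> \<Xi>" "s > 0"
  shows "\<exists>t>0. \<Xi> t \<le> s"
proof -
  have "(\<Xi> \<longlongrightarrow> 0) at_top" using assms(1) by (simp add: beta_mixing_def)
  then have "\<forall>\<^sub>F t in at_top. \<Xi> t < s" using assms(2) by (intro order_tendstoD) auto
  then have "\<forall>\<^sub>F t in at_top. \<Xi> t < s \<and> 0 < t" using eventually_gt_at_top[of 0] by eventually_elim auto
  then obtain t where "\<Xi> t < s" "0 < t" using eventually_happens by fastforce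
  then show ?thesis by (intro exI[of _ t]) simp
qed

text \<open>
  The strict inequality matters: at \<open>rate_inv \<Xi> s\<close> itself \<open>\<Xi>\<close> may still exceed \<open>s\<close>, as it need not be
  right continuous.
\<close>

lemma rate_le_beyond_rate_inv:
  assumes mix: "beta_mixing X P \<mu> \<Xi>" and s: "s > 0" and a: "rate_inv \<Xi> s < a"
  shows "\<Xi> a \<le> s"
proof -
  have "{t. 0 < t \<and> \<Xi> t \<le> s} \<noteq> {}" using rate_inv_set_nonempty[OF mix s] by auto
  then obtain t where t: "0 < t" "\<Xi> t \<le> s" "t < a"
    using cInf_lessD[of "{t. 0 < t \<and> \<Xi> t \<le> s}" a] a unfolding rate_inv_def by auto
  have "antimono_on {0<..} \<Xi>" using mix by (simp add: beta_mixing_def)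
  from monotone_onD[OF this, of t a] have "\<Xi> a \<le> \<Xi> t" using t by simp
  then show ?thesis using t by simp
qed

lemma rate_inv_ge:
  assumes mix: "beta_mixing X P \<mu> \<Xi>" and \<Xi>: "strict_antimono_on {0<..} \<Xi>" and s: "s > 0"
    and b: "b > 0" "s < \<Xi> b"
  shows "b \<le> rate_inv \<Xi> s"
  unfolding rate_inv_def
proof (rule cInf_greatest)
  show "{t. 0 < t \<and> \<Xi> t \<le> s} \<noteq> {}" using rate_inv_set_nonempty[OF mix s] by auto
  fix t assume "t \<in> {t. 0 < t \<and> \<Xi> t \<le> s}"
  then have t: "0 < t" "\<Xi> t \<le> s" by auto
  show "b \<le> t"
  proof (rule ccontr)
    assume "\<not> b \<le> t"
    then have "\<Xi> b < \<Xi> t" using monotone_onD[OF \<Xi>, of t b] t by simp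
    then show False using t b by simp
  qed
qed

lemma rate_inv_le: "0 < t \<Longrightarrow> \<Xi> t \<le> s \<Longrightarrow> rate_inv \<Xi> s \<le> t"
  unfolding rate_inv_def by (intro cInf_lower bdd_belowI[of _ 0]) auto

lemma rate_inv_nonneg: "\<exists>t>0. \<Xi> t \<le> s \<Longrightarrow> 0 \<le> rate_inv \<Xi> s"
  unfolding rate_inv_def by (intro cInf_greatest) auto

text \<open>
  The interval is divided into an even number of equal blocks without remainder; rounding costs at most a
  factor 2 in the block length because at least two pairs of blocks of length \<open>2 * \<tau>\<close> fit.
\<close>

lemma block_length:
  fixes T \<tau> :: real
  assumes "\<tau> > 0" "8 * \<tau> \<le> T"
  obtains n a where "n > 0" "T = 2 * real n * a" "2 * \<tau> \<le> a" "a \<le> 4 * \<tau>" "real n \<le> T / (4 * \<tau>)"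
proof -
  define n where "n = nat \<lfloor>T / (4 * \<tau>)\<rfloor>"
  have x: "2 \<le> T / (4 * \<tau>)" using assms by (simp add: field_simps)
  then have fl: "0 \<le> \<lfloor>T / (4 * \<tau>)\<rfloor>" by simp
  have n1: "real n \<le> T / (4 * \<tau>)" using fl by (simp add: n_def)
  have n2: "T / (4 * \<tau>) - 1 \<le> real n" using fl by (simp add: n_def)
  have n3: "T / (8 * \<tau>) \<le> real n" using n2 x assms by (simp add: field_simps)
  have n0: "n > 0" using n2 x by (cases n) auto
  show thesis
  proof (rule that[OF n0, of "T / (2 * real n)"])
    show "T = 2 * real n * (T / (2 * real n))" using n0 by simp
    show "2 * \<tau> \<le> T / (2 * real n)" using n1 n0 assms by (simp add: field_simps)
    show "T / (2 * real n) \<le> 4 * \<tau>" using n3 n0 assms by (simp add: field_simps)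
  qed (rule n1)
qed

context kernel_estimation
begin

text \<open>
  Here the block length is coupled to \<open>T\<close>. The condition \<open>\<Xi>\<^sup>-\<^sup>1 (T powr (- u)) \<in> o(T)\<close> makes room for
  the blocks, \<open>h \<ge> T powr (- 2)\<close> bounds \<open>ln (1 / h)\<close> by \<open>2 * ln T\<close> in the first term, and
  \<open>\<Xi>\<^sup>-\<^sup>1 (T powr (- u)) \<ge> 3\<close>, which holds for large \<open>T\<close>, absorbs the mixing error.
\<close>

lemma eventually_deviation_event:
  fixes D :: "(real ^ 'd) set"
  assumes short: "short_time_bound p"
    and long: "local_uniform_convergence \<mu> p \<rho> \<or> (CARD('d) \<ge> 2 \<and> exponentially_beta_mixing X P \<mu>)"
    and D: "bounded D" "D \<noteq> {}"
    and mix: "beta_mixing X P \<mu> \<Xi>" and \<Xi>: "strict_antimono_on {0<..} \<Xi>"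
  obtains c where "c > 0"
    "\<And>u h. \<forall>\<^sub>F T in at_top. 1 \<le> u T \<Longrightarrow> (\<lambda>T. rate_inv \<Xi> (T powr (- u T))) \<in> o(\<lambda>T. T) \<Longrightarrow>
      \<forall>\<^sub>F T in at_top. T powr (- 2) \<le> h T \<Longrightarrow> h \<in> o(\<lambda>_. 1) \<Longrightarrow>
      \<forall>\<^sub>F T in at_top. outer_prob_le Q {\<omega> \<in> space M.
        deviation K X Q D (h T) T \<omega> \<ge> c * deviation_threshold CARD('d) \<Xi> (h T) T (u T)} (exp (- u T))"
proof -
  let ?kde = "\<lambda>h T x \<omega>. kde K X h T x \<omega> - (\<integral>\<omega>'. kde K X h T x \<omega>' \<partial>Q)"
  obtain C where C: "C > 0" and bound:
    "\<And>\<Xi> h u a n T. beta_mixing X P \<mu> \<Xi> \<Longrightarrow> \<Xi> a \<ge> 0 \<Longrightarrow> 0 < h \<Longrightarrow> h < 1 \<Longrightarrow> u \<ge> 1 \<Longrightarrow> a > 0 \<Longrightarrow> n > 0 \<Longrightarrow>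
      T = 2 * real n * a \<Longrightarrow>
      \<exists>bad\<in>sets M. measure Q bad \<le> exp (- u) / 2 + 2 * real n * \<Xi> a \<and>
        (\<forall>\<omega>\<in>space M - bad. \<forall>x\<in>D. \<bar>?kde h T x \<omega>\<bar>
          \<le> C * (max u (ln (1 / h)) * a / (T * h ^ CARD('d))
            + T powr (- 1 / 2) * psi CARD('d) (h ^ CARD('d)) * sqrt (max u (ln (1 / h)))))"
    by (fact uniform_deviation_bound[OF short long D(1)])
  show thesis
  proof (rule that[of "9 * C"])
    show "9 * C > 0" using C by simp
    fix u h :: "real \<Rightarrow> real"
    assume u: "\<forall>\<^sub>F T in at_top. 1 \<le> u T" and \<tau>o: "(\<lambda>T. rate_inv \<Xi> (T powr (- u T))) \<in> o(\<lambda>T. T)"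
      and hT: "\<forall>\<^sub>F T in at_top. T powr (- 2) \<le> h T" and ho: "h \<in> o(\<lambda>_. 1)"
    have "(h \<longlongrightarrow> 0) at_top" using smalloD_tendsto[OF ho] by simp
    then have h1: "\<forall>\<^sub>F T in at_top. h T < 1" by (intro order_tendstoD) auto
    have "\<forall>\<^sub>F T in at_top. rate_inv \<Xi> (T powr (- u T)) / T < 1 / 8"
      using smalloD_tendsto[OF \<tau>o] by (intro order_tendstoD) auto
    moreover have "\<Xi> 3 > 0" by (rule rate_pos[OF mix \<Xi>]) simp
    then have "\<forall>\<^sub>F T in at_top. inverse T < \<Xi> 3"
      using tendsto_inverse_0_at_top[OF filterlim_ident] by (intro order_tendstoD) auto
    ultimately show "\<forall>\<^sub>F T in at_top. outer_prob_le Q {\<omega> \<in> space M.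
        deviation K X Q D (h T) T \<omega> \<ge> 9 * C * deviation_threshold CARD('d) \<Xi> (h T) T (u T)} (exp (- u T))"
      using u hT h1 eventually_ge_at_top[of "exp 1"]
    proof eventually_elim
      case (elim T)
      define \<tau> where "\<tau> = rate_inv \<Xi> (T powr (- u T))"
      define A where "A = max (u T) (ln (1 / h T))"
      have T1: "1 < T" using elim one_less_exp_iff[of "1::real"] by linarith
      then have T0: "T > 0" by simp
      have lnT: "1 \<le> ln T" using elim T0 by (simp add: ln_ge_iff)
      have h0: "0 < h T" by (rule less_le_trans[OF _ elim(4)]) (use T0 in simp)
      have s0: "T powr (- u T) > 0" using T0 by simp
      \<comment> \<open>any fixed number above \<open>exp 1\<close> would do in place of 3\<close>
      have "T powr (- u T) \<le> T powr (- 1)" using elim T1 by (intro powr_mono) auto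
      also have "\<dots> < \<Xi> 3" using elim T0 by (simp add: powr_minus inverse_eq_divide)
      finally have \<tau>3: "3 \<le> \<tau>" unfolding \<tau>_def by (intro rate_inv_ge[OF mix \<Xi> s0]) auto
      have \<tau>T: "8 * \<tau> \<le> T" using elim T0 by (simp add: \<tau>_def field_simps)
      obtain n a where n: "n > 0" and Tn: "T = 2 * real n * a" and a: "2 * \<tau> \<le> a" "a \<le> 4 * \<tau>"
        and n_le: "real n \<le> T / (4 * \<tau>)"
        using block_length[of \<tau> T] \<tau>3 \<tau>T by auto
      have a0: "a > 0" using a \<tau>3 by linarith
      have \<Xi>a: "\<Xi> a \<le> T powr (- u T)"
        using a \<tau>3 by (intro rate_le_beyond_rate_inv[OF mix s0]) (auto simp: \<tau>_def)
      have \<Xi>a0: "\<Xi> a \<ge> 0" by (rule rate_nonneg[OF mix a0])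
      have "h T < 1" "1 \<le> u T" using elim by auto
      from bound[OF mix \<Xi>a0 h0 this a0 n Tn, folded A_def]
      obtain bad where bad: "bad \<in> sets M" "measure Q bad \<le> exp (- u T) / 2 + 2 * real n * \<Xi> a"
        and good: "\<forall>\<omega>\<in>space M - bad. \<forall>x\<in>D. \<bar>?kde (h T) T x \<omega>\<bar>
          \<le> C * (A * a / (T * h T ^ CARD('d)) + T powr (- 1 / 2) * psi CARD('d) (h T ^ CARD('d)) * sqrt A)"
        by (elim bexE conjE)
      have "2 * real n * \<Xi> a \<le> 2 * (T / (4 * \<tau>)) * T powr (- u T)"
        using n_le \<Xi>a \<Xi>a0 T0 \<tau>3 by (intro mult_mono) auto
      also have "\<dots> = T powr (1 - u T) / (2 * \<tau>)"
        using T0 by (simp add: powr_diff powr_minus field_simps)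
      also have "\<dots> \<le> exp 1 powr (1 - u T) / (2 * exp 1)"
      proof (rule frac_le)
        show "T powr (1 - u T) \<le> exp 1 powr (1 - u T)" using elim by (intro powr_mono2') auto
        show "2 * exp 1 \<le> 2 * \<tau>" using \<tau>3 exp_le by linarith
      qed auto
      also have "\<dots> = exp (- u T) / 2" by (simp add: exp_powr_real exp_diff exp_minus field_simps)
      finally have mbad: "measure Q bad \<le> exp (- u T)" using bad(2) by linarith
      define \<psi> where "\<psi> = psi CARD('d) (h T ^ CARD('d))"
      have "0 \<le> ln (1 / (h T)\<^sup>2)" using h0 elim by (simp add: power_le_one)
      then have \<psi>: "\<psi> \<ge> 0" by (simp add: \<psi>_def psi_def)
      define thr where "thr = (u T + ln T) / (T * h T ^ CARD('d)) * \<tau> + T powr (- 1/2) * \<psi> * sqrt A"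
      have thr0: "thr > 0"
        unfolding thr_def using elim lnT T1 h0 \<tau>3 \<psi> by (intro add_pos_nonneg mult_pos_pos divide_pos_pos) (auto simp: A_def)
      have A: "A \<le> 2 * (u T + ln T)"
      proof -
        have "ln (T powr (- 2)) \<le> ln (h T)" using elim T0 h0 by (subst ln_le_cancel_iff) auto
        then have "ln (1 / h T) \<le> 2 * ln T" using h0 T0 by (simp add: ln_div ln_powr)
        then show ?thesis using elim lnT by (simp add: A_def)
      qed
      have "C * (A * a / (T * h T ^ CARD('d)) + T powr (- 1 / 2) * \<psi> * sqrt A) \<le> C * (8 * thr)"
      proof (rule mult_left_mono)
        have "A * a \<le> (2 * (u T + ln T)) * (4 * \<tau>)"
          using A a a0 elim lnT by (intro mult_mono) auto
        then have "A * a / (T * h T ^ CARD('d)) \<le> (2 * (u T + ln T)) * (4 * \<tau>) / (T * h T ^ CARD('d))"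
          using T0 h0 by (intro divide_right_mono) auto
        also have "\<dots> = 8 * ((u T + ln T) / (T * h T ^ CARD('d)) * \<tau>)" by simp
        finally have 1: "A * a / (T * h T ^ CARD('d)) \<le> 8 * ((u T + ln T) / (T * h T ^ CARD('d)) * \<tau>)" .
        have "0 \<le> T powr (- 1 / 2) * \<psi> * sqrt A" using \<psi> elim by (simp add: A_def)
        then show "A * a / (T * h T ^ CARD('d)) + T powr (- 1 / 2) * \<psi> * sqrt A \<le> 8 * thr"
          unfolding thr_def distrib_left by (intro add_mono 1) linarith
      qed (use C in simp)
      also have "\<dots> < 9 * C * thr" using C thr0 by simp
      finally have lt: "C * (A * a / (T * h T ^ CARD('d)) + T powr (- 1 / 2) * \<psi> * sqrt A) < 9 * C * thr" .
      have "{\<omega> \<in> space M. deviation K X Q D (h T) T \<omega> \<ge> 9 * C * thr} \<subseteq> bad"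
      proof (safe, rule ccontr)
        fix \<omega> assume w: "\<omega> \<in> space M" "9 * C * thr \<le> deviation K X Q D (h T) T \<omega>" "\<omega> \<notin> bad"
        have "deviation K X Q D (h T) T \<omega>
            \<le> C * (A * a / (T * h T ^ CARD('d)) + T powr (- 1 / 2) * \<psi> * sqrt A)"
          unfolding deviation_def sup_norm_on_def \<psi>_def
          using w D(2) by (intro cSUP_least good[rule_format]) auto
        then show False using lt w by linarith
      qed
      then show ?case
        using bad(1) mbad unfolding outer_prob_le_def deviation_threshold_def thr_def \<tau>_def \<psi>_def A_def
        by (intro bexI[of _ bad] conjI) auto
    qed
  qed
qed

end

lemma exponential_rate_strict_antimono: "exponential_rate \<Xi> \<Longrightarrow> strict_antimono_on {0<..} \<Xi>"
  by (auto simp: exponential_rate_def monotone_on_def)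

text \<open>
  For an exponential rate the inverse at \<open>T powr (- u)\<close> is of the order \<open>u * ln T\<close>; this is where the
  factor \<open>(ln T)\<^sup>2\<close> of \<open>Upsilon\<close> comes from.
\<close>

lemma exponential_rate_inv_bound:
  assumes \<Xi>: "\<Xi> = (\<lambda>t. c * exp (- \<kappa> * t))" "c > 0" "\<kappa> > 0" and T: "exp 1 \<le> T" "c \<le> T" and u: "1 \<le> u"
  shows "0 \<le> rate_inv \<Xi> (T powr (- u))" "rate_inv \<Xi> (T powr (- u)) \<le> 2 * u * ln T / \<kappa>"
proof -
  have T0: "T > 0" using T(1) exp_gt_zero[of "1::real"] by linarith
  have T1: "T \<ge> 1" using T(1) one_le_exp_iff[of "1::real"] by linarith
  have lnT: "1 \<le> ln T" using T(1) T0 by (simp add: ln_ge_iff)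
  let ?t = "2 * u * ln T / \<kappa>"
  have t: "?t > 0" using \<Xi> u lnT by simp
  have "c \<le> T powr 1" using T T0 by simp
  also have "\<dots> \<le> T powr u" using u T1 by (intro powr_mono) auto
  finally have "c * T powr (- 2 * u) \<le> T powr u * T powr (- 2 * u)" by (intro mult_right_mono) auto
  also have "\<dots> = T powr (- u)" by (simp flip: powr_add)
  also have "c * T powr (- 2 * u) = \<Xi> ?t" using \<Xi> T0 by (simp add: powr_def mult_ac)
  finally have le: "\<Xi> ?t \<le> T powr (- u)" .
  show "rate_inv \<Xi> (T powr (- u)) \<le> ?t" using t le by (rule rate_inv_le)
  show "0 \<le> rate_inv \<Xi> (T powr (- u))" using t le by (intro rate_inv_nonneg exI[of _ ?t]) simp
qed

theorem lemma3p4: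
  fixes M :: "'w measure"
    and X :: "real \<Rightarrow> 'w \<Rightarrow> real ^ 'd"
    and P :: "real ^ 'd \<Rightarrow> 'w measure"
    and \<mu> :: "(real ^ 'd) measure"
    and \<Xi> :: "real \<Rightarrow> real"
    and K :: "real ^ 'd \<Rightarrow> real"
    and D :: "(real ^ 'd) set"
  assumes D: "open D" "connected D" "D \<noteq> {}" "bounded D"
    and K: "smooth_kernel K"
    and X: "(class_Theta M X P \<mu> \<and> beta_mixing X P \<mu> \<Xi> \<and> strict_antimono_on {0<..} \<Xi>) \<or>
            (class_Sigma M X P \<mu> \<and> beta_mixing X P \<mu> \<Xi> \<and> exponential_rate \<Xi>)"
  shows
    "(\<forall>u h :: real \<Rightarrow> real.
        (\<forall>\<^sub>F T in at_top. 1 \<le> u T) \<and>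
        (\<lambda>T. rate_inv \<Xi> (T powr (- u T))) \<in> o(\<lambda>T. T) \<and>
        (\<forall>\<^sub>F T in at_top. T powr (- 2) \<le> h T) \<and> h \<in> o(\<lambda>_. 1) \<longrightarrow>
        (\<exists>c>0. \<forall>\<^sub>F T in at_top.
           measure (\<mu> \<bind> P)
             {\<omega> \<in> space M. deviation K X (\<mu> \<bind> P) D (h T) T \<omega> \<ge>
                c * ((u T + ln T) / (T * h T ^ CARD('d)) * rate_inv \<Xi> (T powr (- u T)) +
                     T powr (- 1/2) * psi CARD('d) (h T ^ CARD('d)) *
                       sqrt (max (u T) (ln (1 / h T))))}
           \<le> exp (- u T))) \<and>
     (class_Sigma M X P \<mu> \<longrightarrow>
       (\<forall>\<gamma>>0. \<exists>c>0. \<forall>u h :: real \<Rightarrow> real.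
          (\<forall>\<^sub>F T in at_top. 1 \<le> u T \<and> u T \<le> \<gamma> * ln T) \<and>
          (\<forall>\<^sub>F T in at_top. T powr (- 2) \<le> h T) \<and> h \<in> o(\<lambda>_. 1) \<longrightarrow>
          (\<forall>\<^sub>F T in at_top.
             measure (\<mu> \<bind> P)
               {\<omega> \<in> space M. deviation K X (\<mu> \<bind> P) D (h T) T \<omega> \<ge>
                  c * Upsilon CARD('d) (h T) T (u T)}
             \<le> exp (- u T))))"
proof -
  obtain L B where LB: "L \<ge> 0" "B \<ge> 0" "\<And>x y. \<bar>K x - K y\<bar> \<le> L * norm (x - y)" "\<And>x. \<bar>K x\<bar> \<le> B"
    by (rule smooth_kernel_bounds[OF K]) blast
  let ?exceeds = "\<lambda>h T c. {\<omega> \<in> space M. deviation K X (\<mu> \<bind> P) D (h T) T \<omega> \<ge> c}"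
  let ?thr = "\<lambda>\<Xi> u h T. deviation_threshold CARD('d) \<Xi> (h T) T (u T)"
  have core: "prob_space (\<mu> \<bind> P) \<and> (\<exists>c>0. \<forall>u h.
      (\<forall>\<^sub>F T in at_top. 1 \<le> u T) \<longrightarrow> (\<lambda>T. rate_inv \<Xi>' (T powr (- u T))) \<in> o(\<lambda>T. T) \<longrightarrow>
      (\<forall>\<^sub>F T in at_top. T powr (- 2) \<le> h T) \<longrightarrow> h \<in> o(\<lambda>_. 1) \<longrightarrow>
      (\<forall>\<^sub>F T in at_top. outer_prob_le (\<mu> \<bind> P) (?exceeds h T (c * ?thr \<Xi>' u h T)) (exp (- u T))))"
    if cls: "class_Theta M X P \<mu> \<or> class_Sigma M X P \<mu>" and mix: "beta_mixing X P \<mu> \<Xi>'"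
      and anti: "strict_antimono_on {0<..} \<Xi>'" for \<Xi>'
  proof -
    obtain p \<rho> where proc: "borel_right_process M X P" and basic: "basic_assumption X P \<mu> p \<rho>"
      and short: "short_time_bound p"
      and long: "local_uniform_convergence \<mu> p \<rho> \<or> (CARD('d) \<ge> 2 \<and> exponentially_beta_mixing X P \<mu>)"
      using cls
    proof
      assume "class_Theta M X P \<mu>"
      then show thesis using that unfolding class_Theta_def by blast
    next
      assume S: "class_Sigma M X P \<mu>"
      then obtain p \<rho> where p: "basic_assumption X P \<mu> p \<rho>" "short_time_bound p"
        "DIM(real ^ 'd) = 1 \<longrightarrow> local_uniform_convergence \<mu> p \<rho>"
        unfolding class_Sigma_def by blast
      have e: "borel_right_process M X P" "exponentially_beta_mixing X P \<mu>" using S unfolding class_Sigma_def by auto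
      have "CARD('d) = 1 \<or> CARD('d) \<ge> 2" using zero_less_card_finite[where 'a='d] by linarith
      then show thesis using that p e by auto
    qed
    have inv: "invariant_distribution X P \<mu>" using basic unfolding basic_assumption_def by (elim conjE)
    interpret kernel_estimation M X P \<mu> p \<rho> K L B
      by unfold_locales (fact proc inv basic K LB)+
    obtain c where c: "c > 0" and ev: "\<And>u h. \<forall>\<^sub>F T in at_top. 1 \<le> u T \<Longrightarrow> (\<lambda>T. rate_inv \<Xi>' (T powr (- u T))) \<in> o(\<lambda>T. T) \<Longrightarrow>
      \<forall>\<^sub>F T in at_top. T powr (- 2) \<le> h T \<Longrightarrow> h \<in> o(\<lambda>_. 1) \<Longrightarrow>
      \<forall>\<^sub>F T in at_top. outer_prob_le Q (?exceeds h T (c * ?thr \<Xi>' u h T)) (exp (- u T))"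
      by (fact eventually_deviation_event[OF short long D(4,3) mix anti])
    show ?thesis
      by (intro conjI exI[of _ c] c allI impI prob_space_Q) (rule ev)
  qed
  show ?thesis
  proof (intro conjI allI impI, goal_cases)
    case (1 u h)
    have cls: "class_Theta M X P \<mu> \<or> class_Sigma M X P \<mu>" "beta_mixing X P \<mu> \<Xi>" "strict_antimono_on {0<..} \<Xi>"
      using X exponential_rate_strict_antimono by auto
    note core = core[OF cls]
    from core obtain c where c: "c > 0"
      and ev: "\<forall>\<^sub>F T in at_top. outer_prob_le (\<mu> \<bind> P) (?exceeds h T (c * ?thr \<Xi> u h T)) (exp (- u T))"
      using 1 by blast
    show ?case
      unfolding deviation_threshold_def[symmetric]
      using ev c by (intro exI[of _ c] conjI) (auto elim!: eventually_mono intro: measure_le_outer_prob[OF conjunct1[OF core]])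
  next
    case (2 \<gamma>)
    \<comment> \<open>the exponential rate that comes with the class; \<open>\<Xi>\<close> may be a different rate\<close>
    then obtain \<Xi>' where mix: "beta_mixing X P \<mu> \<Xi>'" and exp: "exponential_rate \<Xi>'"
      by (auto simp: class_Sigma_def exponentially_beta_mixing_def)
    obtain c0 \<kappa> where \<Xi>': "\<Xi>' = (\<lambda>t. c0 * exp (- \<kappa> * t))" "c0 > 0" "\<kappa> > 0"
      using exp by (auto simp: exponential_rate_def)
    note core = core[OF disjI2[OF 2(1)] mix exponential_rate_strict_antimono[OF exp]]
    then obtain c where c: "c > 0" and ev: "\<forall>u h.
      (\<forall>\<^sub>F T in at_top. 1 \<le> u T) \<longrightarrow> (\<lambda>T. rate_inv \<Xi>' (T powr (- u T))) \<in> o(\<lambda>T. T) \<longrightarrow>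
      (\<forall>\<^sub>F T in at_top. T powr (- 2) \<le> h T) \<longrightarrow> h \<in> o(\<lambda>_. 1) \<longrightarrow>
      (\<forall>\<^sub>F T in at_top. outer_prob_le (\<mu> \<bind> P) (?exceeds h T (c * ?thr \<Xi>' u h T)) (exp (- u T)))"
      by blast
    define k where "k = 1 + (\<gamma> + 1) * (2 / \<kappa>)"
    have k: "k \<ge> 1" using 2(2) \<Xi>' by (simp add: k_def)
    show ?case
    proof (intro exI[of _ "c * k"] conjI allI impI)
      show "c * k > 0" using c k by simp
      fix u h :: "real \<Rightarrow> real"
      assume uh: "(\<forall>\<^sub>F T in at_top. 1 \<le> u T \<and> u T \<le> \<gamma> * ln T) \<and>
          (\<forall>\<^sub>F T in at_top. T powr (- 2) \<le> h T) \<and> h \<in> o(\<lambda>_. 1)"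
      then have u: "\<forall>\<^sub>F T in at_top. 1 \<le> u T \<and> u T \<le> \<gamma> * ln T"
        and h: "\<forall>\<^sub>F T in at_top. T powr (- 2) \<le> h T" "h \<in> o(\<lambda>_. 1)" by auto
      have u1: "\<forall>\<^sub>F T in at_top. 1 \<le> u T" using u by eventually_elim simp
      have inv: "\<forall>\<^sub>F T in at_top. 0 \<le> rate_inv \<Xi>' (T powr (- u T)) \<and> rate_inv \<Xi>' (T powr (- u T)) \<le> 2 * u T * ln T / \<kappa>"
        using u1 eventually_ge_at_top[of "exp 1"] eventually_ge_at_top[of c0]
        by eventually_elim (auto intro!: exponential_rate_inv_bound[OF \<Xi>'])
      have o: "(\<lambda>T. rate_inv \<Xi>' (T powr (- u T))) \<in> o(\<lambda>T. T)"
      proof (rule smalloI_tendsto)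
        have "((\<lambda>T::real. ln T ^ 2 / exp (ln T)) \<longlongrightarrow> 0) at_top"
          by (rule filterlim_compose[OF tendsto_power_div_exp_0 ln_at_top])
        then have "((\<lambda>T::real. 2 * \<gamma> / \<kappa> * (ln T ^ 2 / exp (ln T))) \<longlongrightarrow> 2 * \<gamma> / \<kappa> * 0) at_top"
          by (intro tendsto_intros)
        then have lim: "((\<lambda>T::real. 2 * \<gamma> / \<kappa> * (ln T ^ 2 / exp (ln T))) \<longlongrightarrow> 0) at_top" by simp
        show "((\<lambda>T. rate_inv \<Xi>' (T powr (- u T)) / T) \<longlongrightarrow> 0) at_top"
        proof (rule tendsto_sandwich[OF _ _ tendsto_const lim])
          show "\<forall>\<^sub>F T in at_top. 0 \<le> rate_inv \<Xi>' (T powr (- u T)) / T"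
            using inv eventually_gt_at_top[of 0] by eventually_elim simp
          show "\<forall>\<^sub>F T in at_top. rate_inv \<Xi>' (T powr (- u T)) / T \<le> 2 * \<gamma> / \<kappa> * (ln T ^ 2 / exp (ln T))"
            using inv u eventually_ge_at_top[of 1]
          proof eventually_elim
            case (elim T)
            have "2 * u T * ln T / \<kappa> \<le> 2 * (\<gamma> * ln T) * ln T / \<kappa>"
              using elim \<Xi>' by (intro divide_right_mono mult_right_mono) auto
            then have "rate_inv \<Xi>' (T powr (- u T)) \<le> 2 * \<gamma> / \<kappa> * (ln T)\<^sup>2"
              using elim by (simp add: power2_eq_square mult_ac)
            then have "rate_inv \<Xi>' (T powr (- u T)) / T \<le> 2 * \<gamma> / \<kappa> * (ln T)\<^sup>2 / T"
              using elim by (intro divide_right_mono) auto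
            then show ?case using elim by simp
          qed
        qed
        show "\<forall>\<^sub>F T::real in at_top. T \<noteq> 0" by (rule eventually_at_top_not_equal)
      qed
      have "(h \<longlongrightarrow> 0) at_top" using smalloD_tendsto[OF h(2)] by simp
      then have h1: "\<forall>\<^sub>F T in at_top. h T < 1" by (intro order_tendstoD) auto
      have "\<forall>\<^sub>F T in at_top. outer_prob_le (\<mu> \<bind> P) (?exceeds h T (c * ?thr \<Xi>' u h T)) (exp (- u T))"
        using ev u1 o h by blast
      then show "\<forall>\<^sub>F T in at_top.
             measure (\<mu> \<bind> P)
               {\<omega> \<in> space M. deviation K X (\<mu> \<bind> P) D (h T) T \<omega> \<ge>
                  c * k * Upsilon CARD('d) (h T) T (u T)}
             \<le> exp (- u T)"
        using u inv h(1) h1 eventually_ge_at_top[of "exp 1"]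
      proof eventually_elim
        case (elim T)
        have T0: "T > 0" using elim exp_gt_zero[of "1::real"] by linarith
        have lnT: "1 \<le> ln T" using elim T0 by (simp add: ln_ge_iff)
        have h0: "0 < h T" by (rule less_le_trans[OF _ elim(4)]) (use T0 in simp)
        let ?den = "T * h T ^ CARD('d)"
        have den: "?den > 0" using T0 h0 by simp
        have "(u T + ln T) * rate_inv \<Xi>' (T powr (- u T)) \<le> ((\<gamma> + 1) * ln T) * (2 * u T * ln T / \<kappa>)"
          using elim lnT 2(2) by (intro mult_mono) (auto simp: algebra_simps)
        also have "\<dots> = (\<gamma> + 1) * (2 / \<kappa>) * (u T * (ln T)\<^sup>2)" by (simp add: power2_eq_square)
        also have "\<dots> \<le> k * (u T * (ln T)\<^sup>2)"
          using elim by (intro mult_right_mono) (auto simp: k_def)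
        finally have "(u T + ln T) * rate_inv \<Xi>' (T powr (- u T)) / ?den \<le> k * (u T * (ln T)\<^sup>2) / ?den"
          using den by (intro divide_right_mono) auto
        then have 1: "(u T + ln T) / ?den * rate_inv \<Xi>' (T powr (- u T)) \<le> k * (u T * (ln T)\<^sup>2 / ?den)" by simp
        have "0 \<le> ln (1 / (h T)\<^sup>2)" using h0 elim by (simp add: power_le_one)
        then have "0 \<le> psi CARD('d) (h T ^ CARD('d))" by (simp add: psi_def)
        then have "0 \<le> T powr (- 1/2) * psi CARD('d) (h T ^ CARD('d)) * sqrt (max (u T) (ln (1 / h T)))"
          using elim by (intro mult_nonneg_nonneg) (auto simp: le_max_iff_disj)
        from mult_right_mono[OF k this]
        have "?thr \<Xi>' u h T \<le> k * Upsilon CARD('d) (h T) T (u T)"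
          using 1 unfolding deviation_threshold_def Upsilon_def by (simp add: distrib_left)
        then have le: "c * ?thr \<Xi>' u h T \<le> c * k * Upsilon CARD('d) (h T) T (u T)"
          using c by (simp add: mult.assoc)
        then have "?exceeds h T (c * k * Upsilon CARD('d) (h T) T (u T)) \<subseteq> ?exceeds h T (c * ?thr \<Xi>' u h T)"
          by auto
        from outer_prob_le_subset[OF elim(1) this] show ?case
          by (rule measure_le_outer_prob[OF conjunct1[OF core]])
      qed
    qed
  qed
qed

end
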